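(* Let $\Omega\subset\mathbb{C}^n$ be a bounded domain and let $\psi\geq 0$ be a continuous function on $\overline{\Omega}\times\mathbb{R}$ which is non-decreasing in the last variable. Let $\Gamma$, $f$, $F$ be as in the context. Let $u:\overline\Omega\to\mathbb{R}$ be bounded and upper semicontinuous and $v:\overline\Omega\to\mathbb{R}$ be bounded and lower semicontinuous, and suppose that $u$ is a viscosity subsolution and $v$ is a viscosity supersolution of $$F(Hw)=\psi(z,w)$$ in $\Omega$. Assume that $u\le v$ on $\partial\Omega$ and that $$\lim_{R\to\infty}f(R,R,\dots,R)>\sup_{z\in K}\psi(z,v(z))$$ for every $K\Subset\Omega$. Then $u\le v$ in $\Omega$.
   Context: Cone and operator. For $1\le k\le n$ let $\sigma_k(x)=\sum_{1\le j_1<\dots<j_k\le n}x_{j_1}\cdots x_{j_k}$ and $\Gamma_k=\{x\in\mathbb{R}^n:\sigma_1(x)>0,\dots,\sigma_k(x)>0\}$. $\Gamma\subsetneq\mathbb{R}^n$ is an open, convex, symmetric (permutation invariant) cone with vertex at the origin with $\Gamma_n\subseteq\Gamma\subseteq\Gamma_1$. $f:\overline{\Gamma}\to[0,\infty)$ is continuous, symmetric, concave, strictly increasing in each variable on $\Gamma$, with $f>0$ on $\Gamma$ and $f=0$ on $\partial\Gamma$. $\mathcal{H}^n$ is the set of $n\times n$ Hermitian matrices, $\lambda(H)\in\mathbb{R}^n$ denotes the eigenvalues of $H$, $M(\Gamma,n)=\{H\in\mathcal{H}^n:\lambda(H)\in\Gamma\}$, and $F:\mathcal{H}^n\to[-\infty,\infty)$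 is $F(H)=f(\lambda(H))$ if $H\in\overline{M(\Gamma,n)}$ and $F(H)=-\infty$ otherwise. $Hu=\left(\frac{\partial^2u}{\partial z_\alpha\partial\overline{z_\beta}}\right)$ is the complex Hessian. Viscosity sub/supersolutions. An upper (resp. lower) test function for $w$ at $z_0$ is a $C^2$ function $q$ near $z_0$ with $w(z_0)=q(z_0)$ and $w\le q$ (resp. $w\ge q$) near $z_0$. An upper semicontinuous $u$ is a viscosity subsolution of $F(Hw)=\psi(z,w)$ in $\Omega$ if $F(Hq(z_0))\ge\psi(z_0,u(z_0))$ for every $z_0\in\Omega$ and every upper test function $q$ for $u$ at $z_0$. A lower semicontinuous $v$ is a viscosity supersolution if $F(Hq(z_0))\le\psi(z_0,v(z_0))$ for every $z_0\in\Omega$ and every lower test function $q$ for $v$ at $z_0$. *)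

theory Defs
  imports "HOL-Analysis.Analysis"
begin

section \<open>The cone and the operator\<close>

definition elem_sym :: "nat \<Rightarrow> real ^ 'n \<Rightarrow> real" where
  "elem_sym k x = (\<Sum>S | S \<subseteq> UNIV \<and> card S = k. \<Prod>j\<in>S. x $ j)"

definition Garding_cone :: "nat \<Rightarrow> (real ^ 'n) set" where
  "Garding_cone k = {x. \<forall>j\<in>{1..k}. elem_sym j x > 0}"

definition permute_coords :: "('n \<Rightarrow> 'n) \<Rightarrow> real ^ 'n \<Rightarrow> real ^ 'n" where
  "permute_coords p x = (\<chi> i. x $ p i)"

text \<open>
  The library predicates \<^const>\<open>cone\<close> and \<^const>\<open>conic\<close> force the vertex 0 to belong to a
  nonempty cone, which is impossible for an open proper cone; hence the scaling by strictly
  positive factors here.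
\<close>

definition admissible_cone :: "(real ^ 'n) set \<Rightarrow> bool" where
  "admissible_cone \<Gamma> \<longleftrightarrow>
     open \<Gamma> \<and> convex \<Gamma> \<and> \<Gamma> \<noteq> UNIV \<and>
     (\<forall>x\<in>\<Gamma>. \<forall>t>0. t *\<^sub>R x \<in> \<Gamma>) \<and>
     (\<forall>p. bij p \<longrightarrow> (\<forall>x\<in>\<Gamma>. permute_coords p x \<in> \<Gamma>)) \<and>
     Garding_cone CARD('n) \<subseteq> \<Gamma> \<and> \<Gamma> \<subseteq> Garding_cone 1"

definition admissible_function :: "(real ^ 'n) set \<Rightarrow> (real ^ 'n \<Rightarrow> real) \<Rightarrow> bool" where
  "admissible_function \<Gamma> f \<longleftrightarrow>
     (\<forall>x\<in>closure \<Gamma>. f x \<ge> 0) \<and>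
     continuous_on (closure \<Gamma>) f \<and>
     (\<forall>p. bij p \<longrightarrow> (\<forall>x\<in>closure \<Gamma>. f (permute_coords p x) = f x)) \<and>
     concave_on (closure \<Gamma>) f \<and>
     (\<forall>x\<in>\<Gamma>. \<forall>i. \<forall>t>0. x + t *\<^sub>R axis i 1 \<in> \<Gamma> \<longrightarrow> f x < f (x + t *\<^sub>R axis i 1)) \<and>
     (\<forall>x\<in>\<Gamma>. f x > 0) \<and>
     (\<forall>x\<in>frontier \<Gamma>. f x = 0)"

definition hermitian_matrix :: "complex ^ 'n ^ 'n \<Rightarrow> bool" where
  "hermitian_matrix H \<longleftrightarrow> (\<forall>i j. H $ i $ j = cnj (H $ j $ i))"

text \<open>
  Eigenvalues of a Hermitian matrix, counted with multiplicity: the tuple is determined by the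
  characteristic polynomial up to the order of its entries. The choice of the order is
  immaterial, because it is only used with a symmetric cone and a symmetric function.
\<close>

definition eigenvalue_tuple :: "complex ^ 'n ^ 'n \<Rightarrow> real ^ 'n" where
  "eigenvalue_tuple H =
     (SOME x. \<forall>t::complex. det (mat t - H) = (\<Prod>i\<in>UNIV. t - complex_of_real (x $ i)))"

definition cone_matrices :: "(real ^ 'n) set \<Rightarrow> (complex ^ 'n ^ 'n) set" where
  "cone_matrices \<Gamma> = {H. hermitian_matrix H \<and> eigenvalue_tuple H \<in> \<Gamma>}"

definition hessian_operator ::
    "(real ^ 'n) set \<Rightarrow> (real ^ 'n \<Rightarrow> real) \<Rightarrow> complex ^ 'n ^ 'n \<Rightarrow> ereal" where
  "hessian_operator \<Gamma> f H =
     (if H \<in> closure (cone_matrices \<Gamma>) then ereal (f (eigenvalue_tuple H)) else - \<infinity>)"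

section \<open>The complex Hessian\<close>

definition dir_deriv :: "complex ^ 'n \<Rightarrow> (complex ^ 'n \<Rightarrow> complex) \<Rightarrow> complex ^ 'n \<Rightarrow> complex" where
  "dir_deriv e g z = vector_derivative (\<lambda>t::real. g (z + t *\<^sub>R e)) (at 0)"

definition d_dz :: "'n \<Rightarrow> (complex ^ 'n \<Rightarrow> complex) \<Rightarrow> complex ^ 'n \<Rightarrow> complex" where
  "d_dz a g z = (dir_deriv (axis a 1) g z - \<i> * dir_deriv (axis a \<i>) g z) / 2"

definition d_dzbar :: "'n \<Rightarrow> (complex ^ 'n \<Rightarrow> complex) \<Rightarrow> complex ^ 'n \<Rightarrow> complex" where
  "d_dzbar b g z = (dir_deriv (axis b 1) g z + \<i> * dir_deriv (axis b \<i>) g z) / 2"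

definition complex_hessian :: "(complex ^ 'n \<Rightarrow> real) \<Rightarrow> complex ^ 'n \<Rightarrow> complex ^ 'n ^ 'n" where
  "complex_hessian q z = (\<chi> a b. d_dz a (d_dzbar b (\<lambda>w. complex_of_real (q w))) z)"

section \<open>Viscosity sub- and supersolutions\<close>

text \<open>Twice continuously real (Frechet) differentiable; meant for open sets.\<close>

definition C2_on :: "'a::real_normed_vector set \<Rightarrow> ('a \<Rightarrow> real) \<Rightarrow> bool" where
  "C2_on U q \<longleftrightarrow>
     (\<exists>(q' :: 'a \<Rightarrow> 'a \<Rightarrow>\<^sub>L real) (q'' :: 'a \<Rightarrow> 'a \<Rightarrow>\<^sub>L 'a \<Rightarrow>\<^sub>L real).
        (\<forall>x\<in>U. (q has_derivative blinfun_apply (q' x)) (at x)) \<and>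
        (\<forall>x\<in>U. (q' has_derivative blinfun_apply (q'' x)) (at x)) \<and>
        continuous_on U q'')"

definition C2_near :: "'a::real_normed_vector \<Rightarrow> ('a \<Rightarrow> real) \<Rightarrow> bool" where
  "C2_near z0 q \<longleftrightarrow> (\<exists>U. open U \<and> z0 \<in> U \<and> C2_on U q)"

definition usc_on :: "'a::topological_space set \<Rightarrow> ('a \<Rightarrow> real) \<Rightarrow> bool" where
  "usc_on S u \<longleftrightarrow> (\<forall>x\<in>S. \<forall>c. u x < c \<longrightarrow> (\<forall>\<^sub>F y in at x within S. u y < c))"

definition lsc_on :: "'a::topological_space set \<Rightarrow> ('a \<Rightarrow> real) \<Rightarrow> bool" where
  "lsc_on S v \<longleftrightarrow> (\<forall>x\<in>S. \<forall>c. c < v x \<longrightarrow> (\<forall>\<^sub>F y in at x within S. c < v y))"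

definition upper_test_function ::
    "(complex ^ 'n \<Rightarrow> real) \<Rightarrow> complex ^ 'n \<Rightarrow> (complex ^ 'n \<Rightarrow> real) \<Rightarrow> bool" where
  "upper_test_function w z0 q \<longleftrightarrow>
     C2_near z0 q \<and> w z0 = q z0 \<and> (\<forall>\<^sub>F z in nhds z0. w z \<le> q z)"

definition lower_test_function ::
    "(complex ^ 'n \<Rightarrow> real) \<Rightarrow> complex ^ 'n \<Rightarrow> (complex ^ 'n \<Rightarrow> real) \<Rightarrow> bool" where
  "lower_test_function w z0 q \<longleftrightarrow>
     C2_near z0 q \<and> w z0 = q z0 \<and> (\<forall>\<^sub>F z in nhds z0. w z \<ge> q z)"

definition viscosity_subsolution ::
    "(complex ^ 'n ^ 'n \<Rightarrow> ereal) \<Rightarrow> (complex ^ 'n \<Rightarrow> real \<Rightarrow> real) \<Rightarrow>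
     (complex ^ 'n) set \<Rightarrow> (complex ^ 'n \<Rightarrow> real) \<Rightarrow> bool" where
  "viscosity_subsolution F \<psi> \<Omega> u \<longleftrightarrow>
     usc_on \<Omega> u \<and>
     (\<forall>z0\<in>\<Omega>. \<forall>q. upper_test_function u z0 q \<longrightarrow>
        F (complex_hessian q z0) \<ge> ereal (\<psi> z0 (u z0)))"

definition viscosity_supersolution ::
    "(complex ^ 'n ^ 'n \<Rightarrow> ereal) \<Rightarrow> (complex ^ 'n \<Rightarrow> real \<Rightarrow> real) \<Rightarrow>
     (complex ^ 'n) set \<Rightarrow> (complex ^ 'n \<Rightarrow> real) \<Rightarrow> bool" where
  "viscosity_supersolution F \<psi> \<Omega> v \<longleftrightarrow>
     lsc_on \<Omega> v \<and>
     (\<forall>z0\<in>\<Omega>. \<forall>q. lower_test_function v z0 q \<longrightarrow>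
        F (complex_hessian q z0) \<le> ereal (\<psi> z0 (v z0)))"

end

theory Submission
  imports Defs "HOL-Combinatorics.Permutations" "HOL-Computational_Algebra.Polynomial"
begin

text \<open>
  Write \<open>F\<close> for the operator and \<open>Hw\<close> for the complex Hessian. The usual route to comparison doubles
  the variables and needs second order information at a maximum of a difference of two nonsmooth
  functions. Concavity of \<open>f\<close> offers a shorter one: it makes \<open>{H. s \<le> F H}\<close> a closed convex set of
  Hermitian matrices, hence an intersection of half-spaces \<open>b \<le> tr (A H)\<close> with \<open>A\<close> positive
  semidefinite. A viscosity subsolution of \<open>s \<le> F (Hw)\<close> therefore satisfies, in the viscosity sense,
  all the corresponding linear inequalities with constant coefficients, and these are inherited by
  every mollification of \<open>w\<close>. So \<open>w\<close> may be replaced by a nearby smooth function \<open>\<omega>\<close> with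
  \<open>s \<le> F (H\<omega>)\<close> in the classical sense (\<open>mollification_preserves_subsolution\<close>), and such an \<open>\<omega>\<close>, moved
  up or down by a constant, is itself a test function for the supersolution \<open>v\<close>.

  Suppose that \<open>u > v\<close> somewhere. The points where \<open>u - v\<close> is at least half of this excess form a
  compact subset of \<open>\<Omega>\<close>, and \<open>\<psi> z (v z) \<le> s1 < f (R, ..., R)\<close> on a compact neighbourhood of it for some
  \<open>R\<close> and \<open>s1\<close>. Replacing \<open>u\<close> by \<open>U = (1 - \<tau>) u + \<tau> (R |z|^2 - B)\<close> with small \<open>\<tau>\<close> makes the subsolution
  strict: by concavity the right-hand side becomes \<open>(1 - \<tau>) \<psi> + \<tau> f (R, ..., R)\<close>
  (\<open>perturbed_subsolution\<close>). The sup-convolution of \<open>U\<close> with the steep cone \<open>|x - y| / \<epsilon>\<close> is a supremum of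
  translates of \<open>U\<close>, so it satisfies the same differential inequality up to the oscillation of \<open>\<psi>\<close>
  over short distances; moreover it is Lipschitz with constant \<open>1 / \<epsilon>\<close>, so mollifying it on the scale
  \<open>\<epsilon>^2\<close> changes it by at most \<open>\<epsilon>\<close>. At a maximum point \<open>p\<close> of \<open>\<omega> - v\<close> for the resulting smooth \<open>\<omega>\<close> the
  supersolution property yields \<open>F (H\<omega>) \<le> \<psi> p (v p)\<close>, against the strict inequality just produced.

  The linear inequalities are sums of squares, \<open>\<beta> \<le> Lw\<close> with \<open>L = \<Sum>i. \<partial>\<^sub>e\<^sub>i\<^sup>2\<close>, possibly degenerate. That they
  survive mollification (\<open>mollified_subsolution\<close>) is shown with the resolvent of a finite difference
  approximation \<open>\<Delta>\<close> of \<open>L\<close>. The solution \<open>g\<close> of \<open>g - \<mu> \<Delta>g = w\<close> comes from a contraction, commutes with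
  convolution and obeys a maximum principle among bounded functions. Comparing \<open>w\<close> with a mollified
  \<open>g\<close>, which is smooth, gives \<open>w \<le> g - \<mu> \<beta> + O(\<mu>^2)\<close> locally. Convolving with the mollifier and
  dividing by \<open>\<mu>\<close> turns this into \<open>\<beta> \<le> L (w * \<rho>)\<close> as \<open>\<mu>\<close> tends to 0.

  The matrix facts rest on one observation: among all unitary conjugates of a Hermitian matrix, a
  weighted trace of the diagonal with distinct weights is minimal only at a diagonal matrix
  (\<open>spectral_theorem_minimizing\<close>). This yields the spectral theorem and, by a perturbation, that the
  diagonal of a matrix lies in every closed convex symmetric set that contains its eigenvalues
  (\<open>schur_diagonal_in\<close>).
\<close>

section \<open>Diagonalisation of Hermitian matrices\<close>

definition hprod :: "complex ^ 'n \<Rightarrow> complex ^ 'n \<Rightarrow> complex" where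
  "hprod x y = (\<Sum>p\<in>UNIV. cnj (x $ p) * y $ p)"

lemma hprod_add_left: "hprod (x + y) z = hprod x z + hprod y z"
  and hprod_add_right: "hprod x (y + z) = hprod x y + hprod x z"
  and hprod_diff_left: "hprod (x - y) z = hprod x z - hprod y z"
  and hprod_diff_right: "hprod x (y - z) = hprod x y - hprod x z"
  and hprod_scale_left: "hprod (c *s x) y = cnj c * hprod x y"
  and hprod_scale_right: "hprod x (c *s y) = c * hprod x y"
  and cnj_hprod: "cnj (hprod x y) = hprod y x"
  by (auto simp: hprod_def sum.distrib sum_subtractf algebra_simps sum_distrib_left)

lemma hprod_axis_left: "hprod (axis i 1) y = y $ i"
proof -
  have "hprod (axis i 1) y = (\<Sum>p\<in>UNIV. if p = i then y $ p else 0)"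
    unfolding hprod_def by (rule sum.cong) (auto simp: axis_def)
  then show ?thesis by simp
qed

definition adjoint_matrix :: "complex ^ 'n ^ 'm \<Rightarrow> complex ^ 'm ^ 'n" where
  "adjoint_matrix A = (\<chi> i j. cnj (A $ j $ i))"

definition unitary_matrix :: "complex ^ 'n ^ 'n \<Rightarrow> bool" where
  "unitary_matrix U \<longleftrightarrow> adjoint_matrix U ** U = mat 1"

definition unitary_conj :: "complex ^ 'n ^ 'n \<Rightarrow> complex ^ 'n ^ 'n \<Rightarrow> complex ^ 'n ^ 'n" where
  "unitary_conj U H = adjoint_matrix U ** H ** U"

definition diagonal_matrix :: "real ^ 'n \<Rightarrow> complex ^ 'n ^ 'n" where
  "diagonal_matrix d = (\<chi> i j. if i = j then complex_of_real (d $ i) else 0)"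

definition real_diagonal :: "complex ^ 'n ^ 'n \<Rightarrow> real ^ 'n" where
  "real_diagonal K = (\<chi> k. Re (K $ k $ k))"

lemma real_diagonal_diagonal_matrix [simp]: "real_diagonal (diagonal_matrix d) = d"
  by (simp add: real_diagonal_def diagonal_matrix_def vec_eq_iff)

lemma adjoint_matrix_mult: "adjoint_matrix (A ** B) = adjoint_matrix B ** adjoint_matrix A"
  by (simp add: adjoint_matrix_def matrix_matrix_mult_def vec_eq_iff mult.commute)

lemma adjoint_adjoint [simp]: "adjoint_matrix (adjoint_matrix A) = A"
  by (simp add: adjoint_matrix_def vec_eq_iff)

lemma hermitian_iff_adjoint: "hermitian_matrix H \<longleftrightarrow> adjoint_matrix H = H"
  unfolding hermitian_matrix_def adjoint_matrix_def vec_eq_iff vec_lambda_beta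
  by (blast intro: sym)

lemma unitary_conj_nth:
  "unitary_conj U H $ k $ l = hprod (column k U) (H *v column l U)"
proof -
  have "unitary_conj U H $ k $ l = (\<Sum>q\<in>UNIV. (\<Sum>p\<in>UNIV. cnj (U $ p $ k) * H $ p $ q) * U $ q $ l)"
    by (simp add: unitary_conj_def matrix_matrix_mult_def adjoint_matrix_def)
  also have "\<dots> = (\<Sum>q\<in>UNIV. \<Sum>p\<in>UNIV. cnj (U $ p $ k) * (H $ p $ q * U $ q $ l))"
    by (simp add: sum_distrib_right mult.assoc)
  also have "\<dots> = (\<Sum>p\<in>UNIV. \<Sum>q\<in>UNIV. cnj (U $ p $ k) * (H $ p $ q * U $ q $ l))"
    by (rule sum.swap)
  also have "\<dots> = hprod (column k U) (H *v column l U)"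
    by (simp add: hprod_def column_def matrix_vector_mult_def sum_distrib_left)
  finally show ?thesis .
qed

lemma unitary_iff_columns:
  "unitary_matrix U \<longleftrightarrow> (\<forall>k l. hprod (column k U) (column l U) = (if k = l then 1 else 0))"
  by (simp add: unitary_matrix_def vec_eq_iff matrix_matrix_mult_def adjoint_matrix_def mat_def
      hprod_def column_def)

lemma unitary_mat_1: "unitary_matrix (mat 1)"
proof -
  have "column k (mat 1) = axis k (1::complex)" for k :: 'a
    by (auto simp: column_def mat_def axis_def vec_eq_iff)
  then show ?thesis by (simp add: unitary_iff_columns hprod_axis_left) (simp add: axis_def)
qed

lemma unitary_mult:
  assumes "unitary_matrix U" "unitary_matrix V"
  shows "unitary_matrix (U ** V)"
proof -
  have "adjoint_matrix (U ** V) ** (U ** V) = adjoint_matrix V ** (adjoint_matrix U ** U) ** V"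
    by (simp add: adjoint_matrix_mult matrix_mul_assoc)
  then show ?thesis using assms by (simp add: unitary_matrix_def)
qed

lemma unitary_conj_mult: "unitary_conj (U ** V) H = unitary_conj V (unitary_conj U H)"
  by (simp add: unitary_conj_def adjoint_matrix_mult matrix_mul_assoc)

lemma unitary_conj_mat_1 [simp]: "unitary_conj (mat 1) H = H"
proof -
  have "adjoint_matrix (mat 1) = (mat 1 :: complex ^ 'a ^ 'a)"
    by (auto simp: adjoint_matrix_def mat_def vec_eq_iff)
  then show ?thesis by (simp add: unitary_conj_def)
qed

lemma hermitian_unitary_conj: "hermitian_matrix H \<Longrightarrow> hermitian_matrix (unitary_conj U H)"
  by (simp add: hermitian_iff_adjoint unitary_conj_def adjoint_matrix_mult matrix_mul_assoc)

lemma norm_vec_le_sum: "norm (x :: 'a::real_normed_vector ^ 'n) \<le> (\<Sum>i\<in>UNIV. norm (x $ i))"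
  unfolding norm_vec_def by (rule L2_set_le_sum) simp

lemma compact_unitary: "compact {U :: complex ^ 'n ^ 'n. unitary_matrix U}"
proof -
  have "closed {U :: complex ^ 'n ^ 'n. unitary_matrix U}"
    unfolding unitary_matrix_def vec_eq_iff matrix_matrix_mult_def adjoint_matrix_def
    by (simp add: Collect_all_eq)
       (intro closed_INT ballI closed_Collect_eq continuous_intros)
  moreover have "bounded {U :: complex ^ 'n ^ 'n. unitary_matrix U}"
  proof -
    have entry: "norm (U $ i $ j) \<le> 1" if "unitary_matrix U" for U :: "complex ^ 'n ^ 'n" and i j
    proof -
      have "hprod (column j U) (column j U) = 1" using that by (simp add: unitary_iff_columns)
      moreover have "hprod (column j U) (column j U) = complex_of_real (\<Sum>p\<in>UNIV. (norm (U $ p $ j))\<^sup>2)"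
        unfolding of_real_sum hprod_def
        by (rule sum.cong) (auto simp: column_def complex_norm_square[symmetric] mult.commute[of "cnj _"])
      ultimately have "(\<Sum>p\<in>UNIV. (norm (U $ p $ j))\<^sup>2) = 1"
        by (metis of_real_eq_1_iff)
      then have "(norm (U $ i $ j))\<^sup>2 \<le> 1"
        by (metis (no_types, lifting) finite UNIV_I member_le_sum zero_le_power2)
      then show ?thesis by (simp add: power2_le_imp_le)
    qed
    have "norm U \<le> (\<Sum>i\<in>(UNIV::'n set). \<Sum>j\<in>(UNIV::'n set). 1)" if "unitary_matrix U" for U :: "complex ^ 'n ^ 'n"
    proof -
      have "norm U \<le> (\<Sum>i\<in>UNIV. norm (U $ i))" by (rule norm_vec_le_sum)
      also have "\<dots> \<le> (\<Sum>i\<in>UNIV. \<Sum>j\<in>UNIV. norm (U $ i $ j))"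
        by (intro sum_mono norm_vec_le_sum)
      also have "\<dots> \<le> (\<Sum>i\<in>(UNIV::'n set). \<Sum>j\<in>(UNIV::'n set). 1)"
        by (intro sum_mono entry that)
      finally show ?thesis .
    qed
    then show ?thesis by (auto simp: bounded_iff)
  qed
  ultimately show ?thesis by (simp add: compact_eq_bounded_closed)
qed

text \<open>
  Rotating by the angle \<open>t\<close> in the plane of the \<open>i\<close>-th and \<open>j\<close>-th basis vectors, with the phase of
  \<open>K $ i $ j\<close> compensated, changes the weighted diagonal sum at the rate
  \<open>2 (a $ i - a $ j) |K $ i $ j|\<close> at \<open>t = 0\<close>. This rate is not zero, so one of the two directions of
  rotation decreases the sum.
\<close>

lemma rotation_decreases:
  fixes K :: "complex ^ 'n ^ 'n" and a :: "real ^ 'n"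
  assumes herm: "hermitian_matrix K" and ij: "i \<noteq> j" "a $ i \<noteq> a $ j" and nz: "K $ i $ j \<noteq> 0"
  shows "\<exists>V. unitary_matrix V \<and> a \<bullet> real_diagonal (unitary_conj V K) < a \<bullet> real_diagonal K"
proof -
  \<comment> \<open>the phase that makes the mixed term of the rotated matrix real\<close>
  define \<omega> where "\<omega> = cnj (K $ i $ j) / norm (K $ i $ j)"
  have om: "\<omega> * K $ i $ j = norm (K $ i $ j)" "cnj \<omega> * \<omega> = 1" "\<omega> * cnj \<omega> = 1"
    using nz by (auto simp: \<omega>_def complex_norm_square[symmetric] power2_eq_square mult.commute
        field_simps)
  define b :: "real \<Rightarrow> 'n \<Rightarrow> complex ^ 'n" where
    "b t k = (if k = i then complex_of_real (cos t) *s axis i 1 + (complex_of_real (sin t) * \<omega>) *s axis j 1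
       else if k = j then (complex_of_real (- sin t) * cnj \<omega>) *s axis i 1 + complex_of_real (cos t) *s axis j 1
       else axis k 1)" for t k
  define V where "V t = (\<chi> p k. b t k $ p)" for t
  have col: "column k (V t) = b t k" for k t by (simp add: V_def column_def vec_eq_iff)
  have cs: "complex_of_real (cos t) * complex_of_real (cos t) + complex_of_real (sin t) * complex_of_real (sin t) = 1" for t
    by (metis of_real_1 of_real_add of_real_mult power2_eq_square sin_cos_squared_add2)
  have ax: "axis p (1::complex) $ q = (if p = q then 1 else 0)" for p q :: 'n
    by (auto simp: axis_def)
  have uni: "unitary_matrix (V t)" for t
    unfolding unitary_iff_columns col
  proof (intro allI)
    fix k l
    have "\<omega> * (cnj \<omega> * (complex_of_real (sin t) * complex_of_real (sin t))) = (\<omega> * cnj \<omega>) * (complex_of_real (sin t) * complex_of_real (sin t))"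
      by (simp only: mult.assoc)
    then have e: "\<omega> * (cnj \<omega> * (complex_of_real (sin t) * complex_of_real (sin t))) = complex_of_real (sin t) * complex_of_real (sin t)"
      by (simp only: om(3) mult_1)
    show "hprod (b t k) (b t l) = (if k = l then 1 else 0)"
      using cs[of t] ij om
      by (auto simp: b_def hprod_add_left hprod_add_right hprod_diff_left hprod_diff_right hprod_scale_left hprod_scale_right hprod_axis_left
        ax algebra_simps simp del: vector_smult_lneg vector_sneg_minus1) (metis e cs)+
  qed
  have sym: "K $ j $ i = cnj (K $ i $ j)" using herm unfolding hermitian_matrix_def by blast
  define h where "h = norm (K $ i $ j)"
  have Kax1: "K *v axis p 1 = column p K" for p
    by (simp add: vec_eq_iff matrix_vector_mult_def column_def ax if_distrib cong: if_cong)
  have Kax: "hprod x (K *v (c *s axis p 1 + d *s axis q 1)) = c * hprod x (column p K) + d * hprod x (column q K)"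
    for x c d p q
    by (simp add: matrix_vector_right_distrib vector_scalar_commute hprod_add_right hprod_scale_right Kax1)
  have omj: "cnj \<omega> * K $ j $ i = norm (K $ i $ j)"
    using om(1) sym by (metis complex_cnj_complex_of_real complex_cnj_mult)
  have di: "Re (unitary_conj (V t) K $ i $ i) = (cos t)\<^sup>2 * Re (K $ i $ i) + (sin t)\<^sup>2 * Re (K $ j $ j) + 2 * cos t * sin t * h" for t
  proof -
    have "unitary_conj (V t) K $ i $ i = of_real (cos t) * of_real (cos t) * K $ i $ i
        + of_real (cos t) * of_real (sin t) * (cnj \<omega> * K $ j $ i)
        + of_real (cos t) * of_real (sin t) * (\<omega> * K $ i $ j)
        + of_real (sin t) * of_real (sin t) * (cnj \<omega> * \<omega>) * K $ j $ j"
      unfolding unitary_conj_nth col by (simp add: b_def Kax hprod_add_left hprod_diff_left hprod_scale_left hprod_axis_left)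
        (simp add: column_def algebra_simps)
    then show ?thesis unfolding om omj h_def by (simp add: power2_eq_square)
  qed
  have dj: "Re (unitary_conj (V t) K $ j $ j) = (sin t)\<^sup>2 * Re (K $ i $ i) + (cos t)\<^sup>2 * Re (K $ j $ j) - 2 * cos t * sin t * h" for t
  proof -
    have "unitary_conj (V t) K $ j $ j = of_real (sin t) * of_real (sin t) * (cnj \<omega> * \<omega>) * K $ i $ i
        - of_real (cos t) * of_real (sin t) * (cnj \<omega> * K $ j $ i)
        - of_real (cos t) * of_real (sin t) * (\<omega> * K $ i $ j)
        + of_real (cos t) * of_real (cos t) * K $ j $ j"
      using ij unfolding unitary_conj_nth col
      by (simp add: b_def Kax1 matrix_vector_mult_diff_distrib vector_scalar_commute hprod_add_right hprod_diff_right
          hprod_scale_right hprod_add_left hprod_diff_left hprod_scale_left hprod_axis_left)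
        (simp add: column_def algebra_simps)
    then show ?thesis unfolding om omj h_def by (simp add: power2_eq_square)
  qed
  have dk: "Re (unitary_conj (V t) K $ k $ k) = Re (K $ k $ k)" if "k \<noteq> i" "k \<noteq> j" for k t
    unfolding unitary_conj_nth col using that
    by (simp add: b_def Kax1 hprod_axis_left column_def)
  define \<phi> where "\<phi> t = (a $ i - a $ j) * ((sin t)\<^sup>2 * (Re (K $ j $ j) - Re (K $ i $ i)) + 2 * cos t * sin t * h)" for t
  have diff: "a \<bullet> real_diagonal (unitary_conj (V t) K) - a \<bullet> real_diagonal K = \<phi> t" for t
  proof -
    have "a \<bullet> real_diagonal (unitary_conj (V t) K) - a \<bullet> real_diagonal K
      = (\<Sum>k\<in>UNIV. a $ k * (Re (unitary_conj (V t) K $ k $ k) - Re (K $ k $ k)))"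
      by (simp add: inner_vec_def real_diagonal_def sum_subtractf[symmetric] algebra_simps)
    also have "\<dots> = (\<Sum>k\<in>{i,j}. a $ k * (Re (unitary_conj (V t) K $ k $ k) - Re (K $ k $ k)))"
      by (rule sum.mono_neutral_right) (auto simp: dk)
    also have "\<dots> = a $ i * (Re (unitary_conj (V t) K $ i $ i) - Re (K $ i $ i)) + a $ j * (Re (unitary_conj (V t) K $ j $ j) - Re (K $ j $ j))"
      using ij by simp
    also have "\<dots> = \<phi> t"
    proof -
      have alg: "p * (C * x + S * y + e - x) + q * (S * x + C * y - e - y) = (p - q) * (S * (y - x) + e)"
        if "C = 1 - S" for p q x y e C S :: real
        unfolding that by (simp add: algebra_simps)
      show ?thesis unfolding di dj \<phi>_def by (rule alg) (rule cos_squared_eq)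
    qed
    finally show ?thesis .
  qed
  have "(\<phi> has_real_derivative (a $ i - a $ j) * (2 * h)) (at 0)"
    unfolding \<phi>_def by (auto intro!: derivative_eq_intros)
  moreover have "\<phi> 0 = 0" by (simp add: \<phi>_def)
  moreover have "(a $ i - a $ j) * (2 * h) \<noteq> 0" using ij nz by (simp add: h_def)
  ultimately have "\<exists>t. \<phi> t < 0"
    by (metis DERIV_neg_dec_right DERIV_pos_inc_left add_0 diff_0 linorder_neqE_linordered_idom zero_less_one
        dense)
  then show ?thesis using uni diff by (metis diff_less_0_iff_less)
qed

text \<open>
  The weighted diagonal sum attains its minimum on the compact unitary group, and by
  \<open>rotation_decreases\<close> all off-diagonal entries vanish there. The last inequality, which compares the
  minimizer with the identity matrix, is what makes \<open>schur_diagonal_in\<close> work.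
\<close>

lemma spectral_theorem_minimizing:
  fixes H :: "complex ^ 'n ^ 'n" and a :: "real ^ 'n"
  assumes herm: "hermitian_matrix H" and inj: "inj (($) a)"
  shows "\<exists>U d. unitary_matrix U \<and> unitary_conj U H = diagonal_matrix d \<and> a \<bullet> d \<le> a \<bullet> real_diagonal H"
proof -
  have "continuous_on {U. unitary_matrix U} (\<lambda>U. a \<bullet> real_diagonal (unitary_conj U H))"
    unfolding inner_vec_def real_diagonal_def unitary_conj_def matrix_matrix_mult_def adjoint_matrix_def
    by (auto intro!: continuous_intros)
  then obtain U where U: "unitary_matrix U"
    and min: "\<And>W. unitary_matrix W \<Longrightarrow> a \<bullet> real_diagonal (unitary_conj U H) \<le> a \<bullet> real_diagonal (unitary_conj W H)"
    using continuous_attains_inf[OF compact_unitary, of "\<lambda>U. a \<bullet> real_diagonal (unitary_conj U H)"]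
      unitary_mat_1 by fastforce
  define K where "K = unitary_conj U H"
  have K: "hermitian_matrix K" unfolding K_def by (rule hermitian_unitary_conj[OF herm])
  have off: "K $ i $ j = 0" if ij: "i \<noteq> j" for i j
  proof (rule ccontr)
    assume "K $ i $ j \<noteq> 0"
    moreover have "a $ i \<noteq> a $ j" using inj that by (auto dest: injD)
    ultimately obtain V where "unitary_matrix V" "a \<bullet> real_diagonal (unitary_conj V K) < a \<bullet> real_diagonal K"
      using rotation_decreases[OF K ij] by blast
    then show False using min[of "U ** V"] unitary_mult[OF U] by (auto simp: unitary_conj_mult K_def)
  qed
  have "complex_of_real (Re (K $ i $ i)) = K $ i $ i" for i
    using K by (metis Reals_cnj_iff hermitian_matrix_def of_real_Re)
  then have "unitary_conj U H = diagonal_matrix (real_diagonal K)"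
    unfolding K_def[symmetric] vec_eq_iff diagonal_matrix_def real_diagonal_def by (simp add: off)
  moreover have "a \<bullet> real_diagonal K \<le> a \<bullet> real_diagonal H"
    using min[OF unitary_mat_1] by (simp add: K_def)
  ultimately show ?thesis using U by blast
qed

lemma exists_injective_weight: "\<exists>a :: real ^ 'n. inj (($) a)"
proof -
  obtain g :: "'n \<Rightarrow> nat" where "bij_betw g UNIV {0..<CARD('n)}"
    using ex_bij_betw_finite_nat[of "UNIV :: 'n set"] by auto
  then have g: "inj g" by (simp add: bij_betw_def)
  have "inj (($) (\<chi> i. real (g i)))" using g unfolding inj_def by simp
  then show ?thesis by blast
qed

lemma det_char_unitary_conj:
  assumes U: "unitary_matrix U"
  shows "det (mat t - unitary_conj U H) = det (mat t - H)"
proof -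
  have "adjoint_matrix U ** mat t ** U = mat t"
  proof -
    have "adjoint_matrix U ** mat t = mat t ** adjoint_matrix U"
      by (simp add: vec_eq_iff matrix_matrix_mult_def mat_def if_distrib if_distribR cong: if_cong)
    then show ?thesis using U by (metis matrix_mul_assoc matrix_mul_rid unitary_matrix_def)
  qed
  then have "mat t - unitary_conj U H = adjoint_matrix U ** (mat t - H) ** U"
    by (simp add: unitary_conj_def vec_eq_iff matrix_matrix_mult_def sum_subtractf algebra_simps)
  then have "det (mat t - unitary_conj U H) = det (adjoint_matrix U ** U) * det (mat t - H)"
    by (simp add: det_mul)
  then show ?thesis using U by (simp add: unitary_matrix_def)
qed

lemma eigenvalue_tuple_unitary_conj:
  "unitary_matrix U \<Longrightarrow> eigenvalue_tuple (unitary_conj U H) = eigenvalue_tuple H"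
  by (simp add: eigenvalue_tuple_def det_char_unitary_conj)

lemma root_tuples_permuted:
  fixes x y :: "real ^ 'n"
  assumes "\<And>t::complex. (\<Prod>i\<in>UNIV. t - complex_of_real (x $ i)) = (\<Prod>i\<in>UNIV. t - complex_of_real (y $ i))"
  shows "\<exists>p. bij p \<and> x = permute_coords p y"
proof -
  define P where "P z = (\<Prod>i\<in>UNIV. [:- complex_of_real (z $ i), 1:])" for z :: "real ^ 'n"
  have "poly (P z) t = (\<Prod>i\<in>UNIV. t - complex_of_real (z $ i))" for z t
    by (simp add: P_def poly_prod)
  then have "poly (P x) = poly (P y)" using assms by auto
  then have "P x = P y" by (simp add: poly_eq_poly_eq_iff)
  moreover have "proots (P z) = image_mset (\<lambda>i. complex_of_real (z $ i)) (mset_set UNIV)" for z :: "real ^ 'n"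
    unfolding P_def by (subst proots_prod) (auto simp: proots_linear_factor sum_unfold_sum_mset)
  ultimately have "image_mset (\<lambda>i. complex_of_real (x $ i)) (mset_set UNIV) = image_mset (\<lambda>i. complex_of_real (y $ i)) (mset_set UNIV)"
    by metis
  then obtain p where "p permutes UNIV" "\<forall>i. complex_of_real (x $ i) = complex_of_real (y $ p i)"
    using image_mset_eq_implies_permutes[of UNIV "\<lambda>i. complex_of_real (x $ i)" "\<lambda>i. complex_of_real (y $ i)"]
    by auto
  then show ?thesis by (intro exI[of _ p]) (auto simp: permutes_bij permute_coords_def vec_eq_iff)
qed

lemma eigenvalue_tuple_diagonalised:
  assumes U: "unitary_matrix U" and d: "unitary_conj U H = diagonal_matrix d"
  shows "\<exists>p. bij p \<and> eigenvalue_tuple H = permute_coords p d"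
proof -
  have char: "det (mat t - H) = (\<Prod>i\<in>UNIV. t - complex_of_real (d $ i))" for t
  proof -
    have "det (mat t - H) = det (mat t - diagonal_matrix d)"
      using det_char_unitary_conj[OF U] d by metis
    also have "\<dots> = (\<Prod>i\<in>UNIV. (mat t - diagonal_matrix d) $ i $ i)"
      by (rule det_diagonal) (simp add: mat_def diagonal_matrix_def)
    finally show ?thesis by (simp add: mat_def diagonal_matrix_def)
  qed
  have "\<forall>t::complex. det (mat t - H) = (\<Prod>i\<in>UNIV. t - complex_of_real (eigenvalue_tuple H $ i))"
    unfolding eigenvalue_tuple_def by (rule someI[of _ d]) (simp add: char)
  then show ?thesis by (intro root_tuples_permuted) (simp add: char)
qed

lemma permute_coords_inv: "bij p \<Longrightarrow> permute_coords (inv p) (permute_coords p d) = d"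
  by (simp add: permute_coords_def vec_eq_iff bij_inv_eq_iff surj_f_inv_f bij_is_surj)

definition symmetric_set :: "(real ^ 'n) set \<Rightarrow> bool" where
  "symmetric_set \<Lambda> \<longleftrightarrow> (\<forall>p. bij p \<longrightarrow> (\<forall>x\<in>\<Lambda>. permute_coords p x \<in> \<Lambda>))"

text \<open>
  Membership in a symmetric set does not depend on the order in which \<^const>\<open>eigenvalue_tuple\<close> lists the
  eigenvalues, so any diagonalisation may be used instead.
\<close>

lemma eigenvalue_tuple_in_symmetric_iff:
  assumes sym: "symmetric_set \<Lambda>" and U: "unitary_matrix U" and d: "unitary_conj U H = diagonal_matrix d"
  shows "eigenvalue_tuple H \<in> \<Lambda> \<longleftrightarrow> d \<in> \<Lambda>"
proof -
  obtain p where p: "bij p" and e: "eigenvalue_tuple H = permute_coords p d"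
    using eigenvalue_tuple_diagonalised[OF U d] by blast
  then have "d = permute_coords (inv p) (eigenvalue_tuple H)" by (simp add: permute_coords_inv)
  then show ?thesis using sym p e unfolding symmetric_set_def by (metis bij_imp_bij_inv)
qed

text \<open>
  Two coordinates that agree are separated by every positive \<open>\<epsilon>\<close>, and two that differ stay different for
  small \<open>\<epsilon>\<close>.
\<close>

lemma eventually_injective_perturbation:
  fixes a c :: "real ^ 'n"
  assumes "inj (($) c)"
  shows "\<forall>\<^sub>F \<epsilon> in at_right 0. inj (($) (a + \<epsilon> *\<^sub>R c))"
proof -
  have "\<forall>\<^sub>F \<epsilon> in at_right 0. (a + \<epsilon> *\<^sub>R c) $ i \<noteq> (a + \<epsilon> *\<^sub>R c) $ j" if "i \<noteq> j" for i j
  proof (cases "a $ i = a $ j")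
    case True
    have "c $ i \<noteq> c $ j" using assms that by (auto dest: injD)
    then show ?thesis using True eventually_at_right_less[of "0::real"] by (auto elim: eventually_mono)
  next
    case False
    have "((\<lambda>\<epsilon>. (a + \<epsilon> *\<^sub>R c) $ i - (a + \<epsilon> *\<^sub>R c) $ j) \<longlongrightarrow> (a + 0 *\<^sub>R c) $ i - (a + 0 *\<^sub>R c) $ j) (at_right 0)"
      by (intro tendsto_intros)
    then have "\<forall>\<^sub>F \<epsilon> in at_right 0. (a + \<epsilon> *\<^sub>R c) $ i - (a + \<epsilon> *\<^sub>R c) $ j \<noteq> 0"
      by (rule tendsto_imp_eventually_ne) (use False in simp)
    then show ?thesis by (auto elim: eventually_mono)
  qed
  then have "\<forall>\<^sub>F \<epsilon> in at_right 0. \<forall>i j. i \<noteq> j \<longrightarrow> (a + \<epsilon> *\<^sub>R c) $ i \<noteq> (a + \<epsilon> *\<^sub>R c) $ j"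
    by (intro eventually_all_finite) (auto intro: eventually_mono)
  then show ?thesis by (rule eventually_mono) (auto simp: inj_def)
qed

text \<open>
  Schur's theorem that the diagonal is majorized by the eigenvalues. If the diagonal were outside
  \<open>\<Lambda>\<close>, a linear functional \<open>a\<close> would separate it from \<open>\<Lambda>\<close>, in particular from the finitely many
  permutations of the eigenvalue tuple. Perturbing \<open>a\<close> so that its coefficients become distinct
  preserves these finitely many strict inequalities, and then \<open>spectral_theorem_minimizing\<close>
  contradicts them.
\<close>

lemma schur_diagonal_in:
  fixes H :: "complex ^ 'n ^ 'n"
  assumes \<Lambda>: "closed \<Lambda>" "convex \<Lambda>" "symmetric_set \<Lambda>" and herm: "hermitian_matrix H"
    and U: "unitary_matrix U" and ev: "eigenvalue_tuple H \<in> \<Lambda>"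
  shows "real_diagonal (unitary_conj U H) \<in> \<Lambda>"
proof (rule ccontr)
  define K where "K = unitary_conj U H"
  have K: "hermitian_matrix K" "eigenvalue_tuple K \<in> \<Lambda>"
    using ev hermitian_unitary_conj[OF herm] eigenvalue_tuple_unitary_conj[OF U] by (auto simp: K_def)
  assume "real_diagonal (unitary_conj U H) \<notin> \<Lambda>"
  then obtain a b where a: "a \<bullet> real_diagonal K < b" and ab: "\<And>x. x \<in> \<Lambda> \<Longrightarrow> b < a \<bullet> x"
    using separating_hyperplane_closed_point[OF \<Lambda>(2,1)] unfolding K_def by metis
  obtain c :: "real ^ 'n" where c: "inj (($) c)" using exists_injective_weight by blast
  define e where "e = eigenvalue_tuple K"
  have lim: "((\<lambda>\<epsilon>. (a + \<epsilon> *\<^sub>R c) \<bullet> y) \<longlongrightarrow> (a + 0 *\<^sub>R c) \<bullet> y) (at_right 0)" for y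
    by (intro tendsto_intros)
  have "\<forall>\<^sub>F \<epsilon> in at_right 0. (a + \<epsilon> *\<^sub>R c) \<bullet> real_diagonal K < b"
    using order_tendstoD(2)[OF lim[of "real_diagonal K"], of b] a by simp
  moreover have "\<forall>\<^sub>F \<epsilon> in at_right 0. \<forall>p\<in>{p. bij p}. b < (a + \<epsilon> *\<^sub>R c) \<bullet> permute_coords p e"
  proof (rule eventually_ball_finite)
    show "\<forall>p\<in>{p. bij p}. \<forall>\<^sub>F \<epsilon> in at_right 0. b < (a + \<epsilon> *\<^sub>R c) \<bullet> permute_coords p e"
    proof
      fix p assume "p \<in> {p :: 'n \<Rightarrow> 'n. bij p}"
      then have "permute_coords p e \<in> \<Lambda>" using \<Lambda>(3) K(2) by (auto simp: symmetric_set_def e_def)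
      then show "\<forall>\<^sub>F \<epsilon> in at_right 0. b < (a + \<epsilon> *\<^sub>R c) \<bullet> permute_coords p e"
        using order_tendstoD(1)[OF lim[of "permute_coords p e"], of b] ab by simp
    qed
  qed simp
  ultimately have ev3: "\<forall>\<^sub>F \<epsilon> in at_right 0. (a + \<epsilon> *\<^sub>R c) \<bullet> real_diagonal K < b \<and>
     (\<forall>p\<in>{p. bij p}. b < (a + \<epsilon> *\<^sub>R c) \<bullet> permute_coords p e) \<and> inj (($) (a + \<epsilon> *\<^sub>R c))"
    using eventually_injective_perturbation[OF c, of a] by (intro eventually_conj)
  obtain \<epsilon> where eps: "(a + \<epsilon> *\<^sub>R c) \<bullet> real_diagonal K < b \<and>
     (\<forall>p\<in>{p. bij p}. b < (a + \<epsilon> *\<^sub>R c) \<bullet> permute_coords p e) \<and> inj (($) (a + \<epsilon> *\<^sub>R c))"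
    using eventually_happens[OF ev3] trivial_limit_at_right_real by blast
  \<comment> \<open>distinct weights, still separating the diagonal from all permutations of the eigenvalues\<close>
  define a' where "a' = a + \<epsilon> *\<^sub>R c"
  have a': "a' \<bullet> real_diagonal K < b" "\<And>p. bij p \<Longrightarrow> b < a' \<bullet> permute_coords p e" "inj (($) a')"
    using eps unfolding a'_def by blast+
  obtain V d where V: "unitary_matrix V" "unitary_conj V K = diagonal_matrix d" and le: "a' \<bullet> d \<le> a' \<bullet> real_diagonal K"
    using spectral_theorem_minimizing[OF K(1) a'(3)] by blast
  obtain p where p: "bij p" "e = permute_coords p d"
    using eigenvalue_tuple_diagonalised[OF V] e_def by blast
  have "b < a' \<bullet> permute_coords (inv p) e" by (rule a'(2)) (rule bij_imp_bij_inv[OF p(1)])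
  then have "b < a' \<bullet> d" unfolding p(2) permute_coords_inv[OF p(1)] .
  then show False using le a'(1) by linarith
qed

section \<open>Twice differentiable radial functions\<close>

text \<open>
  The two derivatives are explicit arguments, so that values of second order operators on \<open>q\<close> can be
  read off \<open>q2\<close>.
\<close>

definition twice_diff :: "('a::real_normed_vector \<Rightarrow> real) \<Rightarrow> ('a \<Rightarrow> 'a \<Rightarrow>\<^sub>L real) \<Rightarrow> ('a \<Rightarrow> 'a \<Rightarrow>\<^sub>L 'a \<Rightarrow>\<^sub>L real) \<Rightarrow> bool" where
  "twice_diff q q1 q2 \<longleftrightarrow>
     (\<forall>x. (q has_derivative blinfun_apply (q1 x)) (at x)) \<and>
     (\<forall>x. (q1 has_derivative blinfun_apply (q2 x)) (at x)) \<and> continuous_on UNIV q2"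

abbreviation bilinear :: "('a::real_normed_vector \<Rightarrow>\<^sub>L 'a \<Rightarrow>\<^sub>L real) \<Rightarrow> 'a \<Rightarrow> 'a \<Rightarrow> real" where
  "bilinear T h k \<equiv> blinfun_apply (blinfun_apply T h) k"

abbreviation second_order :: "'i set \<Rightarrow> ('i \<Rightarrow> 'a::real_normed_vector) \<Rightarrow> ('a \<Rightarrow>\<^sub>L 'a \<Rightarrow>\<^sub>L real) \<Rightarrow> real" where
  "second_order I e T \<equiv> \<Sum>i\<in>I. bilinear T (e i) (e i)"

lemma twice_diffD:
  assumes "twice_diff q q1 q2"
  shows "(q has_derivative blinfun_apply (q1 x)) (at x)" "(q1 has_derivative blinfun_apply (q2 x)) (at x)"
    "continuous_on UNIV q" "continuous_on UNIV q1" "continuous_on UNIV q2"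
proof -
  show d: "(q has_derivative blinfun_apply (q1 x)) (at x)" "(q1 has_derivative blinfun_apply (q2 x)) (at x)"
     "continuous_on UNIV q2" for x
    using assms by (auto simp: twice_diff_def)
  show "continuous_on UNIV q" "continuous_on UNIV q1"
    using has_derivative_continuous_on[of UNIV q "\<lambda>x. blinfun_apply (q1 x)"] d(1)
      has_derivative_continuous_on[of UNIV q1 "\<lambda>x. blinfun_apply (q2 x)"] d(2) by blast+
qed

lemma twice_diff_add:
  assumes "twice_diff p p1 p2" "twice_diff q q1 q2"
  shows "twice_diff (\<lambda>x. p x + q x) (\<lambda>x. p1 x + q1 x) (\<lambda>x. p2 x + q2 x)"
  unfolding twice_diff_def plus_blinfun.rep_eq
  by (intro conjI allI has_derivative_add continuous_on_add twice_diffD[OF assms(1)] twice_diffD[OF assms(2)])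

lemma twice_diff_add_const:
  assumes "twice_diff p p1 p2"
  shows "twice_diff (\<lambda>x. p x + c) p1 p2"
  using assms by (auto simp: twice_diff_def intro!: derivative_eq_intros)

lemma C2_on_twice_diff: "twice_diff q q1 q2 \<Longrightarrow> C2_on U q"
  unfolding C2_on_def twice_diff_def by (blast intro: continuous_on_subset)

text \<open>
  At 0 the difference quotient of a power of the positive part is the next lower power. Hence the cube of
  the positive part is twice continuously differentiable.
\<close>

lemma truncated_power_deriv:
  "((\<lambda>s::real. max 0 s ^ Suc (Suc n)) has_real_derivative real (n + 2) * max 0 s ^ Suc n) (at s)"
proof (cases s "0::real" rule: linorder_cases)
  case less
  have "((\<lambda>s::real. 0) has_real_derivative 0) (at s)" by simp
  then have "((\<lambda>s::real. max 0 s ^ Suc (Suc n)) has_real_derivative 0) (at s)"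
    by (rule has_field_derivative_transform_within_open[where S="{..<0}"]) (use less in auto)
  then show ?thesis using less by simp
next
  case equal
  have "((\<lambda>h::real. max 0 h ^ Suc n) \<longlongrightarrow> max 0 0 ^ Suc n) (at 0)"
    by (intro tendsto_intros)
  moreover have "(max 0 (0 + h) ^ Suc (Suc n) - max 0 0 ^ Suc (Suc n)) / h = max 0 h ^ Suc n"
    if "h \<noteq> 0" for h :: real
    using that by (cases "h > 0") (auto simp: max_def)
  ultimately show ?thesis
    unfolding equal DERIV_def by (subst LIM_equal[where g="\<lambda>h. max 0 h ^ Suc n"]) auto
next
  case greater
  have "((\<lambda>s::real. s ^ Suc (Suc n)) has_real_derivative real (n + 2) * s ^ Suc n) (at s)"
    using DERIV_pow[of "Suc (Suc n)" s] by (simp add: add.commute)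
  then have "((\<lambda>s::real. max 0 s ^ Suc (Suc n)) has_real_derivative real (n + 2) * s ^ Suc n) (at s)"
    by (rule has_field_derivative_transform_within_open[where S="{0<..}"]) (use greater in auto)
  then show ?thesis using greater by simp
qed

text \<open>
  Both the mollifier and the barrier used below are radial.
\<close>

lemma radial_twice_diff:
  fixes c :: "'a::euclidean_space"
  assumes P: "\<And>s. (P has_real_derivative P1 s) (at s)" "\<And>s. (P1 has_real_derivative P2 s) (at s)"
    and P2: "continuous_on UNIV P2"
  shows "\<exists>q1 q2. twice_diff (\<lambda>x. P ((x - c) \<bullet> (x - c))) q1 q2 \<and>
    (\<forall>x h k. bilinear (q2 x) h k =
       4 * P2 ((x - c) \<bullet> (x - c)) * ((x - c) \<bullet> h) * ((x - c) \<bullet> k) + 2 * P1 ((x - c) \<bullet> (x - c)) * (h \<bullet> k))"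
proof -
  define p where "p x = (x - c) \<bullet> (x - c)" for x
  define q1 where "q1 x = (2 * P1 (p x)) *\<^sub>R blinfun_inner_left (x - c)" for x
  define D where "D x h = (4 * P2 (p x) * ((x - c) \<bullet> h)) *\<^sub>R blinfun_inner_left (x - c)
      + (2 * P1 (p x)) *\<^sub>R blinfun_inner_left h" for x h
  have p: "(p has_derivative (\<lambda>h. 2 * ((x - c) \<bullet> h))) (at x)" for x
    unfolding p_def by (auto intro!: derivative_eq_intros simp: inner_commute)
  have d1: "((\<lambda>x. P (p x)) has_derivative blinfun_apply (q1 x)) (at x)" for x
    using DERIV_compose_FDERIV[OF P(1) p]
    by (rule has_derivative_eq_rhs) (auto simp: q1_def scaleR_blinfun.rep_eq inner_commute)
  have d1': "(q1 has_derivative D x) (at x)" for x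
  proof -
    have "((\<lambda>x. P1 (p x)) has_derivative (\<lambda>h. 2 * ((x - c) \<bullet> h) * P2 (p x))) (at x)"
      by (rule DERIV_compose_FDERIV[OF P(2) p])
    moreover have "((\<lambda>x. blinfun_inner_left (x - c)) has_derivative (\<lambda>h. blinfun_inner_left h)) (at x)"
      by (rule bounded_linear.has_derivative[OF bounded_linear_blinfun_inner_left])
         (auto intro!: derivative_eq_intros)
    ultimately show ?thesis
      unfolding q1_def D_def
      by (auto intro!: derivative_eq_intros simp: fun_eq_iff algebra_simps)
  qed
  define q2 where "q2 x = Blinfun (D x)" for x
  have q2: "blinfun_apply (q2 x) = D x" for x
    unfolding q2_def by (rule bounded_linear_Blinfun_apply[OF has_derivative_bounded_linear[OF d1']])
  have contp: "continuous_on UNIV p" unfolding p_def by (intro continuous_intros)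
  have "continuous_on UNIV P1"
    by (rule continuous_at_imp_continuous_on) (use DERIV_isCont[OF P(2)] in blast)
  from continuous_on_compose2[OF this contp] have "continuous_on UNIV (\<lambda>x. P1 (p x))" by simp
  moreover from continuous_on_compose2[OF P2 contp] have "continuous_on UNIV (\<lambda>x. P2 (p x))" by simp
  moreover have "continuous_on UNIV (\<lambda>x. blinfun_inner_left (x - c))"
    by (intro bounded_linear.continuous_on[OF bounded_linear_blinfun_inner_left] continuous_intros)
  ultimately have "continuous_on UNIV q2"
    by (intro continuous_on_blinfun_componentwise) (auto simp: q2 D_def intro!: continuous_intros)
  then have "twice_diff (\<lambda>x. P (p x)) q1 q2"
    using d1 d1' by (auto simp: twice_diff_def q2)
  moreover have "bilinear (q2 x) h k =
       4 * P2 (p x) * ((x - c) \<bullet> h) * ((x - c) \<bullet> k) + 2 * P1 (p x) * (h \<bullet> k)" for x h k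
    by (simp add: q2 D_def plus_blinfun.rep_eq scaleR_blinfun.rep_eq inner_commute)
  ultimately show ?thesis unfolding p_def by blast
qed

section \<open>Convolution with a compactly supported kernel\<close>

definition conv :: "('a::euclidean_space \<Rightarrow> real) \<Rightarrow> ('a \<Rightarrow> real) \<Rightarrow> 'a \<Rightarrow> real" where
  "conv k \<phi> x = (\<integral>y. k (x - y) * \<phi> y \<partial>lborel)"

lemma integrable_continuous_support:
  fixes f :: "'a::euclidean_space \<Rightarrow> real"
  assumes "continuous_on UNIV f" "\<And>z. r < norm (z - a) \<Longrightarrow> f z = 0"
  shows "integrable lborel f"
proof -
  have "integrable lborel (\<lambda>z. indicator (cball a r) z *\<^sub>R f z)"
    by (rule borel_integrable_compact) (auto intro: continuous_on_subset[OF assms(1)])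
  also have "(\<lambda>z. indicator (cball a r) z *\<^sub>R f z) = f"
    using assms(2) by (fastforce simp: indicator_def dist_norm norm_minus_commute)
  finally show ?thesis .
qed

lemma continuous_on_reflect:
  fixes k :: "'a::real_normed_vector \<Rightarrow> 'b::real_normed_vector"
  assumes "continuous_on UNIV k"
  shows "continuous_on UNIV (\<lambda>y. k (x - y))"
proof -
  have "continuous_on UNIV (\<lambda>y. x - y)" by (intro continuous_intros)
  from continuous_on_compose2[OF assms this] show ?thesis by simp
qed

lemma conv_integrable:
  fixes k :: "'a::euclidean_space \<Rightarrow> real"
  assumes "continuous_on UNIV k" "continuous_on UNIV \<phi>" "\<And>z. r < norm z \<Longrightarrow> \<phi> z = 0"
  shows "integrable lborel (\<lambda>y. k (x - y) * \<phi> y)"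
proof (rule integrable_continuous_support[where a=0 and r=r])
  show "continuous_on UNIV (\<lambda>y. k (x - y) * \<phi> y)"
    by (intro continuous_on_mult continuous_on_reflect assms)
qed (simp add: assms(3))

lemma lborel_integral_reflect:
  fixes f :: "'a::euclidean_space \<Rightarrow> real"
  assumes "f \<in> borel_measurable borel"
  shows "(\<integral>y. f (x - y) \<partial>lborel) = (\<integral>y. f y \<partial>lborel)"
proof -
  have "lborel = distr lborel borel (\<lambda>y. x + (-1) *\<^sub>R y)"
    using lborel_affine[of "-1" x] by (simp add: density_1)
  then have "(\<integral>y. f y \<partial>lborel) = (\<integral>y. f y \<partial>distr lborel borel (\<lambda>y. x + (-1) *\<^sub>R y))"
    by simp
  also have "\<dots> = (\<integral>y. f (x + (-1) *\<^sub>R y) \<partial>lborel)"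
    by (rule integral_distr) (use assms in auto)
  finally show ?thesis by simp
qed

lemma conv_flip:
  fixes k :: "'a::euclidean_space \<Rightarrow> real"
  assumes "continuous_on UNIV k" "continuous_on UNIV \<phi>"
  shows "conv k \<phi> x = (\<integral>y. k y * \<phi> (x - y) \<partial>lborel)"
proof -
  have "continuous_on UNIV (\<lambda>y. k y * \<phi> (x - y))"
    by (intro continuous_intros continuous_on_reflect assms)
  then show ?thesis
    using lborel_integral_reflect[OF borel_measurable_continuous_onI, of "\<lambda>y. k y * \<phi> (x - y)" x]
    by (simp add: conv_def)
qed

lemma conv_abs_le:
  fixes k :: "'a::euclidean_space \<Rightarrow> real"
  assumes k: "continuous_on UNIV k" and \<phi>: "continuous_on UNIV \<phi>" "\<And>z. r < norm z \<Longrightarrow> \<phi> z = 0"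
    and N: "\<And>y. \<bar>k y\<bar> \<le> N"
  shows "\<bar>conv k \<phi> x\<bar> \<le> N * (\<integral>z. \<bar>\<phi> z\<bar> \<partial>lborel)"
proof -
  have i: "integrable lborel (\<lambda>z. \<bar>\<phi> z\<bar>)"
    by (rule integrable_abs, rule integrable_continuous_support[where a=0 and r=r]) (use \<phi> in auto)
  have "\<bar>conv k \<phi> x\<bar> \<le> (\<integral>y. \<bar>k (x - y) * \<phi> y\<bar> \<partial>lborel)"
    unfolding conv_def by (rule integral_abs_bound)
  also have "\<dots> \<le> (\<integral>y. N * \<bar>\<phi> y\<bar> \<partial>lborel)"
  proof (rule integral_mono)
    show "integrable lborel (\<lambda>y. \<bar>k (x - y) * \<phi> y\<bar>)"
      by (rule integrable_abs) (rule conv_integrable[OF k \<phi>])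
    show "integrable lborel (\<lambda>y. N * \<bar>\<phi> y\<bar>)" using i by simp
    show "\<bar>k (x - y) * \<phi> y\<bar> \<le> N * \<bar>\<phi> y\<bar>" for y
      using N by (simp add: abs_mult mult_right_mono)
  qed
  finally show ?thesis by simp
qed

lemma integral_abs_support_le:
  fixes \<phi> :: "'a::euclidean_space \<Rightarrow> real"
  assumes "continuous_on UNIV \<phi>" "\<And>z. r < norm z \<Longrightarrow> \<phi> z = 0" "\<And>z. \<bar>\<phi> z\<bar> \<le> B"
  shows "(\<integral>z. \<bar>\<phi> z\<bar> \<partial>lborel) \<le> B * measure lborel (cball 0 r :: 'a set)"
proof -
  have i: "integrable lborel (\<lambda>z. \<bar>\<phi> z\<bar>)"
    by (rule integrable_abs, rule integrable_continuous_support[where a=0 and r=r]) (use assms in auto)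
  have "(\<integral>z. \<bar>\<phi> z\<bar> \<partial>lborel) \<le> (\<integral>z. B * indicator (cball (0::'a) r) z \<partial>lborel)"
  proof (rule integral_mono)
    show "integrable lborel (\<lambda>z. B * indicator (cball (0::'a) r) z :: real)"
      using emeasure_compact_finite[OF compact_cball[of "0::'a" r]]
      by (intro integrable_mult_right integrable_real_indicator) auto
    show "\<bar>\<phi> z\<bar> \<le> B * indicator (cball 0 r) z" for z :: 'a
      using assms(2)[of z] assms(3)[of z] by (cases "r < norm z") auto
  qed (rule i)
  also have "\<dots> = B * measure lborel (cball 0 r :: 'a set)" by simp
  finally show ?thesis .
qed

lemma conv_linear:
  fixes k :: "'a::euclidean_space \<Rightarrow> real"
  assumes "continuous_on UNIV k" "continuous_on UNIV l"
    and \<phi>: "continuous_on UNIV \<phi>" "\<And>z. r < norm z \<Longrightarrow> \<phi> z = 0"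
  shows "conv (\<lambda>y. k y + l y) \<phi> x = conv k \<phi> x + conv l \<phi> x"
    and "conv (\<lambda>y. k y - l y) \<phi> x = conv k \<phi> x - conv l \<phi> x"
    and "conv (\<lambda>y. c * k y) \<phi> x = c * conv k \<phi> x"
proof -
  have k: "integrable lborel (\<lambda>y. k (x - y) * \<phi> y)" and l: "integrable lborel (\<lambda>y. l (x - y) * \<phi> y)"
    by (rule conv_integrable[OF assms(1) \<phi>], simp, rule conv_integrable[OF assms(2) \<phi>], simp)
  show "conv (\<lambda>y. k y + l y) \<phi> x = conv k \<phi> x + conv l \<phi> x"
    unfolding conv_def distrib_right by (rule Bochner_Integration.integral_add[OF k l])
  show "conv (\<lambda>y. k y - l y) \<phi> x = conv k \<phi> x - conv l \<phi> x"
    unfolding conv_def left_diff_distrib by (rule Bochner_Integration.integral_diff[OF k l])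
  show "conv (\<lambda>y. c * k y) \<phi> x = c * conv k \<phi> x"
    unfolding conv_def mult.assoc by (rule integral_mult_right_zero)
qed

lemma conv_linear_kernel:
  fixes k :: "'a::euclidean_space \<Rightarrow> real"
  assumes k: "continuous_on UNIV k"
    and \<phi>: "continuous_on UNIV \<phi>" "\<And>z. r < norm z \<Longrightarrow> \<phi> z = 0"
    and \<psi>: "continuous_on UNIV \<psi>" "\<And>z. r < norm z \<Longrightarrow> \<psi> z = 0"
  shows "conv k (\<lambda>y. \<phi> y - \<psi> y) x = conv k \<phi> x - conv k \<psi> x"
proof -
  have "integrable lborel (\<lambda>y. k (x - y) * \<phi> y)" "integrable lborel (\<lambda>y. k (x - y) * \<psi> y)"
    by (rule conv_integrable[OF k \<phi>], simp, rule conv_integrable[OF k \<psi>], simp)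
  from Bochner_Integration.integral_diff[OF this] show ?thesis
    unfolding conv_def right_diff_distrib .
qed

lemma conv_kernel_sum:
  fixes k :: "'a::euclidean_space \<Rightarrow> real"
  assumes k: "continuous_on UNIV k"
    and \<phi>: "\<And>i. i \<in> I \<Longrightarrow> continuous_on UNIV (\<phi> i)" "\<And>i z. i \<in> I \<Longrightarrow> r < norm z \<Longrightarrow> \<phi> i z = 0"
  shows "conv k (\<lambda>y. \<Sum>i\<in>I. \<phi> i y) x = (\<Sum>i\<in>I. conv k (\<phi> i) x)"
    unfolding conv_def sum_distrib_left
    by (rule Bochner_Integration.integral_sum) (rule conv_integrable[OF k \<phi>])

lemma integral_UNIV_eq_box:
  fixes f :: "'a::euclidean_space \<Rightarrow> 'b::banach"
  assumes "\<And>y. y \<notin> Q \<Longrightarrow> f y = 0"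
  shows "integral UNIV f = integral Q f"
proof -
  have "f = (\<lambda>y. if y \<in> Q then f y else 0)" using assms by auto
  then show ?thesis by (metis integral_restrict_UNIV)
qed

text \<open>
  Convolution with a kernel that takes values in a Banach space, for the derivatives of a mollifier, which
  are operator-valued. Differentiation under the Henstock-Kurzweil integral holds in this generality; for
  real kernels \<open>bconv_eq_conv\<close> leads back to the Lebesgue integral.
\<close>

definition bconv :: "('a::euclidean_space \<Rightarrow> real) \<Rightarrow> ('a \<Rightarrow> 'b::banach) \<Rightarrow> 'a \<Rightarrow> 'b" where
  "bconv k \<phi> x = integral UNIV (\<lambda>y. k y *\<^sub>R \<phi> (x - y))"

lemma bconv_eq_conv:
  fixes k :: "'a::euclidean_space \<Rightarrow> real"
  assumes k: "continuous_on UNIV k" and \<phi>: "continuous_on UNIV \<phi>" "\<And>z. r < norm z \<Longrightarrow> \<phi> z = 0"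
  shows "bconv k \<phi> x = conv k \<phi> x"
proof -
  have "integrable lborel (\<lambda>y. k y * \<phi> (x - y))"
  proof (rule integrable_continuous_support[where a=x and r=r])
    show "continuous_on UNIV (\<lambda>y. k y * \<phi> (x - y))"
      by (intro continuous_on_mult continuous_on_reflect k \<phi>)
  qed (simp add: \<phi>(2) norm_minus_commute)
  from integral_lborel[OF this] show ?thesis
    by (simp add: bconv_def conv_flip[OF k \<phi>(1)])
qed

text \<open>
  As long as \<open>x\<close> stays in a unit ball, the integrand of a convolution is supported in one fixed box, so that
  the theorems on parametric integrals over boxes apply.
\<close>

lemma reflection_far_outside_box:
  fixes x0 :: "'a::euclidean_space"
  obtains a where "\<And>x y. x \<in> ball x0 1 \<Longrightarrow> y \<notin> cbox (-a) a \<Longrightarrow> r < norm (x - y)"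
proof -
  obtain a where a: "cball x0 (r + 1) \<subseteq> cbox (-a) a"
    using bounded_subset_cbox_symmetric[OF bounded_cball] by blast
  have "r < norm (x - y)" if "x \<in> ball x0 1" "y \<notin> cbox (-a) a" for x y
  proof -
    have "r + 1 < dist x0 y" using a that(2) by (meson linorder_not_le mem_cball subsetD)
    moreover have "dist x0 x < 1" using that by simp
    ultimately show ?thesis using dist_triangle[of x0 y x] by (simp add: dist_norm)
  qed
  then show ?thesis by (rule that)
qed

lemma continuous_on_conv_integrand:
  fixes k :: "'a::euclidean_space \<Rightarrow> real" and \<phi> :: "'a \<Rightarrow> 'b::real_normed_vector"
  assumes k: "continuous_on UNIV k" and \<phi>: "continuous_on UNIV \<phi>"
  shows "continuous_on S (\<lambda>(x, y). k y *\<^sub>R \<phi> (x - y))"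
proof -
  have "continuous_on S (\<lambda>p. fst p - snd p)" "continuous_on S (\<lambda>p. snd p)"
    by (intro continuous_intros)+
  then have "continuous_on S (\<lambda>p. \<phi> (fst p - snd p))" "continuous_on S (\<lambda>p. k (snd p))"
    using continuous_on_compose2[OF \<phi>] continuous_on_compose2[OF k] by auto
  then show ?thesis unfolding split_beta by (intro continuous_on_scaleR)
qed

lemma bconv_continuous:
  fixes k :: "'a::euclidean_space \<Rightarrow> real" and \<phi> :: "'a \<Rightarrow> 'b::banach"
  assumes k: "continuous_on UNIV k" and \<phi>: "continuous_on UNIV \<phi>" "\<And>z. r < norm z \<Longrightarrow> \<phi> z = 0"
  shows "continuous_on UNIV (bconv k \<phi>)"
proof -
  have "isCont (bconv k \<phi>) x0" for x0
  proof -
    obtain a where far: "\<And>x y. x \<in> ball x0 1 \<Longrightarrow> y \<notin> cbox (-a) a \<Longrightarrow> r < norm (x - y)"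
      using reflection_far_outside_box[of x0 r] by blast
    have ab: "bconv k \<phi> x = integral (cbox (-a) a) (\<lambda>y. k y *\<^sub>R \<phi> (x - y))" if "x \<in> ball x0 1" for x
      unfolding bconv_def by (rule integral_UNIV_eq_box) (use far[OF that] \<phi>(2) in auto)
    have "continuous_on (ball x0 1) (\<lambda>x. integral (cbox (-a) a) (\<lambda>y. k y *\<^sub>R \<phi> (x - y)))"
      by (rule integral_continuous_on_param) (rule continuous_on_conv_integrand[OF k \<phi>(1)])
    then have "continuous_on (ball x0 1) (bconv k \<phi>)"
      by (rule continuous_on_eq) (simp add: ab)
    then show ?thesis by (simp add: continuous_on_eq_continuous_at)
  qed
  then show ?thesis by (simp add: continuous_on_eq_continuous_at)
qed

text \<open>
  Outside the closed ball the function is locally constant.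
\<close>

lemma derivative_support:
  assumes "\<And>z. (\<phi> has_derivative blinfun_apply (\<phi>1 z)) (at z)" "\<And>z. r < norm z \<Longrightarrow> \<phi> z = 0"
    and "r < norm z"
  shows "\<phi>1 z = 0"
proof -
  have "open {z. r < norm z}" by (intro open_Collect_less continuous_intros)
  have "((\<lambda>z. 0) has_derivative blinfun_apply (\<phi>1 z)) (at z)"
    by (rule has_derivative_transform_within_open[OF assms(1) \<open>open _\<close>]) (use assms in auto)
  then have "blinfun_apply (\<phi>1 z) = (\<lambda>h. 0)"
    by (rule has_derivative_unique) simp
  then show ?thesis by (auto intro!: blinfun_eqI)
qed

lemma bconv_has_derivative:
  fixes k :: "'a::euclidean_space \<Rightarrow> real" and \<phi> :: "'a \<Rightarrow> 'b::banach"
  assumes k: "continuous_on UNIV k"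
    and d: "\<And>z. (\<phi> has_derivative blinfun_apply (\<phi>1 z)) (at z)" and c1: "continuous_on UNIV \<phi>1"
    and supp: "\<And>z. r < norm z \<Longrightarrow> \<phi> z = 0"
  shows "(bconv k \<phi> has_derivative blinfun_apply (bconv k \<phi>1 x0)) (at x0)"
proof -
  have \<phi>: "continuous_on UNIV \<phi>" 
    using has_derivative_continuous_on[of UNIV \<phi> "\<lambda>x. blinfun_apply (\<phi>1 x)"] d by blast
  obtain a where far: "\<And>x y. x \<in> ball x0 1 \<Longrightarrow> y \<notin> cbox (-a) a \<Longrightarrow> r < norm (x - y)"
    using reflection_far_outside_box[of x0 r] by blast
  have eq: "integral (cbox (-a) a) (\<lambda>y. k y *\<^sub>R \<phi> (x - y)) = bconv k \<phi> x" if "x \<in> ball x0 1" for x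
    unfolding bconv_def by (rule integral_UNIV_eq_box[symmetric]) (use far[OF that] supp in auto)
  have eq1: "integral (cbox (-a) a) (\<lambda>y. k y *\<^sub>R \<phi>1 (x0 - y)) = bconv k \<phi>1 x0"
    unfolding bconv_def
    by (rule integral_UNIV_eq_box[symmetric]) (use far[of x0] derivative_support[OF d supp] in auto)
  have "((\<lambda>x. integral (cbox (-a) a) (\<lambda>y. k y *\<^sub>R \<phi> (x - y))) has_derivative
      blinfun_apply (integral (cbox (-a) a) (\<lambda>y. k y *\<^sub>R \<phi>1 (x0 - y)))) (at x0 within ball x0 1)"
  proof (rule leibniz_rule)
    show "((\<lambda>x. k t *\<^sub>R \<phi> (x - t)) has_derivative blinfun_apply (k t *\<^sub>R \<phi>1 (x - t))) (at x within ball x0 1)" for x t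
    proof -
      have "((\<lambda>x. \<phi> (x - t)) has_derivative (\<lambda>h. blinfun_apply (\<phi>1 (x - t)) h)) (at x)"
        by (rule has_derivative_compose[OF _ d, of "\<lambda>x. x - t" "\<lambda>h. h", simplified])
           (auto intro!: derivative_eq_intros)
      from has_derivative_at_withinI[OF has_derivative_scaleR_right[OF this, of "k t"]] show ?thesis
        by (simp add: scaleR_blinfun.rep_eq)
    qed
    show "(\<lambda>y. k y *\<^sub>R \<phi> (x - y)) integrable_on cbox (-a) a" for x
      by (rule integrable_continuous, rule continuous_on_scaleR)
         (rule continuous_on_subset[OF k], simp, rule continuous_on_subset[OF continuous_on_reflect[OF \<phi>]], simp)
    show "continuous_on (ball x0 1 \<times> cbox (-a) a) (\<lambda>(x, y). k y *\<^sub>R \<phi>1 (x - y))"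
      by (rule continuous_on_conv_integrand[OF k c1])
  qed auto
  then have "((\<lambda>x. integral (cbox (-a) a) (\<lambda>y. k y *\<^sub>R \<phi> (x - y))) has_derivative
      blinfun_apply (bconv k \<phi>1 x0)) (at x0)"
    unfolding eq1 by (subst (asm) at_within_open) auto
  then show ?thesis
    by (rule has_derivative_transform_within_open[where s="ball x0 1"]) (auto simp: eq)
qed

lemma bconv_apply:
  fixes k :: "'a::euclidean_space \<Rightarrow> real" and \<phi> :: "'a \<Rightarrow> 'b::banach"
  assumes k: "continuous_on UNIV k" and \<phi>: "continuous_on UNIV \<phi>" "\<And>z. r < norm z \<Longrightarrow> \<phi> z = 0"
    and T: "bounded_linear T"
  shows "T (bconv k \<phi> x) = bconv k (\<lambda>z. T (\<phi> z)) x"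
proof -
  interpret T: bounded_linear T by fact
  obtain a where far: "\<And>y. y \<notin> cbox (-a) a \<Longrightarrow> r < norm (x - y)"
    using reflection_far_outside_box[of x r] by (metis centre_in_ball zero_less_one)
  have ab: "bconv k \<phi> x = integral (cbox (-a) a) (\<lambda>y. k y *\<^sub>R \<phi> (x - y))"
    "bconv k (\<lambda>z. T (\<phi> z)) x = integral (cbox (-a) a) (\<lambda>y. k y *\<^sub>R T (\<phi> (x - y)))"
    unfolding bconv_def by (rule integral_UNIV_eq_box, simp add: far \<phi>(2) T.zero)+
  have "(\<lambda>y. k y *\<^sub>R \<phi> (x - y)) integrable_on cbox (-a) a"
    by (rule integrable_continuous, rule continuous_on_scaleR)
       (rule continuous_on_subset[OF k], simp, rule continuous_on_subset[OF continuous_on_reflect[OF \<phi>(1)]], simp)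
  from integral_linear[OF this T] show ?thesis unfolding ab by (simp add: o_def T.scaleR)
qed

text \<open>
  Symmetry of the second derivative is part of the notion because it makes the complex Hessian of a
  mollified function Hermitian.
\<close>

locale mollifier =
  fixes \<delta> :: real and \<rho> :: "'a::euclidean_space \<Rightarrow> real" and \<rho>1 \<rho>2
  assumes pos: "0 < \<delta>" and nonneg: "0 \<le> \<rho> z" and supp: "\<delta> < norm z \<Longrightarrow> \<rho> z = 0"
    and diff: "twice_diff \<rho> \<rho>1 \<rho>2" and mass: "(\<integral>z. \<rho> z \<partial>lborel) = 1"
    and sym: "bilinear (\<rho>2 z) h k = bilinear (\<rho>2 z) k h"
begin

lemma supp1: "\<delta> < norm z \<Longrightarrow> \<rho>1 z = 0"
  using derivative_support[OF twice_diffD(1)[OF diff] supp] .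

lemma supp2: "\<delta> < norm z \<Longrightarrow> \<rho>2 z = 0"
  using derivative_support[OF twice_diffD(2)[OF diff] supp1] .

lemma cont: "continuous_on UNIV \<rho>" "continuous_on UNIV \<rho>1" "continuous_on UNIV \<rho>2"
  using twice_diffD[OF diff] by auto

lemma cont_apply: "continuous_on UNIV (\<lambda>z. bilinear (\<rho>2 z) h k)"
  by (intro blinfun.continuous_on continuous_intros cont)

text \<open>
  All derivatives fall on the kernel, so continuity of \<open>k\<close> suffices.
\<close>

lemma conv_twice_diff:
  assumes k: "continuous_on UNIV k"
  shows "\<exists>q1 q2. twice_diff (conv k \<rho>) q1 q2 \<and>
    (\<forall>x h l. bilinear (q2 x) h l = conv k (\<lambda>z. bilinear (\<rho>2 z) h l) x)"
proof -
  have eq: "bconv k \<rho> = conv k \<rho>" using bconv_eq_conv[OF k cont(1) supp] by auto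
  have "twice_diff (conv k \<rho>) (bconv k \<rho>1) (bconv k \<rho>2)"
    unfolding twice_diff_def eq[symmetric]
    using bconv_has_derivative[OF k twice_diffD(1)[OF diff] cont(2) supp]
      bconv_has_derivative[OF k twice_diffD(2)[OF diff] cont(3) supp1] bconv_continuous[OF k cont(3) supp2]
    by blast
  moreover have "bilinear (bconv k \<rho>2 x) h l = conv k (\<lambda>z. bilinear (\<rho>2 z) h l) x" for x h l
  proof -
    have "bounded_linear (\<lambda>B. bilinear B h l)"
      by (intro bounded_linear_compose[OF blinfun.bounded_linear_left] blinfun.bounded_linear_left)
    from bconv_apply[OF k cont(3) supp2 this] show ?thesis
      using bconv_eq_conv[OF k cont_apply, of \<delta>] supp2 by auto
  qed
  ultimately show ?thesis by blast
qed

lemma conv_mono: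
  assumes k: "continuous_on UNIV k" "continuous_on UNIV l"
    and le: "\<And>y. y \<in> cball x \<delta> \<Longrightarrow> k y \<le> l y"
  shows "conv k \<rho> x \<le> conv l \<rho> x"
  unfolding conv_def
proof (rule integral_mono)
  show "integrable lborel (\<lambda>y. k (x - y) * \<rho> y)" "integrable lborel (\<lambda>y. l (x - y) * \<rho> y)"
    by (rule conv_integrable[OF _ cont(1) supp], use k in auto)+
  show "k (x - y) * \<rho> y \<le> l (x - y) * \<rho> y" for y
    using le[of "x - y"] nonneg[of y] supp[of y] by (cases "\<delta> < norm y") (auto simp: dist_norm intro!: mult_right_mono)
qed

lemma conv_const: "conv (\<lambda>_. c) \<rho> x = c"
  by (simp add: conv_def mass)

lemma conv_near:
  assumes k: "continuous_on UNIV k" and near: "\<And>y. y \<in> cball x \<delta> \<Longrightarrow> \<bar>k y - c\<bar> \<le> \<omega>"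
  shows "\<bar>conv k \<rho> x - c\<bar> \<le> \<omega>"
proof -
  have "conv k \<rho> x \<le> conv (\<lambda>_. c + \<omega>) \<rho> x" "conv (\<lambda>_. c - \<omega>) \<rho> x \<le> conv k \<rho> x"
    using near by (force intro!: conv_mono k continuous_intros simp: abs_le_iff)+
  then show ?thesis by (auto simp: conv_const abs_le_iff)
qed

end

text \<open>
  The kernel is the normalized \<open>max 0 (\<delta>^2 - |x|^2) ^ 3\<close>; the exponent 3 is the smallest one for which
  the second derivative is continuous.
\<close>

lemma exists_mollifier:
  assumes "0 < \<delta>"
  shows "\<exists>\<rho> \<rho>1 \<rho>2. mollifier \<delta> (\<rho> :: 'a::euclidean_space \<Rightarrow> real) \<rho>1 \<rho>2"
proof -
  define P where "P s = max 0 (\<delta>\<^sup>2 - s) ^ 3" for s :: real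
  define \<rho>0 where "\<rho>0 x = P (x \<bullet> x)" for x :: 'a
  have zero: "\<rho>0 z = 0" if "\<delta> < norm z" for z
  proof -
    have "\<delta>\<^sup>2 \<le> z \<bullet> z" using that assms by (simp add: dot_square_norm power_mono)
    then show ?thesis by (simp add: \<rho>0_def P_def)
  qed
  have cont0: "continuous_on UNIV \<rho>0" unfolding \<rho>0_def P_def by (intro continuous_intros)
  have int0: "integrable lborel \<rho>0" by (rule integrable_continuous_support[where a=0 and r=\<delta>]) (use cont0 zero in auto)
  define c where "c = (\<integral>z. \<rho>0 z \<partial>lborel)"
  have "0 < c"
  proof -
    define m where "m = (\<delta>\<^sup>2 - (\<delta>/2)\<^sup>2) ^ 3"
    have "0 < m" using assms by (simp add: m_def power2_eq_square field_simps)
    have "m * indicator (cball 0 (\<delta>/2)) z \<le> \<rho>0 z" for z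
    proof (cases "z \<in> cball 0 (\<delta>/2)")
      case True
      then have "z \<bullet> z \<le> (\<delta>/2)\<^sup>2" by (simp add: dot_square_norm power_mono)
      moreover have "(\<delta>/2)\<^sup>2 \<le> \<delta>\<^sup>2" using assms by (intro power_mono) auto
      ultimately have "m \<le> P (z \<bullet> z)" unfolding m_def P_def by (intro power_mono) auto
      then show ?thesis using True by (simp add: \<rho>0_def)
    qed (simp add: \<rho>0_def P_def)
    then have "(\<integral>z. m * indicator (cball (0::'a) (\<delta>/2)) z \<partial>lborel) \<le> c"
      unfolding c_def using int0
      using emeasure_compact_finite[OF compact_cball[of "0::'a" "\<delta>/2"]]
      by (intro integral_mono) auto
    then have "m * measure lborel (cball 0 (\<delta>/2) :: 'a set) \<le> c" by simp
    moreover have "0 < measure lborel (cball 0 (\<delta>/2) :: 'a set)"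
      using content_cball_pos[of "\<delta>/2" "0::'a"] assms by simp
    ultimately show ?thesis using \<open>0 < m\<close> by (meson less_le_trans mult_pos_pos)
  qed
  define Q where "Q s = P s / c" for s
  have d1: "(Q has_real_derivative - 3 * max 0 (\<delta>\<^sup>2 - s) ^ 2 / c) (at s)" for s
  proof -
    have "((\<lambda>s. max 0 (\<delta>\<^sup>2 - s) ^ 3) has_real_derivative (3 * max 0 (\<delta>\<^sup>2 - s) ^ 2) * (- 1)) (at s)"
      by (rule DERIV_chain2[where f="\<lambda>s. max 0 s ^ 3"])
        (use truncated_power_deriv[of 1 "\<delta>\<^sup>2 - s"] in \<open>auto intro!: derivative_eq_intros simp: numeral_3_eq_3 numeral_2_eq_2\<close>)
    from DERIV_cdivide[OF this, of c] show ?thesis by (simp add: Q_def[abs_def] P_def)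
  qed
  have d2: "((\<lambda>s. - 3 * max 0 (\<delta>\<^sup>2 - s) ^ 2 / c) has_real_derivative 6 * max 0 (\<delta>\<^sup>2 - s) / c) (at s)" for s
  proof -
    have "((\<lambda>s. max 0 (\<delta>\<^sup>2 - s) ^ 2) has_real_derivative (2 * max 0 (\<delta>\<^sup>2 - s)) * (- 1)) (at s)"
      by (rule DERIV_chain2[where f="\<lambda>s. max 0 s ^ 2"])
        (use truncated_power_deriv[of 0 "\<delta>\<^sup>2 - s"] in \<open>auto intro!: derivative_eq_intros simp: numeral_3_eq_3 numeral_2_eq_2\<close>)
    from DERIV_cdivide[OF DERIV_cmult[OF this, of "-3"], of c] show ?thesis by simp
  qed
  have d2c: "continuous_on UNIV (\<lambda>s. 6 * max 0 (\<delta>\<^sup>2 - s) / c)"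
    using \<open>0 < c\<close> by (intro continuous_intros) auto
  obtain q1 q2 where q: "twice_diff (\<lambda>x::'a. Q ((x - 0) \<bullet> (x - 0))) q1 q2"
    "\<And>x h k. bilinear (q2 x) h k =
       4 * (6 * max 0 (\<delta>\<^sup>2 - (x - 0) \<bullet> (x - 0)) / c) * ((x - 0) \<bullet> h) * ((x - 0) \<bullet> k) + 2 * (- 3 * max 0 (\<delta>\<^sup>2 - (x - 0) \<bullet> (x - 0)) ^ 2 / c) * (h \<bullet> k)"
    using radial_twice_diff[OF d1 d2 d2c, of 0] by blast
  have "mollifier \<delta> (\<lambda>x::'a. Q (x \<bullet> x)) q1 q2"
  proof
    show "0 \<le> Q (z \<bullet> z)" for z :: 'a using \<open>0 < c\<close> by (simp add: Q_def P_def)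
    show "Q (z \<bullet> z) = 0" if "\<delta> < norm z" for z :: 'a using zero[OF that] by (simp add: Q_def \<rho>0_def)
    show "(\<integral>z. Q ((z::'a) \<bullet> z) \<partial>lborel) = 1"
      using \<open>0 < c\<close> by (simp add: Q_def c_def \<rho>0_def)
  qed (use assms q in \<open>auto simp: inner_commute\<close>)
  then show ?thesis by blast
qed

section \<open>A discrete second order operator and its resolvent\<close>

text \<open>
  A difference approximation of the second order operator \<open>L = \<Sum>i\<in>I. \<partial>\<^sub>e\<^sub>i\<^sup>2\<close> with step \<open>s\<close>. It involves
  translates of \<open>k\<close> only, and hence it makes sense for nonsmooth functions and commutes with convolution.
\<close>

definition sdiff :: "'i set \<Rightarrow> ('i \<Rightarrow> 'a::real_vector) \<Rightarrow> real \<Rightarrow> ('a \<Rightarrow> real) \<Rightarrow> 'a \<Rightarrow> real" where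
  "sdiff I e s k x = (\<Sum>i\<in>I. k (x + s *\<^sub>R e i) + k (x - s *\<^sub>R e i) - 2 * k x) / s\<^sup>2"

lemma sdiff_diff: "sdiff I e s (\<lambda>x. k x - l x) x = sdiff I e s k x - sdiff I e s l x"
  by (simp add: sdiff_def sum_subtractf sum.distrib diff_divide_distrib[symmetric] algebra_simps)

lemma sdiff_uminus: "sdiff I e s (\<lambda>x. - k x) x = - sdiff I e s k x"
  using sdiff_diff[of I e s "\<lambda>_. 0" k x] by (simp add: sdiff_def)

lemma sdiff_continuous:
  fixes k :: "'a::real_normed_vector \<Rightarrow> real"
  assumes k: "continuous_on UNIV k"
  shows "continuous_on UNIV (sdiff I e s k)"
proof -
  have shift: "continuous_on UNIV (\<lambda>z. k (z + a))" for a
  proof -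
    have "continuous_on UNIV (\<lambda>z. z + a)" by (intro continuous_intros)
    from continuous_on_compose2[OF k this] show ?thesis by simp
  qed
  have "continuous_on UNIV (\<lambda>z. (\<Sum>i\<in>I. k (z + s *\<^sub>R e i) + k (z + - (s *\<^sub>R e i)) - 2 * k z) * (1 / s\<^sup>2))"
    by (intro continuous_on_mult_right continuous_on_sum continuous_on_diff continuous_on_add
        continuous_on_mult_left shift k)
  then show ?thesis by (simp add: sdiff_def[abs_def])
qed

text \<open>
  At a point where \<open>g\<close> is close to its supremum the second differences are almost nonpositive.
  Quantitatively, \<open>sdiff I e s g y \<le> 2 |I| (S - g y) / s^2\<close> for the supremum \<open>S\<close>, and taking the supremum
  over \<open>y\<close> gives \<open>S \<le> N\<close>.
\<close>

lemma sdiff_max_principle: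
  assumes "finite I" "0 < \<mu>" "0 < s" and B: "\<And>x. g x \<le> B"
    and le: "\<And>x. g x - \<mu> * sdiff I e s g x \<le> N"
  shows "g x \<le> N"
proof -
  define S where "S = Sup (range g)"
  define c where "c = \<mu> / s\<^sup>2"
  have c: "0 < c" using assms by (simp add: c_def)
  have bdd: "bdd_above (range g)" by (rule bdd_aboveI2) (rule B)
  have gS: "g y \<le> S" for y unfolding S_def by (rule cSUP_upper[OF _ bdd]) simp
  define m where "m = real (card I)"
  have main: "g y \<le> (N + 2 * m * c * S) / (1 + 2 * m * c)" for y
  proof -
    have "(\<Sum>i\<in>I. g (y + s *\<^sub>R e i) + g (y - s *\<^sub>R e i) - 2 * g y) \<le> (\<Sum>i\<in>I. 2 * (S - g y))"
    proof (rule sum_mono)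
      fix i
      show "g (y + s *\<^sub>R e i) + g (y - s *\<^sub>R e i) - 2 * g y \<le> 2 * (S - g y)"
        using gS[of "y + s *\<^sub>R e i"] gS[of "y - s *\<^sub>R e i"] by (simp add: algebra_simps)
    qed
    also have "\<dots> = 2 * m * (S - g y)" by (simp add: m_def)
    finally have "c * (\<Sum>i\<in>I. g (y + s *\<^sub>R e i) + g (y - s *\<^sub>R e i) - 2 * g y) \<le> c * (2 * m * (S - g y))"
      using c by (intro mult_left_mono) auto
    moreover have "\<mu> * sdiff I e s g y = c * (\<Sum>i\<in>I. g (y + s *\<^sub>R e i) + g (y - s *\<^sub>R e i) - 2 * g y)"
      by (simp add: sdiff_def c_def)
    ultimately have "g y - c * (2 * m * (S - g y)) \<le> N" using le[of y] by linarith
    then have "g y * (1 + 2 * m * c) \<le> N + 2 * m * c * S" by (simp add: algebra_simps)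
    moreover have "0 < 1 + 2 * m * c" using c by (simp add: m_def add_pos_nonneg)
    ultimately show ?thesis by (simp add: pos_le_divide_eq)
  qed
  have pos: "0 < 1 + 2 * m * c" using c by (simp add: m_def add_pos_nonneg)
  have "S \<le> (N + 2 * m * c * S) / (1 + 2 * m * c)"
    unfolding S_def by (rule cSUP_least) (use main in \<open>auto simp: S_def\<close>)
  then have "S * (1 + 2 * m * c) \<le> N + 2 * m * c * S" using pos by (simp add: pos_le_divide_eq)
  then have "S \<le> N" by (simp add: algebra_simps)
  then show ?thesis using gS[of x] by linarith
qed

lemma sdiff_max_principle_abs:
  assumes "finite I" "0 < \<mu>" "0 < s" and B: "\<And>x. \<bar>g x\<bar> \<le> B"
    and le: "\<And>x. \<bar>g x - \<mu> * sdiff I e s g x\<bar> \<le> N"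
  shows "\<bar>g x\<bar> \<le> N"
proof -
  have "g x \<le> N"
    by (rule sdiff_max_principle[OF assms(1-3), where B=B and e=e]) (use B le in \<open>auto simp: abs_le_iff\<close>)
  moreover have "- g x \<le> N"
  proof (rule sdiff_max_principle[OF assms(1-3), where B=B and e=e and g="\<lambda>x. - g x"])
    show "- g y \<le> B" for y using B[of y] by linarith
    show "- g y - \<mu> * sdiff I e s (\<lambda>x. - g x) y \<le> N" for y using le[of y] by (simp add: sdiff_uminus)
  qed
  ultimately show ?thesis by linarith
qed

text \<open>
  Solved for the value at the centre, the equation \<open>g - \<mu> sdiff g = k\<close> says that \<open>g x\<close> is a weighted mean
  of \<open>k x\<close> and of the neighbouring values of \<open>g\<close>. The neighbours have total weight less than 1, so this
  is a fixed point equation for a contraction of the bounded continuous functions.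
\<close>

lemma discrete_resolvent_exists:
  fixes k :: "'a::euclidean_space \<Rightarrow> real"
  assumes fin: "finite I" and pos: "0 < \<mu>" "0 < s" and k: "continuous_on UNIV k" "\<And>x. \<bar>k x\<bar> \<le> N"
  shows "\<exists>g. continuous_on UNIV g \<and> (\<forall>x. \<bar>g x\<bar> \<le> N) \<and> (\<forall>x. g x - \<mu> * sdiff I e s g x = k x)"
proof -
  define c where "c = \<mu> / s\<^sup>2"
  have c: "0 < c" using pos by (simp add: c_def)
  define m where "m = real (card I)"
  define t where "t = 1 + 2 * m * c"
  have t: "0 < t" "0 \<le> 2 * m * c" using c by (auto simp: t_def m_def add_pos_nonneg)
  \<comment> \<open>the equation solved for the value at the centre\<close>
  define H where "H g x = (k x + c * (\<Sum>i\<in>I. g (x + s *\<^sub>R e i) + g (x - s *\<^sub>R e i))) / t" for g :: "'a \<Rightarrow> real" and x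
  have Hdist: "\<bar>H g x - H h x\<bar> \<le> 2 * m * c / t * b" if "\<And>x. \<bar>g x - h x\<bar> \<le> b" for g h b x
  proof -
    have "H g x - H h x = c * (\<Sum>i\<in>I. (g (x + s *\<^sub>R e i) - h (x + s *\<^sub>R e i)) + (g (x - s *\<^sub>R e i) - h (x - s *\<^sub>R e i))) / t"
      by (simp add: H_def sum.distrib sum_subtractf diff_divide_distrib[symmetric] algebra_simps)
    moreover have "\<bar>\<Sum>i\<in>I. (g (x + s *\<^sub>R e i) - h (x + s *\<^sub>R e i)) + (g (x - s *\<^sub>R e i) - h (x - s *\<^sub>R e i))\<bar> \<le> (\<Sum>i\<in>I. 2 * b)"
    proof (rule order_trans[OF sum_abs], rule sum_mono)
      fix i
      show "\<bar>(g (x + s *\<^sub>R e i) - h (x + s *\<^sub>R e i)) + (g (x - s *\<^sub>R e i) - h (x - s *\<^sub>R e i))\<bar> \<le> 2 * b"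
        using that[of "x + s *\<^sub>R e i"] that[of "x - s *\<^sub>R e i"] by linarith
    qed
    ultimately have "\<bar>H g x - H h x\<bar> \<le> c * (\<Sum>i\<in>I. 2 * b) / t"
      using c t by (simp add: abs_mult divide_right_mono mult_left_mono)
    then show ?thesis by (simp add: m_def mult_ac)
  qed
  have Hcont: "continuous_on UNIV (H g)" if "continuous_on UNIV g" for g
  proof -
    have "continuous_on UNIV (\<lambda>x. g (x + s *\<^sub>R e i))" "continuous_on UNIV (\<lambda>x. g (x - s *\<^sub>R e i))" for i
      by (rule continuous_on_compose2[OF that]; auto intro!: continuous_intros)+
    then show ?thesis unfolding H_def using t by (intro continuous_intros k) auto
  qed
  have Hb: "H g \<in> bcontfun" if g: "continuous_on UNIV g" "\<And>x. \<bar>g x\<bar> \<le> b" for g b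
  proof (rule bcontfun_normI[OF Hcont[OF g(1)]])
    fix x
    have "\<bar>H g x - H (\<lambda>_. 0) x\<bar> \<le> 2 * m * c / t * b" by (rule Hdist) (use g in simp)
    moreover have "\<bar>H (\<lambda>_. 0) x\<bar> \<le> N / t" using k(2)[of x] t by (simp add: H_def divide_right_mono)
    ultimately show "norm (H g x) \<le> N / t + 2 * m * c / t * b" by simp
  qed
  define T where "T g = Bcontfun (H (apply_bcontfun g))" for g :: "'a \<Rightarrow>\<^sub>C real"
  have bnd: "\<bar>apply_bcontfun g x\<bar> \<le> norm g" for g :: "'a \<Rightarrow>\<^sub>C real" and x
    using norm_bounded[of g x] by simp
  have T: "apply_bcontfun (T g) = H (apply_bcontfun g)" for g
    unfolding T_def by (rule Bcontfun_inverse) (rule Hb, auto intro: bnd)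
  have "\<exists>!g. T g = g"
  proof (rule banach_fix_type)
    show "0 \<le> 2 * m * c / t" "2 * m * c / t < 1"
      using t by (auto simp: pos_divide_less_eq) (simp add: t_def)
    show "\<forall>x y. dist (T x) (T y) \<le> 2 * m * c / t * dist x y"
    proof (intro allI)
      fix g h :: "'a \<Rightarrow>\<^sub>C real"
      show "dist (T g) (T h) \<le> 2 * m * c / t * dist g h"
      proof (rule dist_bound)
        fix x
        have "\<bar>H (apply_bcontfun g) x - H (apply_bcontfun h) x\<bar> \<le> 2 * m * c / t * dist g h"
          by (rule Hdist) (use dist_bounded[of g _ h] in \<open>simp add: dist_real_def\<close>)
        then show "dist (apply_bcontfun (T g) x) (apply_bcontfun (T h) x) \<le> 2 * m * c / t * dist g h"
          by (simp add: T dist_real_def)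
      qed
    qed
  qed
  then obtain gb where "T gb = gb" by blast
  then have fix': "H (apply_bcontfun gb) x = apply_bcontfun gb x" for x using T[of gb] by simp
  define g where "g = apply_bcontfun gb"
  have eq: "g x - \<mu> * sdiff I e s g x = k x" for x
  proof -
    have "t * g x = k x + c * (\<Sum>i\<in>I. g (x + s *\<^sub>R e i) + g (x - s *\<^sub>R e i))"
      using fix'[of x] t unfolding H_def g_def[symmetric] by (simp add: field_simps)
    moreover have "\<mu> * sdiff I e s g x = c * (\<Sum>i\<in>I. g (x + s *\<^sub>R e i) + g (x - s *\<^sub>R e i)) - 2 * m * c * g x"
      by (simp add: sdiff_def c_def m_def sum_subtractf algebra_simps diff_divide_distrib)
    ultimately show ?thesis by (simp add: t_def algebra_simps)
  qed
  have "\<bar>g x\<bar> \<le> N" for x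
    by (rule sdiff_max_principle_abs[OF fin pos, where B="norm gb" and e=e]) (use bnd k(2) eq in \<open>auto simp: g_def\<close>)
  then show ?thesis using eq by (intro exI[of _ g]) (auto simp: g_def)
qed

text \<open>
  Taylor's formula for \<open>q (x + t e) + q (x - t e)\<close> as a function of \<open>t\<close>, whose first derivative vanishes at
  0.
\<close>

lemma second_difference_error:
  assumes q: "twice_diff q q1 q2" and s: "0 < s"
    and close: "\<And>t. \<bar>t\<bar> \<le> s \<Longrightarrow> \<bar>bilinear (q2 (x + t *\<^sub>R e)) e e - bilinear (q2 x) e e\<bar> \<le> \<epsilon>"
  shows "\<bar>q (x + s *\<^sub>R e) + q (x - s *\<^sub>R e) - 2 * q x - s\<^sup>2 * bilinear (q2 x) e e\<bar> \<le> s\<^sup>2 * \<epsilon>"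
proof -
  define a0 where "a0 t = q (x + t *\<^sub>R e)" for t
  define a1 where "a1 t = blinfun_apply (q1 (x + t *\<^sub>R e)) e" for t
  define a2 where "a2 t = bilinear (q2 (x + t *\<^sub>R e)) e e" for t
  have line: "((\<lambda>t. x + t *\<^sub>R e) has_derivative (\<lambda>h. h *\<^sub>R e)) (at t)" for t
    by (auto intro!: derivative_eq_intros)
  have d0: "(a0 has_real_derivative a1 t) (at t)" for t
    unfolding a0_def a1_def has_field_derivative_def
    by (rule has_derivative_eq_rhs[OF has_derivative_compose[OF line twice_diffD(1)[OF q]]])
       (auto simp: blinfun.scaleR_right mult.commute)
  have "((\<lambda>t. q1 (x + t *\<^sub>R e)) has_derivative (\<lambda>h. blinfun_apply (q2 (x + t *\<^sub>R e)) (h *\<^sub>R e))) (at t)" for t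
    by (rule has_derivative_compose[OF line twice_diffD(2)[OF q]])
  then have "((\<lambda>t. blinfun_apply (q1 (x + t *\<^sub>R e)) e) has_derivative (\<lambda>h. bilinear (q2 (x + t *\<^sub>R e)) (h *\<^sub>R e) e)) (at t)" for t
    by (rule bounded_linear.has_derivative[OF blinfun.bounded_linear_left])
  then have d1: "(a1 has_real_derivative a2 t) (at t)" for t
    unfolding a1_def a2_def has_field_derivative_def
    by (rule has_derivative_eq_rhs) (auto simp: blinfun.scaleR_right blinfun.scaleR_left mult.commute)
  \<comment> \<open>the derivatives of the symmetrized function, up to order 2\<close>
  define D where "D n t = (if n = 0 then a0 t + a0 (- t) else if n = 1 then a1 t - a1 (- t) else a2 t + a2 (- t))" for n :: nat and t
  have dm: "((\<lambda>t. a0 (- t)) has_real_derivative - a1 (- t)) (at t)" "((\<lambda>t. a1 (- t)) has_real_derivative - a2 (- t)) (at t)" for t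
    using DERIV_mirror[of a0 "a1 (-t)" t] DERIV_mirror[of a1 "a2 (-t)" t] d0 d1 by auto
  have "DERIV (D m) t :> D (Suc m) t" if "m < 2" for m t
  proof (cases "m = 0")
    case True
    have "((\<lambda>t. a0 t + a0 (- t)) has_real_derivative a1 t + - a1 (- t)) (at t)"
      by (rule DERIV_add[OF d0 dm(1)])
    then show ?thesis using True by (simp add: D_def[abs_def])
  next
    case False
    then have "m = 1" using that by simp
    have "((\<lambda>t. a1 t - a1 (- t)) has_real_derivative a2 t - - a2 (- t)) (at t)"
      by (rule DERIV_diff[OF d1 dm(2)])
    then show ?thesis using \<open>m = 1\<close> by (simp add: D_def[abs_def])
  qed
  then obtain t where t: "0 < t" "t < s" and eq: "D 0 s = (\<Sum>m<2. D m 0 / fact m * s ^ m) + D 2 t / fact 2 * s ^ 2"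
    using Maclaurin[OF s, of 2 D "D 0"] by auto
  have eq': "a0 s + a0 (- s) - 2 * a0 0 - s\<^sup>2 * a2 0 = s\<^sup>2 * (((a2 t - a2 0) + (a2 (- t) - a2 0)) / 2)"
    using eq by (simp add: D_def lessThan_Suc eval_nat_numeral field_simps)
  have "\<bar>a2 t - a2 0\<bar> \<le> \<epsilon>" "\<bar>a2 (- t) - a2 0\<bar> \<le> \<epsilon>"
    using close[of t] close[of "-t"] t by (auto simp: a2_def)
  then have bound: "\<bar>((a2 t - a2 0) + (a2 (- t) - a2 0)) / 2\<bar> \<le> \<epsilon>" by (simp add: abs_le_iff)
  have "\<bar>a0 s + a0 (- s) - 2 * a0 0 - s\<^sup>2 * a2 0\<bar> = s\<^sup>2 * \<bar>((a2 t - a2 0) + (a2 (- t) - a2 0)) / 2\<bar>"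
    unfolding eq' abs_mult by simp
  also have "\<dots> \<le> s\<^sup>2 * \<epsilon>" by (rule mult_left_mono[OF bound]) simp
  finally have "\<bar>a0 s + a0 (- s) - 2 * a0 0 - s\<^sup>2 * a2 0\<bar> \<le> s\<^sup>2 * \<epsilon>" .
  then show ?thesis by (simp add: a0_def a2_def)
qed

lemma uniformly_continuous_compact_support:
  fixes \<phi> :: "'a::euclidean_space \<Rightarrow> real"
  assumes \<phi>: "continuous_on UNIV \<phi>" "\<And>z. r < norm z \<Longrightarrow> \<phi> z = 0" and \<epsilon>: "0 < \<epsilon>"
  shows "\<exists>d>0. \<forall>x y. dist x y < d \<longrightarrow> \<bar>\<phi> x - \<phi> y\<bar> < \<epsilon>"
proof -
  have "uniformly_continuous_on (cball 0 (r + 1)) \<phi>"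
    by (rule compact_uniformly_continuous) (auto intro: continuous_on_subset[OF \<phi>(1)])
  from this[unfolded uniformly_continuous_on_def, rule_format, OF \<epsilon>]
  obtain d where "0 < d" "\<forall>x\<in>cball 0 (r + 1). \<forall>y\<in>cball 0 (r + 1). dist y x < d \<longrightarrow> dist (\<phi> y) (\<phi> x) < \<epsilon>" by blast
  then have d: "0 < d" "\<And>x y. x \<in> cball 0 (r + 1) \<Longrightarrow> y \<in> cball 0 (r + 1) \<Longrightarrow> dist y x < d \<Longrightarrow> dist (\<phi> y) (\<phi> x) < \<epsilon>" by simp_all
  have "\<bar>\<phi> x - \<phi> y\<bar> < \<epsilon>" if xy: "dist x y < min d 1" for x y
  proof (cases "norm x \<le> r + 1 \<and> norm y \<le> r + 1")
    case True
    then show ?thesis using d(2)[of y x] xy by (simp add: dist_real_def)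
  next
    case False
    have "\<bar>norm x - norm y\<bar> < 1"
      using xy norm_triangle_ineq3[of x y] by (simp add: dist_norm)
    then have "r < norm x" "r < norm y" using False by linarith+
    then show ?thesis using \<phi>(2) \<epsilon> by simp
  qed
  then show ?thesis using d(1) by (intro exI[of _ "min d 1"]) auto
qed

lemma conv_sdiff_integrable:
  assumes i: "\<And>x. integrable lborel (\<lambda>y. k (x - y) * \<phi> y)"
  shows "conv (sdiff I e s k) \<phi> x = sdiff I e s (conv k \<phi>) x"
proof -
  have "sdiff I e s k (x - y) * \<phi> y = (\<Sum>i\<in>I. k (x + s *\<^sub>R e i - y) * \<phi> y + k (x - s *\<^sub>R e i - y) * \<phi> y - 2 * (k (x - y) * \<phi> y)) / s\<^sup>2" for y
    unfolding sdiff_def times_divide_eq_left sum_distrib_right by (simp add: algebra_simps)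
  then have "conv (sdiff I e s k) \<phi> x = (\<integral>y. (\<Sum>i\<in>I. k (x + s *\<^sub>R e i - y) * \<phi> y + k (x - s *\<^sub>R e i - y) * \<phi> y - 2 * (k (x - y) * \<phi> y)) / s\<^sup>2 \<partial>lborel)"
    by (simp only: conv_def)
  also have "\<dots> = (\<Sum>i\<in>I. conv k \<phi> (x + s *\<^sub>R e i) + conv k \<phi> (x - s *\<^sub>R e i) - 2 * conv k \<phi> x) / s\<^sup>2"
    unfolding conv_def by (simp add: i Bochner_Integration.integral_sum)
  finally show ?thesis by (simp add: sdiff_def)
qed

lemma conv_sdiff:
  fixes k :: "'a::euclidean_space \<Rightarrow> real"
  assumes k: "continuous_on UNIV k" and \<phi>: "continuous_on UNIV \<phi>" "\<And>z. r < norm z \<Longrightarrow> \<phi> z = 0"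
  shows "conv (sdiff I e s k) \<phi> x = sdiff I e s (conv k \<phi>) x"
  by (rule conv_sdiff_integrable) (rule conv_integrable[OF k \<phi>])

lemma conv_commute:
  assumes "continuous_on UNIV k" "continuous_on UNIV \<phi>"
  shows "conv k \<phi> x = conv \<phi> k x"
  by (simp add: conv_flip[OF assms]) (simp add: conv_def mult.commute)

lemma conv_sdiff_kernel:
  fixes k :: "'a::euclidean_space \<Rightarrow> real"
  assumes k: "continuous_on UNIV k" and \<phi>: "continuous_on UNIV \<phi>" "\<And>z. r < norm z \<Longrightarrow> \<phi> z = 0"
  shows "conv k (sdiff I e s \<phi>) x = sdiff I e s (conv k \<phi>) x"
proof -
  have "integrable lborel (\<lambda>y. \<phi> (x' - y) * k y)" for x'
  proof (rule integrable_continuous_support[where a=x' and r=r])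
    show "continuous_on UNIV (\<lambda>y. \<phi> (x' - y) * k y)"
      by (intro continuous_on_mult continuous_on_reflect k \<phi>)
  qed (simp add: \<phi>(2) norm_minus_commute)
  from conv_sdiff_integrable[OF this]
  have "conv (sdiff I e s \<phi>) k x = sdiff I e s (conv \<phi> k) x" .
  moreover have "conv \<phi> k = conv k \<phi>" using conv_commute[OF k \<phi>(1)] by auto
  moreover have "conv k (sdiff I e s \<phi>) x = conv (sdiff I e s \<phi>) k x"
    by (rule conv_commute[OF k sdiff_continuous[OF \<phi>(1)]])
  ultimately show ?thesis by (simp only:)
qed

context mollifier
begin

text \<open>
  The function \<open>L \<rho>\<close> for \<open>L = \<Sum>i\<in>I. \<partial>\<^sub>e\<^sub>i\<^sup>2\<close>; convolving \<open>g\<close> with it gives \<open>L (g * \<rho>)\<close>.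
\<close>

definition L_kernel :: "'i set \<Rightarrow> ('i \<Rightarrow> 'a) \<Rightarrow> 'a \<Rightarrow> real" where
  "L_kernel I e z = second_order I e (\<rho>2 z)"

lemma L_kernel_cont: "continuous_on UNIV (L_kernel I e)"
  unfolding L_kernel_def[abs_def] by (intro continuous_on_sum cont_apply)

lemma L_kernel_supp: "\<delta> < norm z \<Longrightarrow> L_kernel I e z = 0"
  by (simp add: L_kernel_def supp2)

lemma sdiff_kernel_consistent:
  assumes fin: "finite I" and \<epsilon>: "0 < \<epsilon>"
  shows "\<exists>s0>0. \<forall>s. 0 < s \<and> s < s0 \<longrightarrow> (\<forall>z. \<bar>sdiff I e s \<rho> z - L_kernel I e z\<bar> \<le> \<epsilon>)"
proof -
  define \<epsilon>' where "\<epsilon>' = \<epsilon> / (real (card I) + 1)"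
  have \<epsilon>': "0 < \<epsilon>'" "real (card I) * \<epsilon>' \<le> \<epsilon>" using \<epsilon> by (auto simp: \<epsilon>'_def field_simps)
  define h where "h i z = bilinear (\<rho>2 z) (e i) (e i)" for i z
  have "\<forall>i. \<exists>d>0. \<forall>x y. dist x y < d \<longrightarrow> \<bar>h i x - h i y\<bar> < \<epsilon>'"
    unfolding h_def using uniformly_continuous_compact_support[OF cont_apply _ \<epsilon>'(1), of \<delta>] supp2 by simp
  then obtain d where d: "\<And>i. 0 < d i" "\<And>i x y. dist x y < d i \<Longrightarrow> \<bar>h i x - h i y\<bar> < \<epsilon>'"
    by metis
  define s0 where "s0 = Min (insert 1 ((\<lambda>i. d i / (norm (e i) + 1)) ` I))"
  have pos: "0 < d i / (norm (e i) + 1)" for i using d(1)[of i] by (simp add: add_nonneg_pos)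
  have s0: "0 < s0" using fin pos by (auto simp: s0_def)
  have "\<bar>sdiff I e s \<rho> z - L_kernel I e z\<bar> \<le> \<epsilon>" if s: "0 < s" "s < s0" for s z
  proof -
    have each: "\<bar>\<rho> (z + s *\<^sub>R e i) + \<rho> (z - s *\<^sub>R e i) - 2 * \<rho> z - s\<^sup>2 * h i z\<bar> \<le> s\<^sup>2 * \<epsilon>'" if i: "i \<in> I" for i
      unfolding h_def
    proof (rule second_difference_error[OF diff s(1)])
      fix t :: real assume t: "\<bar>t\<bar> \<le> s"
      have "s0 \<le> d i / (norm (e i) + 1)" unfolding s0_def using fin i by (intro Min_le) auto
      then have "s < d i / (norm (e i) + 1)" using s by linarith
      then have "s * (norm (e i) + 1) < d i"
        by (simp add: pos_less_divide_eq add_nonneg_pos)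
      moreover have "dist (z + t *\<^sub>R e i) z \<le> s * (norm (e i) + 1)"
        using t s by (simp add: dist_norm mult_mono)
      ultimately have "\<bar>h i (z + t *\<^sub>R e i) - h i z\<bar> < \<epsilon>'" by (intro d(2)) simp
      then show "\<bar>bilinear (\<rho>2 (z + t *\<^sub>R e i)) (e i) (e i) - bilinear (\<rho>2 z) (e i) (e i)\<bar> \<le> \<epsilon>'"
        by (simp add: h_def)
    qed
    have s2: "0 < s\<^sup>2" using s by simp
    have "sdiff I e s \<rho> z - L_kernel I e z = (\<Sum>i\<in>I. \<rho> (z + s *\<^sub>R e i) + \<rho> (z - s *\<^sub>R e i) - 2 * \<rho> z - s\<^sup>2 * h i z) / s\<^sup>2"
      using s2 by (simp add: sdiff_def L_kernel_def h_def sum_subtractf sum_distrib_left[symmetric] diff_divide_distrib)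
    moreover have "\<bar>\<Sum>i\<in>I. \<rho> (z + s *\<^sub>R e i) + \<rho> (z - s *\<^sub>R e i) - 2 * \<rho> z - s\<^sup>2 * h i z\<bar> \<le> (\<Sum>i\<in>I. s\<^sup>2 * \<epsilon>')"
      by (rule order_trans[OF sum_abs]) (rule sum_mono[OF each])
    ultimately have "\<bar>sdiff I e s \<rho> z - L_kernel I e z\<bar> \<le> (\<Sum>i\<in>I. s\<^sup>2 * \<epsilon>') / s\<^sup>2"
      using s2 divide_right_mono[of _ "\<Sum>i\<in>I. s\<^sup>2 * \<epsilon>'" "s\<^sup>2"] by (simp only: abs_divide abs_of_pos less_imp_le)
    also have "\<dots> = real (card I) * \<epsilon>'" using s2 by simp
    finally show ?thesis using \<epsilon>'(2) by linarith
  qed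
  then show ?thesis using s0 by blast
qed

text \<open>
  The step size depends on \<open>g\<close> only through its bound: the difference of the two operators can be moved to
  the fixed kernel \<open>\<rho>\<close>. This uniformity is essential, because below \<open>g\<close> is a resolvent that itself
  depends on the step size.
\<close>

lemma sdiff_conv_consistent:
  assumes fin: "finite I" and \<epsilon>: "0 < \<epsilon>"
  shows "\<exists>s0>0. \<forall>s g x. 0 < s \<longrightarrow> s < s0 \<longrightarrow> continuous_on UNIV g \<longrightarrow> (\<forall>y. \<bar>g y\<bar> \<le> N) \<longrightarrow>
    \<bar>sdiff I e s (conv g \<rho>) x - conv g (L_kernel I e) x\<bar> \<le> \<epsilon>"
proof -
  \<comment> \<open>a radius that contains the supports of all translates of the kernel for steps below 1\<close>
  define R where "R = \<delta> + (\<Sum>i\<in>I. norm (e i))"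
  define vol where "vol = measure lborel (cball (0::'a) R)"
  define \<epsilon>' where "\<epsilon>' = \<epsilon> / (\<bar>N\<bar> * vol + 1)"
  have vol: "0 \<le> vol" by (simp add: vol_def)
  have den: "0 < \<bar>N\<bar> * vol + 1" using vol by (simp add: add_nonneg_pos)
  have \<epsilon>': "0 < \<epsilon>'" using \<epsilon> den by (simp add: \<epsilon>'_def)
  have "\<bar>N\<bar> * vol / (\<bar>N\<bar> * vol + 1) \<le> 1" using den by simp
  then have small: "\<bar>N\<bar> * (\<epsilon>' * vol) \<le> \<epsilon>"
    using mult_left_mono[of "\<bar>N\<bar> * vol / (\<bar>N\<bar> * vol + 1)" 1 \<epsilon>] \<epsilon> by (simp add: \<epsilon>'_def mult_ac)
  obtain s0 where s0: "0 < s0" and cons: "\<And>s z. 0 < s \<Longrightarrow> s < s0 \<Longrightarrow> \<bar>sdiff I e s \<rho> z - L_kernel I e z\<bar> \<le> \<epsilon>'"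
    using sdiff_kernel_consistent[OF fin \<epsilon>', of e] by blast
  have "\<bar>sdiff I e s (conv g \<rho>) x - conv g (L_kernel I e) x\<bar> \<le> \<epsilon>"
    if s: "0 < s" "s < min s0 1" and g: "continuous_on UNIV g" "\<And>y. \<bar>g y\<bar> \<le> N" for s g x
  proof -
    have far: "\<delta> < norm z" "\<delta> < norm (z + s *\<^sub>R e i)" "\<delta> < norm (z - s *\<^sub>R e i)" if z: "R < norm z" and i: "i \<in> I" for z i
    proof -
      have "norm (e i) \<le> (\<Sum>i\<in>I. norm (e i))" using fin i by (intro member_le_sum) auto
      moreover have "norm (s *\<^sub>R e i) \<le> norm (e i)" using s by (simp add: mult_left_le_one_le)
      ultimately have "\<delta> + norm (s *\<^sub>R e i) < norm z" using z by (simp add: R_def)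
      then show "\<delta> < norm (z + s *\<^sub>R e i)" "\<delta> < norm (z - s *\<^sub>R e i)"
        using norm_triangle_ineq4[of "z + s *\<^sub>R e i" "s *\<^sub>R e i"] norm_triangle_ineq[of "z - s *\<^sub>R e i" "s *\<^sub>R e i"] by auto
      show "\<delta> < norm z" using \<open>\<delta> + norm (s *\<^sub>R e i) < norm z\<close> norm_ge_zero[of "s *\<^sub>R e i"] by linarith
    qed
    have supS: "sdiff I e s \<rho> z = 0" if "R < norm z" for z
      unfolding sdiff_def using far[OF that] by (simp add: supp)
    have supL: "L_kernel I e z = 0" if "R < norm z" for z
      unfolding L_kernel_def using far(1)[OF that] by (simp add: supp2)
    have contS: "continuous_on UNIV (sdiff I e s \<rho>)" by (rule sdiff_continuous[OF cont(1)])
    define \<phi> where "\<phi> z = sdiff I e s \<rho> z - L_kernel I e z" for z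
    have \<phi>: "continuous_on UNIV \<phi>" "\<And>z. R < norm z \<Longrightarrow> \<phi> z = 0" "\<And>z. \<bar>\<phi> z\<bar> \<le> \<epsilon>'"
      using cons s supS supL contS L_kernel_cont unfolding \<phi>_def by (auto intro!: continuous_on_diff)
    have "0 \<le> N" using g(2)[of 0] by linarith
    have "sdiff I e s (conv g \<rho>) x - conv g (L_kernel I e) x = conv g \<phi> x"
    proof -
      have "conv g \<phi> x = conv g (sdiff I e s \<rho>) x - conv g (L_kernel I e) x"
        unfolding \<phi>_def by (rule conv_linear_kernel[OF g(1) contS supS L_kernel_cont supL])
      then show ?thesis by (simp only: conv_sdiff_kernel[OF g(1) cont(1) supp])
    qed
    also have "\<bar>\<dots>\<bar> \<le> N * (\<integral>z. \<bar>\<phi> z\<bar> \<partial>lborel)"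
      by (rule conv_abs_le[OF g(1) \<phi>(1,2) g(2)])
    also have "\<dots> \<le> \<bar>N\<bar> * (\<epsilon>' * vol)"
      using integral_abs_support_le[OF \<phi>] \<open>0 \<le> N\<close> by (simp add: vol_def mult_left_mono)
    finally show ?thesis using small by linarith
  qed
  then show ?thesis using s0 by (intro exI[of _ "min s0 1"]) auto
qed

end

section \<open>Mollifying viscosity subsolutions of linear inequalities\<close>

text \<open>
  Viscosity subsolutions of \<open>\<beta> \<le> L u\<close> in \<open>V\<close> for \<open>L = \<Sum>i\<in>I. \<partial>\<^sub>e\<^sub>i\<^sup>2\<close>. Only test functions that are smooth on the
  whole space are admitted, which keeps their second derivative a total function.
\<close>

definition viscosity_linear :: "'i set \<Rightarrow> ('i \<Rightarrow> 'a::euclidean_space) \<Rightarrow> 'a set \<Rightarrow> real \<Rightarrow> ('a \<Rightarrow> real) \<Rightarrow> bool" where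
  "viscosity_linear I e V \<beta> u \<longleftrightarrow>
     (\<forall>x\<in>V. \<forall>q q1 q2. twice_diff q q1 q2 \<longrightarrow> u x = q x \<longrightarrow> (\<forall>\<^sub>F y in nhds x. u y \<le> q y) \<longrightarrow>
        \<beta> \<le> second_order I e (q2 x))"

text \<open>
  A supersolution of \<open>b - \<mu> L b = 0\<close> that is large on the sphere but only of order \<open>\<mu>^2\<close> at the centre. It
  localizes comparison with the resolvent at a cost that remains negligible after division by \<open>\<mu>\<close>. With
  \<open>w = |x - x1|^2 / r^2\<close> one has \<open>L w \<le> c\<close> and \<open>L (w^2) \<le> 6 c w\<close>, which determines the coefficients of
  \<open>b = B (6 \<mu>^2 c^2 + 6 \<mu> c w + w^2)\<close> one after the other, starting from \<open>w^2\<close>.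
\<close>

lemma resolvent_barrier:
  fixes x1 :: "'a::euclidean_space" and e :: "'i \<Rightarrow> 'a" and I :: "'i set"
  assumes r: "0 < r" and \<mu>: "0 < \<mu>" and B: "0 \<le> B"
  defines "c \<equiv> 2 * (\<Sum>i\<in>I. (norm (e i))\<^sup>2) / r\<^sup>2"
  shows "\<exists>b b1 b2. twice_diff b b1 b2 \<and> b x1 = B * (6 * \<mu>\<^sup>2 * c\<^sup>2) \<and> (\<forall>x. norm (x - x1) = r \<longrightarrow> B \<le> b x) \<and> (\<forall>x. 0 \<le> b x) \<and>
     (\<forall>x\<in>cball x1 r. \<mu> * second_order I e (b2 x) \<le> b x)"
proof -
  define A where "A = (\<Sum>i\<in>I. (norm (e i))\<^sup>2)"
  have A: "0 \<le> A" by (simp add: A_def sum_nonneg)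
  have c: "c = 2 * A / r\<^sup>2" "0 \<le> c" using A by (auto simp: c_def A_def)
  define d0 where "d0 = 6 * \<mu>\<^sup>2 * c\<^sup>2"
  define d1 where "d1 = 6 * \<mu> * c"
  have d: "0 \<le> d0" "0 \<le> d1" using \<mu> c(2) by (auto simp: d0_def d1_def)
  have r2: "0 < r\<^sup>2" using r by simp
  define P where "P t = B * (d0 + d1 * (t / r\<^sup>2) + (t / r\<^sup>2)\<^sup>2)" for t
  define P1 where "P1 t = B * (d1 / r\<^sup>2 + 2 * t / r\<^sup>2 / r\<^sup>2)" for t
  define P2 where "P2 t = B * (2 / r\<^sup>2 / r\<^sup>2)" for t :: real
  have PP: "(P has_real_derivative P1 t) (at t)" "(P1 has_real_derivative P2 t) (at t)" for t
    unfolding P_def P1_def P2_def using r2 by (auto intro!: derivative_eq_intros simp: field_simps power2_eq_square)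
  obtain b1 b2 where td: "twice_diff (\<lambda>x. P ((x - x1) \<bullet> (x - x1))) b1 b2"
    and b2: "\<And>x h k. bilinear (b2 x) h k =
       4 * P2 ((x - x1) \<bullet> (x - x1)) * ((x - x1) \<bullet> h) * ((x - x1) \<bullet> k) + 2 * P1 ((x - x1) \<bullet> (x - x1)) * (h \<bullet> k)"
    using radial_twice_diff[OF PP, of x1] by (auto simp: P2_def[abs_def])
  define b where "b x = P ((x - x1) \<bullet> (x - x1))" for x
  have "b x1 = B * (6 * \<mu>\<^sup>2 * c\<^sup>2)" by (simp add: b_def P_def d0_def)
  moreover have "0 \<le> b x" for x
    using B d r2 by (auto simp: b_def P_def intro!: mult_nonneg_nonneg add_nonneg_nonneg divide_nonneg_pos)
  moreover have "B \<le> b x" if "norm (x - x1) = r" for x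
  proof -
    have "(x - x1) \<bullet> (x - x1) = r\<^sup>2" using that by (simp add: dot_square_norm)
    then have "b x = B * (d0 + d1 + 1)" using r2 by (simp add: b_def P_def)
    moreover have "B * 1 \<le> B * (d0 + d1 + 1)" using B d by (intro mult_left_mono) auto
    ultimately show ?thesis by simp
  qed
  moreover have "\<mu> * second_order I e (b2 x) \<le> b x" if x: "x \<in> cball x1 r" for x
  proof -
    define t where "t = (x - x1) \<bullet> (x - x1)"
    define w where "w = t / r\<^sup>2"
    have t: "0 \<le> t" by (simp add: t_def)
    have w: "0 \<le> w" "t = w * r\<^sup>2" using t r2 by (auto simp: w_def)
    have P2: "0 \<le> P2 t" using B by (simp add: P2_def)
    have "second_order I e (b2 x) \<le> (\<Sum>i\<in>I. (4 * P2 t * t + 2 * P1 t) * (norm (e i))\<^sup>2)"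
    proof (rule sum_mono)
      fix i
      have "((x - x1) \<bullet> e i)\<^sup>2 \<le> t * (norm (e i))\<^sup>2"
        using Cauchy_Schwarz_ineq[of "x - x1" "e i"] by (simp add: t_def dot_square_norm)
      then have "4 * P2 t * ((x - x1) \<bullet> e i)\<^sup>2 \<le> 4 * P2 t * (t * (norm (e i))\<^sup>2)"
        using P2 by (intro mult_left_mono) auto
      then show "bilinear (b2 x) (e i) (e i) \<le> (4 * P2 t * t + 2 * P1 t) * (norm (e i))\<^sup>2"
        unfolding b2 t_def[symmetric] by (simp add: power2_eq_square algebra_simps dot_square_norm)
    qed
    also have "\<dots> = (4 * P2 t * t + 2 * P1 t) * A" by (simp add: A_def sum_distrib_left)
    also have "\<dots> = B * (c * (d1 + 6 * w))"
      unfolding P1_def P2_def c(1) w(2) using r2 by (simp add: field_simps)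
    finally have "\<mu> * second_order I e (b2 x) \<le> \<mu> * (B * (c * (d1 + 6 * w)))"
      using \<mu> by (intro mult_left_mono) auto
    also have "\<dots> = B * (d0 + d1 * w)" by (simp add: d0_def d1_def power2_eq_square algebra_simps)
    also have "\<dots> \<le> B * (d0 + d1 * w + w\<^sup>2)" using B by (intro mult_left_mono) auto
    also have "\<dots> = b x" by (simp add: b_def P_def t_def w_def)
    finally show ?thesis .
  qed
  ultimately show ?thesis using td unfolding b_def by blast
qed

lemma (in mollifier) conv_resolvent:
  assumes g: "continuous_on UNIV g"
    and res: "\<And>x. g x - \<mu> * sdiff I e s g x = u x"
  shows "conv g \<rho> x - \<mu> * sdiff I e s (conv g \<rho>) x = conv u \<rho> x"
proof -
  have sc: "continuous_on UNIV (sdiff I e s g)" by (rule sdiff_continuous[OF g])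
  have "u = (\<lambda>x. g x - \<mu> * sdiff I e s g x)" using res by auto
  then have "conv u \<rho> x = conv g \<rho> x - conv (\<lambda>y. \<mu> * sdiff I e s g y) \<rho> x"
    using conv_linear(2)[OF g continuous_on_mult[OF continuous_on_const sc] cont(1) supp] by simp
  also have "conv (\<lambda>y. \<mu> * sdiff I e s g y) \<rho> x = \<mu> * conv (sdiff I e s g) \<rho> x"
    by (rule conv_linear(3)[OF sc sc cont(1) supp])
  finally show ?thesis by (simp add: conv_sdiff[OF g cont(1) supp])
qed

text \<open>
  If \<open>u\<close> were smooth, \<open>u - \<mu> L u \<le> u - \<mu> \<beta>\<close> would give \<open>u \<le> g - \<mu> \<beta>\<close> by the maximum principle. As \<open>u\<close> is
  only a viscosity subsolution, the smooth function \<open>G = g * \<rho>\<close> takes the role of \<open>g\<close>: at a maximum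
  of \<open>u - G - b\<close> inside the ball, \<open>G + b\<close> plus a constant touches \<open>u\<close> from above, and the equation of \<open>G\<close>
  bounds \<open>L G\<close> there. The error terms come from mollification (\<open>\<omega>\<close>), from discretization (\<open>\<kappa>\<close>) and from
  the barrier.
\<close>

lemma (in mollifier) subsolution_below_resolvent:
  assumes fin: "finite I" and u: "continuous_on UNIV u" "\<And>x. \<bar>u x\<bar> \<le> N"
    and visc: "viscosity_linear I e V \<beta> u" and x1: "cball x1 r \<subseteq> V" "0 < r"
    and \<mu>: "0 < \<mu>" "\<mu> \<le> 1" and s: "0 < s"
    and g: "continuous_on UNIV g" "\<And>x. \<bar>g x\<bar> \<le> N" "\<And>x. g x - \<mu> * sdiff I e s g x = u x"
    and \<omega>: "\<And>x. \<bar>conv u \<rho> x - u x\<bar> \<le> \<omega>"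
    and \<kappa>: "\<And>x. \<bar>sdiff I e s (conv g \<rho>) x - conv g (L_kernel I e) x\<bar> \<le> \<kappa>"
  shows "u x1 \<le> g x1 + 2 * \<omega> - \<mu> * \<beta> + \<mu> * \<kappa>
     + (2 * N + \<bar>\<beta>\<bar>) * (6 * \<mu>\<^sup>2 * (2 * (\<Sum>i\<in>I. (norm (e i))\<^sup>2) / r\<^sup>2)\<^sup>2)"
proof -
  have N: "0 \<le> N" using u(2)[of x1] by linarith
  have nn: "0 \<le> \<omega>" "0 \<le> \<kappa>" using \<omega>[of x1] \<kappa>[of x1] by linarith+
  define B where "B = 2 * N + \<bar>\<beta>\<bar>"
  have B: "0 \<le> B" using N by (simp add: B_def)
  obtain b b1 b2 where b: "twice_diff b b1 b2" "b x1 = B * (6 * \<mu>\<^sup>2 * (2 * (\<Sum>i\<in>I. (norm (e i))\<^sup>2) / r\<^sup>2)\<^sup>2)"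
    "\<And>x. norm (x - x1) = r \<Longrightarrow> B \<le> b x" "\<And>x. 0 \<le> b x"
    "\<And>x. x \<in> cball x1 r \<Longrightarrow> \<mu> * second_order I e (b2 x) \<le> b x"
    using resolvent_barrier[OF x1(2) \<mu>(1) B, where I=I and e=e and ?x1.0=x1] by blast
  define G where "G = conv g \<rho>"
  obtain G1 G2 where G: "twice_diff G G1 G2"
    and G2: "\<And>x h l. bilinear (G2 x) h l = conv g (\<lambda>z. bilinear (\<rho>2 z) h l) x"
    using conv_twice_diff[OF g(1)] unfolding G_def by blast
  have LG: "second_order I e (G2 x) = conv g (L_kernel I e) x" for x
    unfolding G2 L_kernel_def[abs_def]
    by (rule conv_kernel_sum[OF g(1) cont_apply, where r=\<delta>, symmetric]) (simp add: supp2)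
  have Geq: "G x - \<mu> * sdiff I e s G x = conv u \<rho> x" for x
    unfolding G_def by (rule conv_resolvent[OF g(1) g(3)])
  have Gb: "\<bar>G x\<bar> \<le> N" for x
  proof -
    have "\<bar>conv g \<rho> x - 0\<bar> \<le> N" by (rule conv_near[OF g(1)]) (use g(2) in simp)
    then show ?thesis by (simp add: G_def)
  qed
  have Gg: "\<bar>G x - g x\<bar> \<le> \<omega>" for x
  proof (rule sdiff_max_principle_abs[OF fin \<mu>(1) s, where B="2 * N" and e=e and g="\<lambda>x. G x - g x"])
    show "\<bar>G x - g x\<bar> \<le> 2 * N" for x using Gb[of x] g(2)[of x] by linarith
    show "\<bar>G x - g x - \<mu> * sdiff I e s (\<lambda>x. G x - g x) x\<bar> \<le> \<omega>" for x
      using Geq[of x] g(3)[of x] \<omega>[of x] by (simp add: sdiff_diff algebra_simps)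
  qed
  define F where "F x = u x - G x - b x" for x
  have "continuous_on (cball x1 r) F"
    unfolding F_def using u(1) twice_diffD(3)[OF G] twice_diffD(3)[OF b(1)]
    by (intro continuous_on_diff) (auto intro: continuous_on_subset)
  then obtain y where y: "y \<in> cball x1 r" and max: "\<And>x. x \<in> cball x1 r \<Longrightarrow> F x \<le> F y"
    using continuous_attains_sup[of "cball x1 r" F] x1(2) by auto
  have "F y \<le> \<omega> + \<mu> * \<kappa> - \<mu> * \<beta>"
  proof (cases "norm (y - x1) = r")
    case True
    have "\<mu> * \<beta> \<le> \<bar>\<beta>\<bar>"
      using \<mu> mult_left_le_one_le[of "\<bar>\<beta>\<bar>" \<mu>] mult_left_mono[of \<beta> "\<bar>\<beta>\<bar>" \<mu>] by linarith
    moreover have "0 \<le> \<mu> * \<kappa>" using \<mu> nn by simp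
    moreover have "F y \<le> - \<bar>\<beta>\<bar>"
      using b(3)[OF True] u(2)[of y] Gb[of y] by (simp add: F_def B_def abs_le_iff)
    ultimately show ?thesis using nn by linarith
  next
    case False
    then have yb: "y \<in> ball x1 r" using y by (auto simp: dist_norm norm_minus_commute)
    \<comment> \<open>the smooth function that touches \<open>u\<close> from above at \<open>y\<close>\<close>
    define q where "q x = G x + b x + F y" for x
    have q: "twice_diff q (\<lambda>x. G1 x + b1 x) (\<lambda>x. G2 x + b2 x)"
      unfolding q_def by (rule twice_diff_add_const[OF twice_diff_add[OF G b(1)]])
    have "\<forall>\<^sub>F x in nhds y. x \<in> ball x1 r"
      by (rule eventually_nhds_in_open) (use yb in auto)
    then have "\<forall>\<^sub>F x in nhds y. u x \<le> q x"
    proof (rule eventually_mono)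
      fix x assume "x \<in> ball x1 r"
      then show "u x \<le> q x" using max[of x] by (simp add: F_def q_def)
    qed
    moreover have "u y = q y" by (simp add: q_def F_def)
    moreover have "y \<in> V" using y x1 by blast
    ultimately have "\<beta> \<le> second_order I e (G2 y + b2 y)"
      using visc q unfolding viscosity_linear_def by blast
    also have "\<dots> = conv g (L_kernel I e) y + second_order I e (b2 y)"
      by (simp add: plus_blinfun.rep_eq sum.distrib LG)
    finally have "\<mu> * \<beta> \<le> \<mu> * conv g (L_kernel I e) y + \<mu> * second_order I e (b2 y)"
      using \<mu> by (simp add: distrib_left[symmetric])
    moreover have "\<mu> * conv g (L_kernel I e) y \<le> \<mu> * sdiff I e s G y + \<mu> * \<kappa>"
    proof -
      have "conv g (L_kernel I e) y \<le> sdiff I e s G y + \<kappa>" using \<kappa>[of y] by (simp add: G_def abs_le_iff)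
      from mult_left_mono[OF this, of \<mu>] show ?thesis using \<mu> by (simp add: distrib_left)
    qed
    ultimately show ?thesis using b(5)[OF y] Geq[of y] \<omega>[of y] by (simp add: F_def abs_le_iff)
  qed
  moreover have "F x1 \<le> F y" by (rule max) (use x1 in simp)
  ultimately show ?thesis using Gg[of x1] b(2) by (simp add: F_def B_def abs_le_iff)
qed

lemma exists_uniform_mollifier:
  fixes u :: "'a::euclidean_space \<Rightarrow> real"
  assumes u: "uniformly_continuous_on UNIV u" and \<omega>: "0 < \<omega>"
  shows "\<exists>\<eta> \<rho> \<rho>1 \<rho>2. mollifier \<eta> \<rho> \<rho>1 \<rho>2 \<and> (\<forall>x. \<bar>conv u \<rho> x - u x\<bar> \<le> \<omega>)"
proof -
  from u[unfolded uniformly_continuous_on_def, rule_format, OF \<omega>]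
  obtain d where "0 < d" "\<forall>x\<in>UNIV. \<forall>y\<in>UNIV. dist y x < d \<longrightarrow> dist (u y) (u x) < \<omega>" by blast
  then have d: "0 < d" "\<And>x y. dist y x < d \<Longrightarrow> dist (u y) (u x) < \<omega>" by simp_all
  obtain \<rho> :: "'a \<Rightarrow> real" and \<rho>1 \<rho>2 where "mollifier (d / 2) \<rho> \<rho>1 \<rho>2"
    using exists_mollifier[of "d / 2"] d(1) by auto
  then interpret mollifier "d / 2" \<rho> \<rho>1 \<rho>2 .
  have "\<bar>conv u \<rho> x - u x\<bar> \<le> \<omega>" for x
  proof (rule conv_near[OF uniformly_continuous_imp_continuous[OF u]])
    fix y assume "y \<in> cball x (d / 2)"
    then have "dist y x < d" using d(1) by (simp add: dist_commute)
    then show "\<bar>u y - u x\<bar> \<le> \<omega>" using d(2)[of y x] by (simp add: dist_real_def)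
  qed
  then show ?thesis using mollifier_axioms by blast
qed

text \<open>
  For a smooth function the resolvent is within \<open>O(\<mu>)\<close> of it; the given \<open>u\<close> is within \<open>\<omega>\<close> of a smooth one,
  and resolvents of functions at distance \<open>\<omega>\<close> are at distance at most \<open>\<omega>\<close>.
\<close>

lemma resolvent_approximates:
  fixes u :: "'a::euclidean_space \<Rightarrow> real" and e :: "'i \<Rightarrow> 'a"
  assumes fin: "finite I" and u: "uniformly_continuous_on UNIV u" "\<And>x. \<bar>u x\<bar> \<le> N" and \<omega>: "0 < \<omega>"
  shows "\<exists>C \<sigma>. 0 \<le> C \<and> 0 < \<sigma> \<and> (\<forall>\<mu> s g x. 0 < \<mu> \<longrightarrow> 0 < s \<longrightarrow> s < \<sigma> \<longrightarrow> (\<forall>x. \<bar>g x\<bar> \<le> N) \<longrightarrow>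
     (\<forall>x. g x - \<mu> * sdiff I e s g x = u x) \<longrightarrow> \<bar>g x - u x\<bar> \<le> 2 * \<omega> + \<mu> * C)"
proof -
  have uc: "continuous_on UNIV u" by (rule uniformly_continuous_imp_continuous[OF u(1)])
  obtain \<eta> and \<rho> :: "'a \<Rightarrow> real" and \<rho>1 \<rho>2 where m: "mollifier \<eta> \<rho> \<rho>1 \<rho>2" and near: "\<And>x. \<bar>conv u \<rho> x - u x\<bar> \<le> \<omega>"
    using exists_uniform_mollifier[OF u(1) \<omega>] by blast
  interpret mollifier \<eta> \<rho> \<rho>1 \<rho>2 by (rule m)
  obtain \<sigma> where \<sigma>: "0 < \<sigma>" and cons: "\<And>s g x. 0 < s \<Longrightarrow> s < \<sigma> \<Longrightarrow> continuous_on UNIV g \<Longrightarrow> (\<And>y. \<bar>g y\<bar> \<le> N) \<Longrightarrow>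
    \<bar>sdiff I e s (conv g \<rho>) x - conv g (L_kernel I e) x\<bar> \<le> 1"
    using sdiff_conv_consistent[OF fin, where \<epsilon>=1 and e=e and N=N] by (metis zero_less_one)
  define C where "C = N * (\<integral>z. \<bar>L_kernel I e z\<bar> \<partial>lborel) + 1"
  have N: "0 \<le> N" using u(2)[of undefined] by linarith
  have C: "0 \<le> C" using N by (simp add: C_def add_nonneg_nonneg)
  have Cs: "\<bar>sdiff I e s (conv u \<rho>) x\<bar> \<le> C" if "0 < s" "s < \<sigma>" for s x
  proof -
    have "\<bar>conv u (L_kernel I e) x\<bar> \<le> N * (\<integral>z. \<bar>L_kernel I e z\<bar> \<partial>lborel)"
      by (rule conv_abs_le[OF uc L_kernel_cont L_kernel_supp u(2)])
    then show ?thesis using cons[OF that uc u(2), of x] unfolding C_def by linarith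
  qed
  have ub: "\<bar>conv u \<rho> x\<bar> \<le> N" for x
    using conv_near[OF uc, of x 0 N] u(2) by simp
  have "\<bar>g x - u x\<bar> \<le> 2 * \<omega> + \<mu> * C"
    if \<mu>: "0 < \<mu>" and s: "0 < s" "s < \<sigma>" and g: "\<And>x. \<bar>g x\<bar> \<le> N" "\<And>x. g x - \<mu> * sdiff I e s g x = u x" for \<mu> s g x
  proof -
    have "\<bar>g x - conv u \<rho> x\<bar> \<le> \<omega> + \<mu> * C"
    proof (rule sdiff_max_principle_abs[OF fin \<mu> s(1), where B="2 * N" and e=e and g="\<lambda>x. g x - conv u \<rho> x"])
      show "\<bar>g x - conv u \<rho> x\<bar> \<le> 2 * N" for x using g(1)[of x] ub[of x] by linarith
      fix x
      have "g x - conv u \<rho> x - \<mu> * sdiff I e s (\<lambda>x. g x - conv u \<rho> x) x = (u x - conv u \<rho> x) + \<mu> * sdiff I e s (conv u \<rho>) x"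
        using g(2)[of x] by (simp add: sdiff_diff algebra_simps)
      moreover have "\<bar>\<mu> * sdiff I e s (conv u \<rho>) x\<bar> \<le> \<mu> * C"
        using Cs[OF s, of x] \<mu> by (simp add: abs_mult)
      ultimately show "\<bar>g x - conv u \<rho> x - \<mu> * sdiff I e s (\<lambda>x. g x - conv u \<rho> x) x\<bar> \<le> \<omega> + \<mu> * C"
        using near[of x] by linarith
    qed
    then show ?thesis using near[of x] by linarith
  qed
  then show ?thesis using C \<sigma> by blast
qed

text \<open>
  Let \<open>W = g * \<rho>\<close> and \<open>w = u * \<rho>\<close>, where \<open>g\<close> is the resolvent of \<open>u\<close>. Convolving the bound of
  \<open>subsolution_below_resolvent\<close> with \<open>\<rho>\<close> gives \<open>w \<le> W - \<mu> \<beta> + o(\<mu>)\<close> at \<open>x0\<close>. On the other hand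
  \<open>W - w = \<mu> sdiff W\<close>, so \<open>\<beta> \<le> sdiff W + o(1)\<close>; here \<open>sdiff W\<close> is close to \<open>L W\<close>, and \<open>L W\<close> is close to
  \<open>L w\<close> because \<open>g\<close> is uniformly close to \<open>u\<close>.
\<close>

theorem (in mollifier) mollified_subsolution:
  assumes fin: "finite I" and u: "uniformly_continuous_on UNIV u" "\<And>x. \<bar>u x\<bar> \<le> N"
    and visc: "viscosity_linear I e V \<beta> u" and V: "cball x0 r \<subseteq> V" "\<delta> < r"
  shows "\<beta> \<le> conv u (L_kernel I e) x0"
proof (rule field_le_epsilon)
  fix \<epsilon>0 :: real assume "0 < \<epsilon>0"
  define \<epsilon> where "\<epsilon> = \<epsilon>0 / 7"
  have \<epsilon>: "0 < \<epsilon>" using \<open>0 < \<epsilon>0\<close> by (simp add: \<epsilon>_def)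
  have uc: "continuous_on UNIV u" by (rule uniformly_continuous_imp_continuous[OF u(1)])
  have N: "0 \<le> N" using u(2)[of x0] by linarith
  define K where "K = (\<integral>z. \<bar>L_kernel I e z\<bar> \<partial>lborel)"
  have K: "0 \<le> K" by (simp add: K_def)
  define r' where "r' = r - \<delta>"
  have r': "0 < r'" using V by (simp add: r'_def)
  define C2 where "C2 = (2 * N + \<bar>\<beta>\<bar>) * (6 * (2 * (\<Sum>i\<in>I. (norm (e i))\<^sup>2) / r'\<^sup>2)\<^sup>2)"
  have C2: "0 \<le> C2" using N by (simp add: C2_def)
  \<comment> \<open>The parameters are chosen in the order \<open>\<omega>1\<close>, \<open>\<mu>\<close>, \<open>\<omega>2\<close>, \<open>s\<close>: the second mollification error
    has to be small relative to \<open>\<mu>\<close>, and the step size comes last.\<close>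
  define \<omega>1 where "\<omega>1 = \<epsilon> / (2 * (K + 1))"
  have \<omega>1: "0 < \<omega>1" "K * (2 * \<omega>1) \<le> \<epsilon>" using \<epsilon> K by (auto simp: \<omega>1_def field_simps add_nonneg_pos)
  obtain C1 \<sigma>1 where C1: "0 \<le> C1" "0 < \<sigma>1"
    and appr: "\<And>\<mu> s g x. 0 < \<mu> \<Longrightarrow> 0 < s \<Longrightarrow> s < \<sigma>1 \<Longrightarrow> (\<And>x. \<bar>g x\<bar> \<le> N) \<Longrightarrow>
     (\<And>x. g x - \<mu> * sdiff I e s g x = u x) \<Longrightarrow> \<bar>g x - u x\<bar> \<le> 2 * \<omega>1 + \<mu> * C1"
    using resolvent_approximates[OF fin u \<omega>1(1), where e=e] by blast
  define \<mu> where "\<mu> = min 1 (min (\<epsilon> / (K * C1 + 1)) (\<epsilon> / (C2 + 1)))"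
  have \<mu>: "0 < \<mu>" "\<mu> \<le> 1" "\<mu> * (K * C1) \<le> \<epsilon>" "\<mu> * C2 \<le> \<epsilon>"
  proof -
    have pos: "0 < K * C1 + 1" "0 < C2 + 1" using K C1 C2 by (auto intro: add_nonneg_pos)
    then show "0 < \<mu>" "\<mu> \<le> 1" using \<epsilon> by (auto simp: \<mu>_def)
    have "\<mu> \<le> \<epsilon> / (K * C1 + 1)" "\<mu> \<le> \<epsilon> / (C2 + 1)" by (auto simp: \<mu>_def)
    then have "\<mu> * (K * C1 + 1) \<le> \<epsilon>" "\<mu> * (C2 + 1) \<le> \<epsilon>" using pos by (auto simp: pos_le_divide_eq)
    then show "\<mu> * (K * C1) \<le> \<epsilon>" "\<mu> * C2 \<le> \<epsilon>" using \<open>0 < \<mu>\<close> by (auto simp: distrib_left)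
  qed
  define \<omega>2 where "\<omega>2 = \<mu> * \<epsilon> / 2"
  have \<omega>2: "0 < \<omega>2" using \<mu> \<epsilon> by (simp add: \<omega>2_def)
  obtain \<eta> and \<rho>' :: "'a \<Rightarrow> real" and \<rho>1' \<rho>2' where m': "mollifier \<eta> \<rho>' \<rho>1' \<rho>2'" and near: "\<And>x. \<bar>conv u \<rho>' x - u x\<bar> \<le> \<omega>2"
    using exists_uniform_mollifier[OF u(1) \<omega>2] by blast
  interpret m': mollifier \<eta> \<rho>' \<rho>1' \<rho>2' by (rule m')
  obtain \<sigma>2 where \<sigma>2: "0 < \<sigma>2" and cons': "\<And>s g x. 0 < s \<Longrightarrow> s < \<sigma>2 \<Longrightarrow> continuous_on UNIV g \<Longrightarrow> (\<And>y. \<bar>g y\<bar> \<le> N) \<Longrightarrow>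
    \<bar>sdiff I e s (conv g \<rho>') x - conv g (m'.L_kernel I e) x\<bar> \<le> \<epsilon>"
    using m'.sdiff_conv_consistent[OF fin \<epsilon>, where e=e and N=N] by metis
  obtain \<sigma>3 where \<sigma>3: "0 < \<sigma>3" and cons: "\<And>s g x. 0 < s \<Longrightarrow> s < \<sigma>3 \<Longrightarrow> continuous_on UNIV g \<Longrightarrow> (\<And>y. \<bar>g y\<bar> \<le> N) \<Longrightarrow>
    \<bar>sdiff I e s (conv g \<rho>) x - conv g (L_kernel I e) x\<bar> \<le> \<epsilon>"
    using sdiff_conv_consistent[OF fin \<epsilon>, where e=e and N=N] by metis
  define s where "s = min \<sigma>1 (min \<sigma>2 \<sigma>3) / 2"
  have s: "0 < s" "s < \<sigma>1" "s < \<sigma>2" "s < \<sigma>3" using C1(2) \<sigma>2 \<sigma>3 by (auto simp: s_def)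
  obtain g where g: "continuous_on UNIV g" "\<And>x. \<bar>g x\<bar> \<le> N" "\<And>x. g x - \<mu> * sdiff I e s g x = u x"
    using discrete_resolvent_exists[OF fin \<mu>(1) s(1) uc u(2), where e=e] by blast
  define E where "E = 2 * \<omega>2 - \<mu> * \<beta> + \<mu> * \<epsilon> + \<mu>\<^sup>2 * C2"
  have point: "u x \<le> g x + E" if x: "x \<in> cball x0 \<delta>" for x
  proof -
    have "cball x r' \<subseteq> V"
    proof
      fix y assume "y \<in> cball x r'"
      then have "dist x0 y \<le> r" using x dist_triangle[of x0 y x] by (simp add: r'_def)
      then show "y \<in> V" using V by auto
    qed
    from m'.subsolution_below_resolvent[OF fin uc u(2) visc this r' \<mu>(1,2) s(1) g near cons'[OF s(1,3) g(1,2)]]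
    show ?thesis by (simp add: E_def C2_def algebra_simps)
  qed
  have "conv u \<rho> x0 \<le> conv (\<lambda>y. g y + E) \<rho> x0"
    by (rule conv_mono[OF uc]) (use point g(1) in \<open>auto intro!: continuous_intros\<close>)
  also have "\<dots> = conv g \<rho> x0 + E"
    using conv_linear(1)[OF g(1) continuous_on_const cont(1) supp] by (simp add: conv_const)
  finally have "- E \<le> \<mu> * sdiff I e s (conv g \<rho>) x0"
    using conv_resolvent[OF g(1) g(3), of x0] by linarith
  moreover have "\<mu>\<^sup>2 * C2 \<le> \<mu> * \<epsilon>"
    using mult_left_mono[OF \<mu>(4), of \<mu>] \<mu>(1) by (simp add: power2_eq_square mult.assoc)
  ultimately have "\<mu> * (\<beta> - 3 * \<epsilon>) \<le> \<mu> * sdiff I e s (conv g \<rho>) x0"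
    by (simp add: E_def \<omega>2_def algebra_simps)
  then have 1: "\<beta> - 3 * \<epsilon> \<le> sdiff I e s (conv g \<rho>) x0" using \<mu>(1) by simp
  have 2: "\<bar>sdiff I e s (conv g \<rho>) x0 - conv g (L_kernel I e) x0\<bar> \<le> \<epsilon>" by (rule cons[OF s(1,4) g(1,2)])
  have gu: "continuous_on UNIV (\<lambda>x. g x - u x)" using g(1) uc by (rule continuous_on_diff)
  have "\<bar>conv (\<lambda>x. g x - u x) (L_kernel I e) x0\<bar> \<le> (2 * \<omega>1 + \<mu> * C1) * K"
    unfolding K_def by (rule conv_abs_le[OF gu L_kernel_cont L_kernel_supp appr[OF \<mu>(1) s(1,2) g(2,3)]])
  also have "\<dots> \<le> 2 * \<epsilon>" using \<omega>1(2) \<mu>(3) by (simp add: algebra_simps)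
  finally have 3: "\<bar>conv g (L_kernel I e) x0 - conv u (L_kernel I e) x0\<bar> \<le> 2 * \<epsilon>"
    by (simp add: conv_linear(2)[OF g(1) uc L_kernel_cont L_kernel_supp])
  show "\<beta> \<le> conv u (L_kernel I e) x0 + \<epsilon>0" using 1 2 3 \<open>0 < \<epsilon>0\<close> unfolding \<epsilon>_def by linarith
qed

section \<open>The complex Hessian as a family of real second derivatives\<close>

lemma dir_deriv_eq:
  assumes "(g has_derivative D) (at z)"
  shows "dir_deriv e g z = D e"
proof -
  have "((\<lambda>t::real. z + t *\<^sub>R e) has_derivative (\<lambda>t. t *\<^sub>R e)) (at 0)"
    by (auto intro!: derivative_eq_intros)
  moreover have "(g has_derivative D) (at (z + 0 *\<^sub>R e))" using assms by simp
  ultimately have "((\<lambda>t::real. g (z + t *\<^sub>R e)) has_derivative (\<lambda>t. D (t *\<^sub>R e))) (at 0)"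
    by (rule has_derivative_compose)
  moreover have "D (t *\<^sub>R e) = t *\<^sub>R D e" for t
    using has_derivative_bounded_linear[OF assms] by (simp add: linear_simps)
  ultimately have "((\<lambda>t::real. g (z + t *\<^sub>R e)) has_vector_derivative D e) (at 0)"
    by (simp add: has_vector_derivative_def)
  then show ?thesis unfolding dir_deriv_def by (rule vector_derivative_at)
qed

lemma complex_hessian_twice_diff:
  fixes q :: "complex ^ 'n \<Rightarrow> real" and z
  assumes q: "twice_diff q q1 q2"
  defines "B \<equiv> \<lambda>h k. complex_of_real (bilinear (q2 z) h k)"
  shows "complex_hessian q z $ a $ b =
     (B (axis a 1) (axis b 1) + B (axis a \<i>) (axis b \<i>) + \<i> * (B (axis a 1) (axis b \<i>) - B (axis a \<i>) (axis b 1))) / 4"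
proof -
  have dq: "((\<lambda>w. complex_of_real (q w)) has_derivative (\<lambda>h. complex_of_real (blinfun_apply (q1 w) h))) (at w)" for w
    by (rule has_derivative_of_real[OF twice_diffD(1)[OF q]])
  have 1: "d_dzbar b (\<lambda>w. complex_of_real (q w)) = (\<lambda>w. (complex_of_real (blinfun_apply (q1 w) (axis b 1)) + \<i> * complex_of_real (blinfun_apply (q1 w) (axis b \<i>))) / 2)"
    by (simp add: fun_eq_iff d_dzbar_def dir_deriv_eq[OF dq])
  have d: "((\<lambda>w. complex_of_real (blinfun_apply (q1 w) k)) has_derivative (\<lambda>h. complex_of_real (bilinear (q2 z) h k))) (at z)" for k
    by (intro has_derivative_of_real bounded_linear.has_derivative[OF blinfun.bounded_linear_left] twice_diffD(2)[OF q])
  have d2: "((\<lambda>w. (complex_of_real (blinfun_apply (q1 w) (axis b 1)) + \<i> * complex_of_real (blinfun_apply (q1 w) (axis b \<i>))) / 2) has_derivative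
      (\<lambda>h. (B h (axis b 1) + \<i> * B h (axis b \<i>)) / 2)) (at z)"
    unfolding B_def by (intro bounded_linear.has_derivative[OF bounded_linear_divide] has_derivative_add d has_derivative_mult_right)
  then show ?thesis
    by (simp add: complex_hessian_def 1 d_dz_def dir_deriv_eq[OF d2] field_simps)
qed

lemma complex_hessian_hermitian:
  assumes q: "twice_diff q q1 q2"
    and sym: "\<And>h k. bilinear (q2 z) h k = bilinear (q2 z) k h"
  shows "hermitian_matrix (complex_hessian q z)"
  unfolding hermitian_matrix_def
proof (intro allI)
  fix i j
  show "complex_hessian q z $ i $ j = cnj (complex_hessian q z $ j $ i)"
    unfolding complex_hessian_twice_diff[OF q]
    by (simp add: sym[of "axis j 1"] sym[of "axis j \<i>"] algebra_simps)
qed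

lemma vec_complex_expansion:
  fixes \<xi> :: "complex ^ 'n"
  shows "\<xi> = (\<Sum>a\<in>UNIV. Re (\<xi> $ a) *\<^sub>R axis a 1 + Im (\<xi> $ a) *\<^sub>R axis a \<i>)"
proof -
  have "(\<Sum>a\<in>UNIV. Re (\<xi> $ a) *\<^sub>R axis a 1 + Im (\<xi> $ a) *\<^sub>R axis a \<i>) $ p = \<xi> $ p" for p
  proof -
    have "(\<Sum>a\<in>UNIV. Re (\<xi> $ a) *\<^sub>R axis a 1 + Im (\<xi> $ a) *\<^sub>R axis a \<i>) $ p
        = (\<Sum>a\<in>UNIV. if a = p then \<xi> $ a else 0)"
      unfolding sum_component by (rule sum.cong) (auto simp: axis_def complex_eq_iff)
    then show ?thesis by simp
  qed
  then show ?thesis by (simp add: vec_eq_iff)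
qed

text \<open>
  Along a complex line the complex Hessian is a quarter of the Laplacian. Both sides are expanded in the
  real basis that consists of the coordinate vectors and their multiples by \<open>\<i>\<close>.
\<close>

lemma levi_form:
  fixes q :: "complex ^ 'n \<Rightarrow> real"
  assumes q: "twice_diff q q1 q2"
  shows "Re (\<Sum>a\<in>UNIV. \<Sum>b\<in>UNIV. \<xi> $ a * cnj (\<xi> $ b) * complex_hessian q z $ a $ b) =
     (bilinear (q2 z) \<xi> \<xi> + bilinear (q2 z) (\<i> *s \<xi>) (\<i> *s \<xi>)) / 4"
proof -
  define B where "B h k = bilinear (q2 z) h k" for h k
  define T where "T \<xi> a b = Re (\<xi> $ a) * Re (\<xi> $ b) * B (axis a 1) (axis b 1) + Re (\<xi> $ a) * Im (\<xi> $ b) * B (axis a 1) (axis b \<i>)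
     + Im (\<xi> $ a) * Re (\<xi> $ b) * B (axis a \<i>) (axis b 1) + Im (\<xi> $ a) * Im (\<xi> $ b) * B (axis a \<i>) (axis b \<i>)" for \<xi> :: "complex ^ 'n" and a b
  have expand: "B \<xi> \<xi> = (\<Sum>a\<in>UNIV. \<Sum>b\<in>UNIV. T \<xi> a b)" for \<xi> :: "complex ^ 'n"
  proof -
    have left: "B \<xi> k = (\<Sum>a\<in>UNIV. Re (\<xi> $ a) * B (axis a 1) k + Im (\<xi> $ a) * B (axis a \<i>) k)" for k
      unfolding B_def
      by (subst vec_complex_expansion[of \<xi>])
         (simp add: blinfun.sum_right blinfun.sum_left blinfun.add_left blinfun.add_right blinfun.scaleR_left blinfun.scaleR_right)
    have right: "B k \<xi> = (\<Sum>b\<in>UNIV. Re (\<xi> $ b) * B k (axis b 1) + Im (\<xi> $ b) * B k (axis b \<i>))" for k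
      unfolding B_def
      by (subst vec_complex_expansion[of \<xi>])
         (simp add: blinfun.sum_right blinfun.add_right blinfun.scaleR_right)
    have "B \<xi> \<xi> = (\<Sum>a\<in>UNIV. Re (\<xi> $ a) * (\<Sum>b\<in>UNIV. Re (\<xi> $ b) * B (axis a 1) (axis b 1) + Im (\<xi> $ b) * B (axis a 1) (axis b \<i>))
        + Im (\<xi> $ a) * (\<Sum>b\<in>UNIV. Re (\<xi> $ b) * B (axis a \<i>) (axis b 1) + Im (\<xi> $ b) * B (axis a \<i>) (axis b \<i>)))"
      unfolding left[of \<xi>] by (simp only: right)
    also have "\<dots> = (\<Sum>a\<in>UNIV. \<Sum>b\<in>UNIV. T \<xi> a b)"
      unfolding T_def sum_distrib_left sum.distrib[symmetric] by (simp add: algebra_simps)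
    finally show ?thesis .
  qed
  have e: "Re (\<xi> $ a * cnj (\<xi> $ b) * complex_hessian q z $ a $ b) = (T \<xi> a b + T (\<i> *s \<xi>) a b) / 4" for a b
    unfolding complex_hessian_twice_diff[OF q] T_def B_def by (simp add: field_simps)
  show ?thesis
    unfolding B_def[symmetric] expand by (simp only: Re_sum e sum.distrib add_divide_distrib sum_divide_distrib)
qed

text \<open>
  For nonnegative weights \<open>a\<close>, these vectors turn the linear functional \<open>H \<mapsto> \<Sum>k. a $ k * (V* H V) $ k $ k\<close>
  of the complex Hessian into a sum of pure second derivatives: each column of \<open>V\<close> contributes the two real
  directions that span its (conjugated) complex line.
\<close>

definition levi_directions :: "complex ^ 'n ^ 'n \<Rightarrow> real ^ 'n \<Rightarrow> 'n \<times> bool \<Rightarrow> complex ^ 'n" where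
  "levi_directions V a = (\<lambda>(k, c). (sqrt (a $ k) / 2) *\<^sub>R ((if c then \<i> else 1) *s (\<chi> p. cnj (V $ p $ k))))"

lemma weighted_diagonal_hessian:
  fixes q :: "complex ^ 'n \<Rightarrow> real"
  assumes q: "twice_diff q q1 q2" and a: "\<And>k. 0 \<le> a $ k"
  shows "a \<bullet> real_diagonal (unitary_conj V (complex_hessian q z)) =
     second_order UNIV (levi_directions V a) (q2 z)"
proof -
  define \<xi> where "\<xi> k = (\<chi> p. cnj (V $ p $ k))" for k
  define B where "B h = bilinear (q2 z) h h" for h
  have Bs: "B (t *\<^sub>R h) = t\<^sup>2 * B h" for t h
    by (simp add: B_def blinfun.scaleR_right blinfun.scaleR_left power2_eq_square)
  have d: "real_diagonal (unitary_conj V (complex_hessian q z)) $ k = (B (\<xi> k) + B (\<i> *s \<xi> k)) / 4" for k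
  proof -
    have "unitary_conj V (complex_hessian q z) $ k $ k = (\<Sum>p\<in>UNIV. \<Sum>r\<in>UNIV. \<xi> k $ p * cnj (\<xi> k $ r) * complex_hessian q z $ p $ r)"
      by (simp add: unitary_conj_nth hprod_def column_def \<xi>_def matrix_vector_mult_def sum_distrib_left mult_ac)
    then show ?thesis using levi_form[OF q, of "\<xi> k" z] by (simp add: real_diagonal_def B_def)
  qed
  have "(\<Sum>i\<in>UNIV. B (levi_directions V a i)) = (\<Sum>k\<in>UNIV. \<Sum>c\<in>UNIV. B (levi_directions V a (k, c)))"
    by (simp add: sum.cartesian_product UNIV_Times_UNIV[symmetric] del: UNIV_Times_UNIV)
  also have "\<dots> = (\<Sum>k\<in>UNIV. a $ k * ((B (\<xi> k) + B (\<i> *s \<xi> k)) / 4))"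
    using a by (simp add: levi_directions_def Bs UNIV_bool \<xi>_def[symmetric] power_divide algebra_simps add_divide_distrib)
  finally show ?thesis by (simp add: inner_vec_def d B_def)
qed

section \<open>Superlevel sets of the operator\<close>

lemma positive_in_admissible_cone:
  fixes x :: "real ^ 'n"
  assumes \<Gamma>: "admissible_cone \<Gamma>" and x: "\<And>i. 0 < x $ i"
  shows "x \<in> \<Gamma>"
proof -
  have "0 < elem_sym j x" if j: "j \<in> {1..CARD('n)}" for j
  proof -
    obtain S :: "'n set" where "card S = j"
      using obtain_subset_with_card_n[of j "UNIV :: 'n set"] j by auto
    then show ?thesis unfolding elem_sym_def
      by (intro sum_pos prod_pos) (auto simp: x)
  qed
  then have "x \<in> Garding_cone CARD('n)" by (simp add: Garding_cone_def)
  then show ?thesis using \<Gamma> unfolding admissible_cone_def by blast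
qed

text \<open>
  The midpoint of a point of the closure and an interior point is interior; scale it by 2.
\<close>

lemma closure_plus_cone:
  assumes \<Gamma>: "admissible_cone \<Gamma>" and x: "x \<in> closure \<Gamma>" and y: "y \<in> \<Gamma>"
  shows "x + y \<in> \<Gamma>"
proof -
  have "open \<Gamma>" "convex \<Gamma>" using \<Gamma> by (auto simp: admissible_cone_def)
  then have "x - (1/2) *\<^sub>R (x - y) \<in> interior \<Gamma>"
    using x y by (intro mem_interior_closure_convex_shrink) (auto simp: interior_open)
  then have "x - (1/2) *\<^sub>R (x - y) \<in> \<Gamma>" using interior_subset by blast
  then have "2 *\<^sub>R (x - (1/2) *\<^sub>R (x - y)) \<in> \<Gamma>" using \<Gamma> unfolding admissible_cone_def by (metis zero_less_numeral)
  moreover have "2 *\<^sub>R (x - (1/2) *\<^sub>R (x - y)) = x + y" by (simp add: scaleR_diff_right scaleR_2)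
  ultimately show ?thesis by simp
qed

lemma nonneg_in_closure:
  fixes x :: "real ^ 'n"
  assumes \<Gamma>: "admissible_cone \<Gamma>" and x: "\<And>i. 0 \<le> x $ i"
  shows "x \<in> closure \<Gamma>"
proof -
  have "((\<lambda>t::real. x + (\<chi> i. t)) \<longlongrightarrow> x + (\<chi> i. 0)) (at_right 0)"
    by (intro tendsto_add tendsto_const vec_tendstoI) (simp add: tendsto_ident_at)
  then have "((\<lambda>t::real. x + (\<chi> i. t)) \<longlongrightarrow> x) (at_right 0)"
    by (simp add: zero_vec_def[symmetric])
  moreover have "\<forall>\<^sub>F t in at_right (0::real). x + (\<chi> i. t) \<in> closure \<Gamma>"
    using eventually_at_right_less[of "0::real"]
  proof eventually_elim
    case (elim t)
    have "x + (\<chi> i. t) \<in> \<Gamma>"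
      by (rule positive_in_admissible_cone[OF \<Gamma>]) (simp add: x elim add_nonneg_pos)
    then show ?case using closure_subset by blast
  qed
  ultimately show ?thesis
    by (rule Lim_in_closed_set[OF closed_closure, rotated 2]) simp
qed

lemma permute_coords_tendsto [tendsto_intros]:
  "(g \<longlongrightarrow> x) F \<Longrightarrow> ((\<lambda>y. permute_coords p (g y)) \<longlongrightarrow> permute_coords p x) F"
  unfolding permute_coords_def by (intro vec_tendstoI) (simp add: tendsto_vec_nth)

lemma symmetric_closure:
  assumes "symmetric_set \<Gamma>"
  shows "symmetric_set (closure \<Gamma>)"
  unfolding symmetric_set_def
proof (intro allI impI ballI)
  fix p :: "'a \<Rightarrow> 'a" and x assume p: "bij p" and "x \<in> closure \<Gamma>"
  then obtain X where "\<And>n. X n \<in> \<Gamma>" "X \<longlonglongrightarrow> x" unfolding closure_sequential by blast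
  then have "\<And>n. permute_coords p (X n) \<in> \<Gamma>" "(\<lambda>n. permute_coords p (X n)) \<longlonglongrightarrow> permute_coords p x"
    using assms p by (auto simp: symmetric_set_def intro: tendsto_intros)
  then show "permute_coords p x \<in> closure \<Gamma>" unfolding closure_sequential by (intro exI[of _ "\<lambda>n. permute_coords p (X n)"]) simp
qed

definition superlevel :: "(real ^ 'n) set \<Rightarrow> (real ^ 'n \<Rightarrow> real) \<Rightarrow> real \<Rightarrow> (real ^ 'n) set" where
  "superlevel \<Gamma> f s = {x \<in> closure \<Gamma>. s \<le> f x}"

lemma superlevel_closed_convex_symmetric:
  assumes \<Gamma>: "admissible_cone \<Gamma>" and f: "admissible_function \<Gamma> f"
  shows "closed (superlevel \<Gamma> f s)" "convex (superlevel \<Gamma> f s)" "symmetric_set (superlevel \<Gamma> f s)"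
proof -
  have cont: "continuous_on (closure \<Gamma>) f" and conc: "concave_on (closure \<Gamma>) f"
    using f by (auto simp: admissible_function_def)
  have "superlevel \<Gamma> f s = closure \<Gamma> \<inter> f -` {s..}" by (auto simp: superlevel_def)
  then show "closed (superlevel \<Gamma> f s)"
    using continuous_closed_preimage[OF cont closed_closure, of "{s..}"] by simp
  show "convex (superlevel \<Gamma> f s)"
    unfolding superlevel_def
  proof (rule convexI)
    fix x y and t t' :: real
    assume xy: "x \<in> {x \<in> closure \<Gamma>. s \<le> f x}" "y \<in> {x \<in> closure \<Gamma>. s \<le> f x}" and t: "0 \<le> t" "0 \<le> t'" "t + t' = 1"
    have "t *\<^sub>R x + t' *\<^sub>R y \<in> closure \<Gamma>"
      using convex_closure[of \<Gamma>] \<Gamma> xy t by (auto simp: admissible_cone_def convex_def)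
    moreover have "t * f x + t' * f y \<le> f (t *\<^sub>R x + t' *\<^sub>R y)"
      using conc xy t unfolding concave_on_iff by blast
    moreover have "s \<le> t * f x + t' * f y"
    proof -
      have "t * s + t' * s \<le> t * f x + t' * f y" using xy t by (intro add_mono mult_left_mono) auto
      then show ?thesis using t by (simp add: distrib_right[symmetric])
    qed
    ultimately show "t *\<^sub>R x + t' *\<^sub>R y \<in> {x \<in> closure \<Gamma>. s \<le> f x}" by auto
  qed
  have "symmetric_set \<Gamma>" using \<Gamma> by (simp add: admissible_cone_def symmetric_set_def)
  from symmetric_closure[OF this] show "symmetric_set (superlevel \<Gamma> f s)"
    using f by (simp add: superlevel_def symmetric_set_def admissible_function_def)
qed

text \<open>
  In the interior this is monotonicity of \<open>f\<close>; on the frontier \<open>f\<close> vanishes, so there \<open>s \<le> 0\<close> and it suffices to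
  stay in the closure.
\<close>

lemma superlevel_upward:
  assumes \<Gamma>: "admissible_cone \<Gamma>" and f: "admissible_function \<Gamma> f"
    and x: "x \<in> superlevel \<Gamma> f s" and t: "0 < t"
  shows "x + t *\<^sub>R axis i 1 \<in> superlevel \<Gamma> f s"
proof (cases "x \<in> \<Gamma>")
  case True
  have "t *\<^sub>R axis i 1 \<in> closure \<Gamma>"
    by (rule nonneg_in_closure[OF \<Gamma>]) (use t in \<open>simp add: axis_def\<close>)
  from closure_plus_cone[OF \<Gamma> this True] have "x + t *\<^sub>R axis i 1 \<in> \<Gamma>" by (simp add: add.commute)
  moreover from this have "f x < f (x + t *\<^sub>R axis i 1)"
    using f True t unfolding admissible_function_def by blast
  ultimately show ?thesis using x closure_subset by (fastforce simp: superlevel_def)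
next
  case False
  have xc: "x \<in> closure \<Gamma>" using x by (simp add: superlevel_def)
  then have "x \<in> frontier \<Gamma>"
    using False \<Gamma> by (simp add: frontier_def interior_open admissible_cone_def)
  then have "f x = 0" using f by (simp add: admissible_function_def)
  then have "s \<le> 0" using x by (simp add: superlevel_def)
  have "x + t *\<^sub>R axis i 1 \<in> closure \<Gamma>"
  proof -
    obtain X where X: "\<And>n. X n \<in> \<Gamma>" "X \<longlonglongrightarrow> x" using xc unfolding closure_sequential by blast
    have "t *\<^sub>R axis i 1 \<in> closure \<Gamma>"
      by (rule nonneg_in_closure[OF \<Gamma>]) (use t in \<open>simp add: axis_def\<close>)
    then have "X n + t *\<^sub>R axis i 1 \<in> \<Gamma>" for n
      using closure_plus_cone[OF \<Gamma> _ X(1)] by (metis add.commute)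
    moreover have "(\<lambda>n. X n + t *\<^sub>R axis i 1) \<longlonglongrightarrow> x + t *\<^sub>R axis i 1" by (intro tendsto_intros X)
    ultimately show ?thesis unfolding closure_sequential by (intro exI[of _ "\<lambda>n. X n + t *\<^sub>R axis i 1"]) simp
  qed
  moreover from this have "0 \<le> f (x + t *\<^sub>R axis i 1)" using f by (simp add: admissible_function_def)
  ultimately show ?thesis using \<open>s \<le> 0\<close> by (simp add: superlevel_def)
qed

lemma spectral_theorem:
  fixes H :: "complex ^ 'n ^ 'n"
  assumes "hermitian_matrix H"
  obtains U d where "unitary_matrix U" "unitary_conj U H = diagonal_matrix d"
  using spectral_theorem_minimizing[OF assms] exists_injective_weight by blast

lemma unitary_conj_shift:
  assumes U: "unitary_matrix U" "unitary_conj U H = diagonal_matrix d"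
  shows "unitary_conj U (c *\<^sub>R H + mat (complex_of_real t)) = diagonal_matrix (c *\<^sub>R d + (\<chi> i. t))"
proof -
  have uu: "(\<Sum>p\<in>UNIV. cnj (U $ p $ k) * U $ p $ l) = (if k = l then 1 else 0)" for k l
    using U(1) by (simp add: unitary_iff_columns hprod_def column_def)
  have "unitary_conj U (c *\<^sub>R H + mat (complex_of_real t)) $ k $ l = complex_of_real c * unitary_conj U H $ k $ l + complex_of_real t * (\<Sum>p\<in>UNIV. cnj (U $ p $ k) * U $ p $ l)" for k l
  proof -
    have "(c *\<^sub>R H + mat (complex_of_real t)) *v y = complex_of_real c *s (H *v y) + complex_of_real t *s y" for y
    proof -
      have "((c *\<^sub>R H + mat (complex_of_real t)) *v y) $ i = (\<Sum>j\<in>UNIV. complex_of_real c * (H $ i $ j * y $ j) + (if i = j then complex_of_real t * y $ j else 0))" for i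
        unfolding matrix_vector_mult_def vec_lambda_beta
        by (rule sum.cong) (auto simp: mat_def scaleR_conv_of_real[where 'a=complex] algebra_simps)
      then show ?thesis
        by (simp add: vec_eq_iff sum.distrib) (simp add: matrix_vector_mult_def sum_distrib_left)
    qed
    then show ?thesis
      by (simp add: unitary_conj_nth hprod_add_right hprod_scale_right) (simp add: hprod_def column_def)
  qed
  then show ?thesis
    by (simp add: U(2) uu vec_eq_iff diagonal_matrix_def)
qed

lemma hermitian_shift: "hermitian_matrix H \<Longrightarrow> hermitian_matrix (c *\<^sub>R H + mat (complex_of_real t))"
  unfolding hermitian_iff_adjoint by (auto simp: adjoint_matrix_def mat_def vec_eq_iff complex_eq_iff)

lemma closed_hermitian: "closed {H :: complex ^ 'n ^ 'n. hermitian_matrix H}"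
  unfolding hermitian_matrix_def
  by (simp add: Collect_all_eq) (intro closed_INT ballI closed_Collect_eq continuous_intros)

lemma tendsto_mat:
  fixes c :: "'b \<Rightarrow> complex"
  assumes "(c \<longlongrightarrow> l) F"
  shows "((\<lambda>n. mat (c n) :: complex ^ 'n ^ 'n) \<longlongrightarrow> mat l) F"
proof (intro vec_tendstoI)
  fix i j :: 'n
  show "((\<lambda>n. mat (c n) $ i $ j) \<longlongrightarrow> mat l $ i $ j) F"
    using assms by (cases "i = j") (simp_all add: mat_def)
qed

text \<open>
  Limits of matrices with eigenvalues in \<open>\<Gamma>\<close> keep them in the closure: in an eigenbasis of the limit the
  diagonals of the approximating matrices lie in the closure by \<open>schur_diagonal_in\<close> and converge to the
  eigenvalues of the limit. Conversely, adding a small multiple of the identity moves the eigenvalues from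
  the closure into \<open>\<Gamma>\<close>.
\<close>

lemma closure_cone_matrices:
  assumes \<Gamma>: "admissible_cone \<Gamma>"
  shows "H \<in> closure (cone_matrices \<Gamma>) \<longleftrightarrow> hermitian_matrix H \<and> eigenvalue_tuple H \<in> closure \<Gamma>"
proof
  have sym: "symmetric_set \<Gamma>" and conv: "convex \<Gamma>"
    using \<Gamma> by (auto simp: admissible_cone_def symmetric_set_def)
  note symc = symmetric_closure[OF sym]
  {
    assume "H \<in> closure (cone_matrices \<Gamma>)"
    then obtain X where X: "\<And>n. X n \<in> cone_matrices \<Gamma>" "X \<longlonglongrightarrow> H" unfolding closure_sequential by blast
    have herm: "hermitian_matrix H"
      using Lim_in_closed_set[OF closed_hermitian _ _ X(2)] X(1) by (simp add: cone_matrices_def)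
    obtain U d where U: "unitary_matrix U" "unitary_conj U H = diagonal_matrix d"
      using spectral_theorem[OF herm] .
    have "real_diagonal (unitary_conj U (X n)) \<in> closure \<Gamma>" for n
      using X(1)[of n] closure_subset[of \<Gamma>]
      by (intro schur_diagonal_in convex_closure conv symc U(1)) (auto simp: cone_matrices_def)
    moreover have "(\<lambda>n. real_diagonal (unitary_conj U (X n))) \<longlonglongrightarrow> real_diagonal (unitary_conj U H)"
      unfolding real_diagonal_def unitary_conj_def matrix_matrix_mult_def
      by (intro vec_tendstoI) (auto intro!: tendsto_intros X(2))
    ultimately have "d \<in> closure \<Gamma>"
      unfolding U(2) real_diagonal_diagonal_matrix
      by (intro Lim_in_closed_set[OF closed_closure, of "\<lambda>n. real_diagonal (unitary_conj U (X n))"]) auto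
    then show "hermitian_matrix H \<and> eigenvalue_tuple H \<in> closure \<Gamma>"
      using herm eigenvalue_tuple_in_symmetric_iff[OF symc U] by simp
  }
  assume *: "hermitian_matrix H \<and> eigenvalue_tuple H \<in> closure \<Gamma>"
  then obtain U d where U: "unitary_matrix U" "unitary_conj U H = diagonal_matrix d"
    using spectral_theorem by blast
  have d: "d \<in> closure \<Gamma>" using * eigenvalue_tuple_in_symmetric_iff[OF symc U] by simp
  define X where "X n = 1 *\<^sub>R H + mat (complex_of_real (1 / real (Suc n)))" for n
  have "X n \<in> cone_matrices \<Gamma>" for n
  proof -
    have "(\<chi> i. 1 / real (Suc n)) \<in> \<Gamma>" by (rule positive_in_admissible_cone[OF \<Gamma>]) simp
    from closure_plus_cone[OF \<Gamma> d this] have "1 *\<^sub>R d + (\<chi> i. 1 / real (Suc n)) \<in> \<Gamma>" by simp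
    then have "eigenvalue_tuple (X n) \<in> \<Gamma>"
      using eigenvalue_tuple_in_symmetric_iff[OF sym U(1) unitary_conj_shift[OF U]] unfolding X_def by blast
    moreover have "hermitian_matrix (X n)" unfolding X_def using * by (blast intro: hermitian_shift)
    ultimately show ?thesis by (simp add: cone_matrices_def)
  qed
  moreover have "X \<longlonglongrightarrow> H"
  proof -
    have "(\<lambda>n. complex_of_real (1 / real (Suc n))) \<longlonglongrightarrow> complex_of_real 0"
      by (intro tendsto_of_real lim_1_over_n[THEN LIMSEQ_Suc])
    then have "(\<lambda>n. mat (complex_of_real (1 / real (Suc n))) :: complex ^ 'a ^ 'a) \<longlonglongrightarrow> mat (complex_of_real 0)"
      by (rule tendsto_mat)
    then have "(\<lambda>n. 1 *\<^sub>R H + mat (complex_of_real (1 / real (Suc n)))) \<longlonglongrightarrow> 1 *\<^sub>R H + mat (complex_of_real 0)"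
      by (intro tendsto_intros)
    moreover have "mat 0 = (0 :: complex ^ 'a ^ 'a)" by (simp add: mat_def vec_eq_iff)
    ultimately show ?thesis unfolding X_def by simp
  qed
  ultimately show "H \<in> closure (cone_matrices \<Gamma>)" unfolding closure_sequential by blast
qed

text \<open>
  This absorbs the value \<open>-\<infinity>\<close> of the operator: the superlevel sets only see finite values.
\<close>

lemma hessian_operator_ge_iff:
  assumes \<Gamma>: "admissible_cone \<Gamma>"
  shows "ereal s \<le> hessian_operator \<Gamma> f H \<longleftrightarrow> hermitian_matrix H \<and> eigenvalue_tuple H \<in> superlevel \<Gamma> f s"
  using closure_cone_matrices[OF \<Gamma>, of H] by (auto simp: hessian_operator_def superlevel_def)

text \<open>
  The identity matrix commutes with \<open>H\<close>, so concavity of \<open>f\<close> along the segment of eigenvalue tuples is enough.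
\<close>

lemma hessian_operator_strictify:
  assumes \<Gamma>: "admissible_cone \<Gamma>" and f: "admissible_function \<Gamma> f"
    and H: "ereal s \<le> hessian_operator \<Gamma> f H" and \<tau>: "0 \<le> \<tau>" "\<tau> \<le> 1" and R: "0 < R"
  shows "ereal ((1 - \<tau>) * s + \<tau> * f (\<chi> i. R)) \<le> hessian_operator \<Gamma> f ((1 - \<tau>) *\<^sub>R H + mat (complex_of_real (\<tau> * R)))"
proof -
  have herm: "hermitian_matrix H" and e: "eigenvalue_tuple H \<in> superlevel \<Gamma> f s"
    using H hessian_operator_ge_iff[OF \<Gamma>] by auto
  obtain U d where U: "unitary_matrix U" "unitary_conj U H = diagonal_matrix d"
    using spectral_theorem[OF herm] .
  have d: "d \<in> superlevel \<Gamma> f s"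
    using e eigenvalue_tuple_in_symmetric_iff[OF superlevel_closed_convex_symmetric(3)[OF \<Gamma> f] U] by simp
  have R1: "(\<chi> i. R) \<in> closure \<Gamma>"
    using positive_in_admissible_cone[OF \<Gamma>, of "\<chi> i. R"] R closure_subset by auto
  have eq: "(\<chi> i. \<tau> * R) = \<tau> *\<^sub>R (\<chi> i. R)" by (simp add: vec_eq_iff)
  have "convex (closure \<Gamma>)" using \<Gamma> convex_closure by (auto simp: admissible_cone_def)
  then have 1: "(1 - \<tau>) *\<^sub>R d + \<tau> *\<^sub>R (\<chi> i. R) \<in> closure \<Gamma>"
    using d R1 \<tau> unfolding convex_def superlevel_def by auto
  have "concave_on (closure \<Gamma>) f" using f by (simp add: admissible_function_def)
  then have "(1 - \<tau>) * f d + \<tau> * f (\<chi> i. R) \<le> f ((1 - \<tau>) *\<^sub>R d + \<tau> *\<^sub>R (\<chi> i. R))"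
    unfolding concave_on_iff using d R1 \<tau> by (auto simp: superlevel_def)
  moreover have "(1 - \<tau>) * s \<le> (1 - \<tau>) * f d" using d \<tau> by (intro mult_left_mono) (auto simp: superlevel_def)
  ultimately have "(1 - \<tau>) *\<^sub>R d + (\<chi> i. \<tau> * R) \<in> superlevel \<Gamma> f ((1 - \<tau>) * s + \<tau> * f (\<chi> i. R))"
    using 1 by (simp add: superlevel_def eq)
  then have "eigenvalue_tuple ((1 - \<tau>) *\<^sub>R H + mat (complex_of_real (\<tau> * R))) \<in> superlevel \<Gamma> f ((1 - \<tau>) * s + \<tau> * f (\<chi> i. R))"
    using eigenvalue_tuple_in_symmetric_iff[OF superlevel_closed_convex_symmetric(3)[OF \<Gamma> f] U(1) unitary_conj_shift[OF U]] by blast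
  then show ?thesis using hessian_operator_ge_iff[OF \<Gamma>] hermitian_shift[OF herm] by blast
qed

text \<open>
  Separate the eigenvalues of \<open>H0\<close> from the convex set of admissible eigenvalue tuples, and read the
  separating vector \<open>a\<close> as a functional of matrices in the eigenbasis \<open>V\<close> of \<open>H0\<close>; by \<open>schur_diagonal_in\<close>
  it is bounded below on the whole superlevel set. The weights are nonnegative because the set of tuples
  is closed under increasing a coordinate.
\<close>

lemma hessian_operator_separation:
  fixes H0 :: "complex ^ 'n ^ 'n"
  assumes \<Gamma>: "admissible_cone \<Gamma>" and f: "admissible_function \<Gamma> f"
    and herm: "hermitian_matrix H0" and low: "\<not> ereal s \<le> hessian_operator \<Gamma> f H0"
  shows "\<exists>V a b. (\<forall>k. 0 \<le> a $ k) \<and> a \<bullet> real_diagonal (unitary_conj V H0) < b \<and>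
     (\<forall>K. ereal s \<le> hessian_operator \<Gamma> f K \<longrightarrow> b \<le> a \<bullet> real_diagonal (unitary_conj V K))"
proof -
  let ?L = "superlevel \<Gamma> f s"
  note L = superlevel_closed_convex_symmetric[OF \<Gamma> f, of s]
  obtain V d where V: "unitary_matrix V" "unitary_conj V H0 = diagonal_matrix d"
    using spectral_theorem[OF herm] .
  have "d \<notin> ?L"
    using low herm hessian_operator_ge_iff[OF \<Gamma>] eigenvalue_tuple_in_symmetric_iff[OF L(3) V] by blast
  then obtain a b where a: "a \<bullet> d < b" and ab: "\<And>x. x \<in> ?L \<Longrightarrow> b < a \<bullet> x"
    using separating_hyperplane_closed_point[OF L(2,1)] by metis
  show ?thesis
  proof (cases "?L = {}")
    case True
    then show ?thesis
      using hessian_operator_ge_iff[OF \<Gamma>] by (intro exI[of _ V] exI[of _ 0] exI[of _ 1]) auto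
  next
    case False
    then obtain x where x: "x \<in> ?L" by blast
    have "0 \<le> a $ k" for k
    proof (rule ccontr)
      assume "\<not> 0 \<le> a $ k"
      then have neg: "a $ k < 0" by simp
      \<comment> \<open>moving this far along the \<open>k\<close>-th axis would bring the functional down to \<open>b - 1\<close>\<close>
      define t where "t = (a \<bullet> x - b + 1) / (- (a $ k))"
      have t: "0 < t" using neg ab[OF x] by (simp add: t_def divide_pos_neg zero_less_divide_iff)
      have "b < a \<bullet> (x + t *\<^sub>R axis k 1)" by (rule ab[OF superlevel_upward[OF \<Gamma> f x t]])
      also have "\<dots> = a \<bullet> x + t * (a $ k)" by (simp add: inner_add_right inner_axis)
      also have "\<dots> = b - 1" using neg by (simp add: t_def field_simps)
      finally show False by simp
    qed
    moreover have "a \<bullet> real_diagonal (unitary_conj V H0) < b" using a V by simp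
    moreover have "b \<le> a \<bullet> real_diagonal (unitary_conj V K)" if "ereal s \<le> hessian_operator \<Gamma> f K" for K
      using that hessian_operator_ge_iff[OF \<Gamma>] schur_diagonal_in[OF L _ V(1)] ab by (meson less_imp_le)
    ultimately show ?thesis by blast
  qed
qed

section \<open>Semicontinuous functions and sup-convolution\<close>

lemma usc_on_ball:
  fixes S :: "'a::metric_space set"
  assumes "usc_on S u" "x \<in> S" "u x < c"
  shows "\<exists>d>0. \<forall>y\<in>S. dist y x < d \<longrightarrow> u y < c"
proof -
  have "\<forall>\<^sub>F y in at x within S. u y < c" using assms by (simp add: usc_on_def)
  then obtain d where "0 < d" "\<And>y. y \<in> S \<Longrightarrow> y \<noteq> x \<Longrightarrow> dist y x < d \<Longrightarrow> u y < c"
    unfolding eventually_at by blast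
  then show ?thesis using assms(3) by metis
qed

lemma lsc_on_iff_usc_on: "lsc_on S v \<longleftrightarrow> usc_on S (\<lambda>x. - v x)"
proof -
  have "(\<forall>c. c < v x \<longrightarrow> (\<forall>\<^sub>F y in at x within S. c < v y)) \<longleftrightarrow> (\<forall>c. - v x < c \<longrightarrow> (\<forall>\<^sub>F y in at x within S. - v y < c))" for x
  proof safe
    fix c assume *: "\<forall>c. c < v x \<longrightarrow> (\<forall>\<^sub>F y in at x within S. c < v y)" "- v x < c"
    then have "\<forall>\<^sub>F y in at x within S. - c < v y" by simp
    then show "\<forall>\<^sub>F y in at x within S. - v y < c" by (rule eventually_mono) linarith
  next
    fix c assume *: "\<forall>c. - v x < c \<longrightarrow> (\<forall>\<^sub>F y in at x within S. - v y < c)" "c < v x"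
    then have "\<forall>\<^sub>F y in at x within S. - v y < - c" using *(1)[rule_format, of "- c"] by simp
    then show "\<forall>\<^sub>F y in at x within S. c < v y" by (rule eventually_mono) linarith
  qed
  then show ?thesis by (simp add: lsc_on_def usc_on_def)
qed

lemma usc_on_add:
  fixes S :: "'a::topological_space set"
  assumes "usc_on S u" "usc_on S v"
  shows "usc_on S (\<lambda>x. u x + v x)"
  unfolding usc_on_def
proof (intro ballI allI impI)
  fix x c assume x: "x \<in> S" and c: "u x + v x < c"
  define e where "e = (c - u x - v x) / 2"
  have "0 < e" using c by (simp add: e_def)
  then have "\<forall>\<^sub>F y in at x within S. u y < u x + e" "\<forall>\<^sub>F y in at x within S. v y < v x + e"
    using assms x by (auto simp: usc_on_def)
  then show "\<forall>\<^sub>F y in at x within S. u y + v y < c"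
    by eventually_elim (simp add: e_def field_simps)
qed

lemma usc_on_cmult:
  fixes S :: "'a::topological_space set"
  assumes "usc_on S u" "0 < a"
  shows "usc_on S (\<lambda>x. a * u x)"
  unfolding usc_on_def
proof (intro ballI allI impI)
  fix x c assume x: "x \<in> S" and c: "a * u x < c"
  then have "u x < c / a" using assms(2) by (simp add: pos_less_divide_eq mult.commute)
  then have "\<forall>\<^sub>F y in at x within S. u y < c / a" using assms x by (auto simp: usc_on_def)
  then show "\<forall>\<^sub>F y in at x within S. a * u y < c"
    by (rule eventually_mono) (use assms(2) in \<open>simp add: pos_less_divide_eq mult.commute\<close>)
qed

lemma continuous_imp_usc_on: "continuous_on S u \<Longrightarrow> usc_on S u"
  unfolding usc_on_def continuous_on_def by (blast intro: order_tendstoD(2))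

lemma usc_limit:
  fixes S :: "'a::metric_space set"
  assumes u: "usc_on S u" and x: "x \<in> S" and X: "X \<longlonglongrightarrow> x" "\<And>n. X n \<in> S" and c: "u x < c"
  shows "\<forall>\<^sub>F n in sequentially. u (X n) < c"
proof -
  obtain d where d: "0 < d" "\<And>y. y \<in> S \<Longrightarrow> dist y x < d \<Longrightarrow> u y < c"
    using usc_on_ball[OF u x c] by blast
  have "\<forall>\<^sub>F n in sequentially. dist (X n) x < d" using X(1) d(1) by (rule tendstoD)
  then show ?thesis by (rule eventually_mono) (use d(2) X(2) in blast)
qed

text \<open>
  The function \<open>u y - v x\<close> of the pair \<open>(y, x)\<close> is upper semicontinuous; this is its behaviour at a limit on
  the diagonal.
\<close>

lemma usc_difference_limit:
  fixes S :: "'a::metric_space set"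
  assumes u: "usc_on S u" and v: "lsc_on S v" and x: "x \<in> S"
    and Y: "Y \<longlonglongrightarrow> x" "\<And>n. Y n \<in> S" and X: "X \<longlonglongrightarrow> x" "\<And>n. X n \<in> S"
    and c: "\<And>n. c \<le> u (Y n) - v (X n)"
  shows "c \<le> u x - v x"
proof (rule ccontr)
  assume "\<not> c \<le> u x - v x"
  define e where "e = (c - (u x - v x)) / 2"
  have e: "0 < e" using \<open>\<not> c \<le> u x - v x\<close> by (simp add: e_def)
  have "\<forall>\<^sub>F n in sequentially. u (Y n) < u x + e" by (rule usc_limit[OF u x Y]) (use e in simp)
  moreover have "\<forall>\<^sub>F n in sequentially. - v (X n) < - v x + e"
    by (rule usc_limit[OF v[unfolded lsc_on_iff_usc_on] x X]) (use e in simp)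
  ultimately have "\<forall>\<^sub>F n in sequentially. False"
  proof eventually_elim
    case (elim n)
    then have "u (Y n) - v (X n) < u x - v x + 2 * e" by linarith
    also have "\<dots> = c" by (simp add: e_def field_simps)
    finally show ?case using c[of n] by linarith
  qed
  then show False by simp
qed

lemma usc_attains_sup:
  fixes S :: "'a::metric_space set"
  assumes S: "compact S" "S \<noteq> {}" and u: "usc_on S u" and b: "\<And>x. x \<in> S \<Longrightarrow> u x \<le> B"
  shows "\<exists>x\<in>S. \<forall>y\<in>S. u y \<le> u x"
proof -
  define s where "s = Sup (u ` S)"
  have bdd: "bdd_above (u ` S)" using b by (rule bdd_aboveI2)
  have "\<exists>x\<in>S. s - 1 / real (Suc n) < u x" for n
    using less_cSUP_iff[OF S(2) bdd, of "s - 1 / real (Suc n)"] by (simp add: s_def)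
  then obtain X where X: "\<And>n. X n \<in> S" "\<And>n. s - 1 / real (Suc n) < u (X n)" by metis
  obtain x r where x: "x \<in> S" "strict_mono r" "(X \<circ> r) \<longlonglongrightarrow> x"
    using S(1) X(1) unfolding compact_def by metis
  have "s \<le> u x"
  proof (rule ccontr)
    assume "\<not> s \<le> u x"
    define e where "e = (s - u x) / 2"
    have e: "0 < e" using \<open>\<not> s \<le> u x\<close> by (simp add: e_def)
    have "\<forall>\<^sub>F n in sequentially. u ((X \<circ> r) n) < u x + e"
      by (rule usc_limit[OF u x(1) x(3)]) (use X e in auto)
    moreover have "\<forall>\<^sub>F n in sequentially. 1 / real (Suc n) < e"
      using order_tendstoD(2)[OF LIMSEQ_inverse_real_of_nat e] by (simp add: inverse_eq_divide)
    ultimately have "\<forall>\<^sub>F n in sequentially. False"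
    proof eventually_elim
      case (elim n)
      have "1 / real (Suc (r n)) \<le> 1 / real (Suc n)"
        using seq_suble[OF x(2), of n] by (intro divide_left_mono) auto
      then have "s - e < u (X (r n))" using X(2)[of "r n"] elim by linarith
      moreover have "u x + e = s - e" by (simp add: e_def field_simps)
      ultimately show ?case using elim by simp
    qed
    then show False by simp
  qed
  moreover have "u y \<le> s" if "y \<in> S" for y unfolding s_def by (rule cSUP_upper[OF that bdd])
  ultimately show ?thesis using x(1) by (meson order_trans)
qed

text \<open>
  The function is \<open>sup y. U y - L |x - y|\<close>, cut off from below at \<open>- C\<close> to make it bounded on the whole
  space. On \<open>W\<close> the cut-off is invisible, since the supremum is at least \<open>U x\<close> there.
\<close>

lemma sup_convolution_exists:
  fixes W :: "'a::metric_space set"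
  assumes W: "compact W" "W \<noteq> {}" and U: "usc_on W U" and C: "\<And>y. y \<in> W \<Longrightarrow> \<bar>U y\<bar> \<le> C" and L: "0 < L"
  shows "\<exists>w. (\<forall>x y. \<bar>w x - w y\<bar> \<le> L * dist x y) \<and> (\<forall>x. \<bar>w x\<bar> \<le> C) \<and>
     (\<forall>x y. y \<in> W \<longrightarrow> U y - L * dist x y \<le> w x) \<and> (\<forall>x\<in>W. \<exists>y\<in>W. w x = U y - L * dist x y)"
proof -
  have "\<exists>y\<in>W. \<forall>z\<in>W. U z - L * dist x z \<le> U y - L * dist x y" for x
  proof (rule usc_attains_sup[OF W, where B=C])
    have "usc_on W (\<lambda>y. U y + - (L * dist x y))"
      by (intro usc_on_add U continuous_imp_usc_on continuous_intros)
    then show "usc_on W (\<lambda>y. U y - L * dist x y)" by simp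
    show "U y - L * dist x y \<le> C" if "y \<in> W" for y
    proof -
      have "0 \<le> L * dist x y" using L by simp
      then show ?thesis using C[OF that] by linarith
    qed
  qed
  then obtain Y where Y: "\<And>x. Y x \<in> W" "\<And>x z. z \<in> W \<Longrightarrow> U z - L * dist x z \<le> U (Y x) - L * dist x (Y x)"
    by metis
  define w0 where "w0 x = U (Y x) - L * dist x (Y x)" for x
  define w where "w x = max (- C) (w0 x)" for x
  have lip: "w0 x \<le> w0 y + L * dist x y" for x y
  proof -
    have "L * dist y (Y x) \<le> L * (dist x y + dist x (Y x))"
      using L dist_triangle3[of y "Y x" x] by (intro mult_left_mono) (auto simp: dist_commute)
    then have "w0 x \<le> U (Y x) - L * dist y (Y x) + L * dist x y"
      by (simp add: w0_def distrib_left)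
    also have "U (Y x) - L * dist y (Y x) \<le> w0 y" unfolding w0_def by (rule Y(2)[OF Y(1)])
    finally show ?thesis by simp
  qed
  have "\<bar>w x - w y\<bar> \<le> L * dist x y" for x y
  proof -
    have "0 \<le> L * dist x y" using L by simp
    moreover have "w0 y \<le> w0 x + L * dist x y" using lip[of y x] by (simp add: dist_commute)
    ultimately show ?thesis using lip[of x y] unfolding w_def by linarith
  qed
  moreover have "\<bar>w x\<bar> \<le> C" for x
  proof -
    have "0 \<le> L * dist x (Y x)" using L by simp
    moreover have "0 \<le> C" using C[OF Y(1)] by (meson abs_ge_zero order_trans)
    ultimately show ?thesis using C[OF Y(1)[of x]] unfolding w_def w0_def by linarith
  qed
  moreover have "U y - L * dist x y \<le> w x" if "y \<in> W" for x y
    using Y(2)[OF that, of x] unfolding w_def w0_def by linarith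
  moreover have "\<exists>y\<in>W. w x = U y - L * dist x y" if "x \<in> W" for x
  proof -
    have "- C \<le> w0 x" using Y(2)[OF that, of x] C[OF that] by (simp add: w0_def)
    then have "w x = w0 x" by (simp add: w_def)
    then show ?thesis using Y(1) unfolding w0_def by blast
  qed
  ultimately show ?thesis by blast
qed

section \<open>Values of the symmetric function on the diagonal\<close>

lemma superlevel_add_nonneg:
  assumes \<Gamma>: "admissible_cone \<Gamma>" and f: "admissible_function \<Gamma> f"
    and x: "x \<in> superlevel \<Gamma> f s" and y: "\<And>i. 0 \<le> y $ i"
  shows "x + y \<in> superlevel \<Gamma> f s"
proof -
  have "x + (\<Sum>i\<in>S. (y $ i) *\<^sub>R axis i 1) \<in> superlevel \<Gamma> f s" if "finite S" for S
    using that
  proof (induction S)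
    case (insert i S)
    then have eq: "x + (\<Sum>i\<in>insert i S. (y $ i) *\<^sub>R axis i 1) = (x + (\<Sum>i\<in>S. (y $ i) *\<^sub>R axis i 1)) + (y $ i) *\<^sub>R axis i 1"
      by (simp add: add_ac)
    show ?case
    proof (cases "y $ i = 0")
      case False
      then have "0 < y $ i" using y[of i] by simp
      from superlevel_upward[OF \<Gamma> f insert.IH this] show ?thesis unfolding eq .
    qed (use insert eq in simp)
  qed (use x in simp)
  from this[of UNIV] have "x + (\<Sum>i\<in>UNIV. (y $ i) *\<^sub>R axis i 1) \<in> superlevel \<Gamma> f s" by simp
  moreover have "(\<Sum>i\<in>UNIV. (y $ i) *\<^sub>R axis i 1) = y"
    using basis_expansion[of y] by (simp add: scalar_mult_eq_scaleR)
  ultimately show ?thesis by simp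
qed

text \<open>
  Monotonicity turns the limit along the diagonal into a supremum, which also shows that the limit exists.
\<close>

lemma diagonal_value_exceeds:
  fixes \<Gamma> :: "(real ^ 'n) set"
  assumes \<Gamma>: "admissible_cone \<Gamma>" and f: "admissible_function \<Gamma> f"
    and c: "c < Lim at_top (\<lambda>R::real. ereal (f (\<chi> i. R)))"
  shows "\<exists>R>0. c < ereal (f (\<chi> i. R))"
proof -
  define g where "g R = ereal (f (\<chi> i. R))" for R
  have mono: "g R \<le> g R'" if "0 < R" "R \<le> R'" for R R'
  proof -
    have "(\<chi> i. R) \<in> closure \<Gamma>"
      using positive_in_admissible_cone[OF \<Gamma>, of "\<chi> i. R"] that closure_subset by auto
    then have "(\<chi> i. R) + (\<chi> i. R' - R) \<in> superlevel \<Gamma> f (f (\<chi> i. R))"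
      using that by (intro superlevel_add_nonneg[OF \<Gamma> f]) (auto simp: superlevel_def)
    moreover have "(\<chi> i. R) + (\<chi> i. R' - R) = (\<chi> i. R' :: real ^ 'n)" by (simp add: vec_eq_iff)
    ultimately show ?thesis by (simp add: superlevel_def g_def)
  qed
  define l where "l = (SUP R\<in>{0<..}. g R)"
  have "(g \<longlongrightarrow> l) at_top"
  proof (rule increasing_tendsto)
    show "\<forall>\<^sub>F R in at_top. g R \<le> l"
      using eventually_gt_at_top[of "0::real"] by (rule eventually_mono) (auto simp: l_def intro: SUP_upper)
    fix x assume "x < l"
    then obtain R where R: "0 < R" "x < g R" unfolding l_def less_SUP_iff by auto
    show "\<forall>\<^sub>F R in at_top. x < g R"
      using eventually_ge_at_top[of R] by (rule eventually_mono) (use R mono in \<open>meson less_le_trans\<close>)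
  qed
  then have "Lim at_top g = l" by (intro tendsto_Lim) auto
  then have "c < l" using c by (simp add: g_def[abs_def])
  then show ?thesis unfolding l_def less_SUP_iff g_def by auto
qed

section \<open>Test functions\<close>

lemma twice_diff_cmult:
  assumes q: "twice_diff q q1 q2"
  shows "twice_diff (\<lambda>x. c * q x) (\<lambda>x. c *\<^sub>R q1 x) (\<lambda>x. c *\<^sub>R q2 x)"
  unfolding twice_diff_def scaleR_blinfun.rep_eq real_scaleR_def
  by (intro conjI allI has_derivative_mult_right has_derivative_scaleR_right continuous_on_scaleR continuous_on_const twice_diffD[OF q])

lemma twice_diff_shift:
  assumes q: "twice_diff q q1 q2"
  shows "twice_diff (\<lambda>x. q (x + a)) (\<lambda>x. q1 (x + a)) (\<lambda>x. q2 (x + a))"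
proof -
  have d: "((\<lambda>x. x + a) has_derivative (\<lambda>h. h)) (at x)" for x
    by (auto intro!: derivative_eq_intros)
  have "continuous_on UNIV (\<lambda>x. x + a)" by (intro continuous_intros)
  from continuous_on_compose2[OF twice_diffD(5)[OF q] this] have "continuous_on UNIV (\<lambda>x. q2 (x + a))" by simp
  then show ?thesis
    using has_derivative_compose[OF d twice_diffD(1)[OF q]] has_derivative_compose[OF d twice_diffD(2)[OF q]]
    by (simp add: twice_diff_def)
qed

lemma twice_diff_norm_square:
  fixes R :: real
  shows "\<exists>p1 p2. twice_diff (\<lambda>x::'a::euclidean_space. R * (x \<bullet> x)) p1 p2 \<and>
     (\<forall>x h k. bilinear (p2 x) h k = 2 * R * (h \<bullet> k))"
proof -
  have "((\<lambda>s. R * s) has_real_derivative R) (at s)" "((\<lambda>s. R) has_real_derivative 0) (at s)" for s :: real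
    by (auto intro!: derivative_eq_intros)
  from radial_twice_diff[OF this, of 0] show ?thesis by simp
qed

lemma upper_test_twice_diff:
  assumes "twice_diff q q1 q2" "w z = q z" "\<forall>\<^sub>F y in nhds z. w y \<le> q y"
  shows "upper_test_function w z q"
  using assms C2_on_twice_diff[OF assms(1), of UNIV] by (auto simp: upper_test_function_def C2_near_def intro!: exI[of _ UNIV])

lemma lower_test_twice_diff:
  assumes "twice_diff q q1 q2" "w z = q z" "\<forall>\<^sub>F y in nhds z. q y \<le> w y"
  shows "lower_test_function w z q"
  using assms C2_on_twice_diff[OF assms(1), of UNIV] by (auto simp: lower_test_function_def C2_near_def intro!: exI[of _ UNIV])

text \<open>
  The complex Hessian depends on the second derivative only; this covers translations and added constants.
\<close>

lemma complex_hessian_cong: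
  assumes "twice_diff p p1 p2" "twice_diff q q1 q2" "p2 z = q2 y"
  shows "complex_hessian p z = complex_hessian q y"
  by (simp add: vec_eq_iff complex_hessian_twice_diff[OF assms(1)] complex_hessian_twice_diff[OF assms(2)] assms(3))

text \<open>
  A test function \<open>q\<close> for the perturbation yields the test function \<open>(q - \<tau> (R |z|^2 - B)) / (1 - \<tau>)\<close> for \<open>u\<close>.
  Since the complex Hessian of \<open>|z|^2\<close> is the identity matrix, \<open>hessian_operator_strictify\<close> recovers the
  Hessian of \<open>q\<close>.
\<close>

lemma perturbed_subsolution:
  fixes u :: "complex ^ 'n \<Rightarrow> real"
  assumes \<Gamma>: "admissible_cone \<Gamma>" and f: "admissible_function \<Gamma> f"
    and sub: "viscosity_subsolution (hessian_operator \<Gamma> f) \<psi> \<Omega> u" and y: "y \<in> \<Omega>"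
    and \<tau>: "0 < \<tau>" "\<tau> < 1" and R: "0 < R" and q: "twice_diff q q1 q2"
    and eq: "(1 - \<tau>) * u y + \<tau> * (R * (y \<bullet> y) - B) = q y"
    and le: "\<forall>\<^sub>F z in nhds y. (1 - \<tau>) * u z + \<tau> * (R * (z \<bullet> z) - B) \<le> q z"
  shows "ereal ((1 - \<tau>) * \<psi> y (u y) + \<tau> * f (\<chi> i. R)) \<le> hessian_operator \<Gamma> f (complex_hessian q y)"
proof -
  obtain p1 p2 where p: "twice_diff (\<lambda>x::complex ^ 'n. (- \<tau> * R) * (x \<bullet> x)) p1 p2"
    and p2: "\<And>x h k. bilinear (p2 x) h k = 2 * (- \<tau> * R) * (h \<bullet> k)"
    using twice_diff_norm_square[of "- \<tau> * R"] by blast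
  define c where "c = 1 / (1 - \<tau>)"
  have c: "0 < c" "c * (1 - \<tau>) = 1" using \<tau> by (auto simp: c_def)
  define q' where "q' x = c * ((q x + (- \<tau> * R) * (x \<bullet> x)) + \<tau> * B)" for x
  have q': "twice_diff q' (\<lambda>x. c *\<^sub>R (q1 x + p1 x)) (\<lambda>x. c *\<^sub>R (q2 x + p2 x))"
    unfolding q'_def by (rule twice_diff_cmult[OF twice_diff_add_const[OF twice_diff_add[OF q p]]])
  have val: "q' z - u z = c * (q z - ((1 - \<tau>) * u z + \<tau> * (R * (z \<bullet> z) - B)))" for z
  proof -
    have "c * ((1 - \<tau>) * u z) = u z" using c(2) by (simp flip: mult.assoc)
    then show ?thesis by (simp add: q'_def algebra_simps)
  qed
  have "upper_test_function u y q'"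
  proof (rule upper_test_twice_diff[OF q'])
    show "u y = q' y" using val[of y] eq by simp
    show "\<forall>\<^sub>F z in nhds y. u z \<le> q' z"
      using le
    proof (rule eventually_mono)
      fix z assume "(1 - \<tau>) * u z + \<tau> * (R * (z \<bullet> z) - B) \<le> q z"
      then have "0 \<le> q' z - u z" unfolding val using c(1) by simp
      then show "u z \<le> q' z" by simp
    qed
  qed
  then have F: "ereal (\<psi> y (u y)) \<le> hessian_operator \<Gamma> f (complex_hessian q' y)"
    using sub y by (auto simp: viscosity_subsolution_def)
  have "(1 - \<tau>) *\<^sub>R complex_hessian q' y + mat (complex_of_real (\<tau> * R)) = complex_hessian q y"
  proof -
    have "((1 - \<tau>) *\<^sub>R complex_hessian q' y + mat (complex_of_real (\<tau> * R))) $ a $ b = complex_hessian q y $ a $ b" for a b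
    proof -
      have i: "axis a 1 \<bullet> (axis b 1 :: complex ^ 'n) = (if a = b then 1 else 0)" "axis a \<i> \<bullet> (axis b \<i> :: complex ^ 'n) = (if a = b then 1 else 0)"
        "axis a 1 \<bullet> (axis b \<i> :: complex ^ 'n) = 0" "axis a \<i> \<bullet> (axis b 1 :: complex ^ 'n) = 0"
        by (auto simp: inner_axis_axis inner_complex_def)
      have cc: "(1 - \<tau>) * c = 1" using c by (simp add: mult.commute)
      have "complex_hessian q' y $ a $ b = complex_of_real c * (complex_hessian q y $ a $ b - complex_of_real (\<tau> * R) * (if a = b then 1 else 0))"
        unfolding complex_hessian_twice_diff[OF q'] complex_hessian_twice_diff[OF q]
        by (simp add: scaleR_blinfun.rep_eq plus_blinfun.rep_eq p2 i field_simps)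
      then have "((1 - \<tau>) *\<^sub>R complex_hessian q' y + mat (complex_of_real (\<tau> * R))) $ a $ b
         = complex_of_real ((1 - \<tau>) * c) * (complex_hessian q y $ a $ b - complex_of_real (\<tau> * R) * (if a = b then 1 else 0)) + complex_of_real (\<tau> * R) * (if a = b then 1 else 0)"
        by (simp add: mat_def scaleR_conv_of_real[where 'a=complex] mult.assoc)
      then show ?thesis unfolding cc by simp
    qed
    then show ?thesis by (simp add: vec_eq_iff)
  qed
  then show ?thesis using hessian_operator_strictify[OF \<Gamma> f F _ _ R, of \<tau>] \<tau> by simp
qed

section \<open>Comparison\<close>

text \<open>
  If the mollified function failed the inequality, a linear functional would separate its complex Hessian
  from the superlevel set. The same functional gives a linear inequality satisfied by \<open>w\<close> in the viscosity
  sense, hence by its mollification, which is a contradiction.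
\<close>

lemma mollification_preserves_subsolution:
  fixes w :: "complex ^ 'n \<Rightarrow> real"
  assumes \<Gamma>: "admissible_cone \<Gamma>" and f: "admissible_function \<Gamma> f" and m: "mollifier \<delta> \<rho> \<rho>1 \<rho>2"
    and w: "uniformly_continuous_on UNIV w" "\<And>x. \<bar>w x\<bar> \<le> N" and r: "\<delta> < r"
    and sub: "\<And>x q q1 q2. x \<in> cball x0 r \<Longrightarrow> twice_diff q q1 q2 \<Longrightarrow> w x = q x \<Longrightarrow> \<forall>\<^sub>F y in nhds x. w y \<le> q y \<Longrightarrow>
       ereal s \<le> hessian_operator \<Gamma> f (complex_hessian q x)"
  shows "ereal s \<le> hessian_operator \<Gamma> f (complex_hessian (conv w \<rho>) x0)"
proof (rule ccontr)
  assume low: "\<not> ereal s \<le> hessian_operator \<Gamma> f (complex_hessian (conv w \<rho>) x0)"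
  interpret mollifier \<delta> \<rho> \<rho>1 \<rho>2 by (rule m)
  have wc: "continuous_on UNIV w" by (rule uniformly_continuous_imp_continuous[OF w(1)])
  obtain q1 q2 where q: "twice_diff (conv w \<rho>) q1 q2"
    and q2: "\<And>x h l. bilinear (q2 x) h l = conv w (\<lambda>z. bilinear (\<rho>2 z) h l) x"
    using conv_twice_diff[OF wc] by blast
  have herm: "hermitian_matrix (complex_hessian (conv w \<rho>) x0)"
  proof (rule complex_hessian_hermitian[OF q])
    fix h k
    have "(\<lambda>z. bilinear (\<rho>2 z) h k) = (\<lambda>z. bilinear (\<rho>2 z) k h)"
      using sym by auto
    then show "bilinear (q2 x0) h k = bilinear (q2 x0) k h"
      unfolding q2 by simp
  qed
  obtain V a b where a: "\<And>k. 0 \<le> a $ k"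
    and ab: "a \<bullet> real_diagonal (unitary_conj V (complex_hessian (conv w \<rho>) x0)) < b"
      "\<And>K. ereal s \<le> hessian_operator \<Gamma> f K \<Longrightarrow> b \<le> a \<bullet> real_diagonal (unitary_conj V K)"
    using hessian_operator_separation[OF \<Gamma> f herm low] by blast
  let ?e = "levi_directions V a"
  have "viscosity_linear UNIV ?e (cball x0 r) b w"
    unfolding viscosity_linear_def
  proof (intro ballI allI impI)
    fix x p p1 p2
    assume x: "x \<in> cball x0 r" "twice_diff p p1 p2" "w x = p x" "\<forall>\<^sub>F y in nhds x. w y \<le> p y"
    have "b \<le> a \<bullet> real_diagonal (unitary_conj V (complex_hessian p x))" by (rule ab(2)[OF sub[OF x]])
    then show "b \<le> second_order UNIV ?e (p2 x)"
      by (simp add: weighted_diagonal_hessian[OF x(2) a])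
  qed
  then have "b \<le> conv w (L_kernel UNIV ?e) x0"
    by (rule mollified_subsolution[OF finite w]) (use r in auto)
  also have "conv w (L_kernel UNIV ?e) x0 = second_order UNIV ?e (q2 x0)"
    unfolding q2 L_kernel_def[abs_def]
    by (rule conv_kernel_sum[OF wc cont_apply, where r=\<delta>]) (simp add: supp2)
  also have "\<dots> = a \<bullet> real_diagonal (unitary_conj V (complex_hessian (conv w \<rho>) x0))"
    by (simp add: weighted_diagonal_hessian[OF q a])
  finally show False using ab(1) by linarith
qed

lemma coincidence_set_compact:
  fixes W :: "'a::metric_space set"
  assumes W: "compact W" and u: "usc_on W u" and v: "lsc_on W v"
  shows "compact {x \<in> W. c \<le> u x - v x}"
proof -
  have "closed {x \<in> W. c \<le> u x - v x}"
    unfolding closed_sequential_limits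
  proof (intro allI impI, elim conjE)
    fix X x assume X: "\<forall>n. X n \<in> {x \<in> W. c \<le> u x - v x}" "X \<longlonglongrightarrow> x"
    then have x: "x \<in> W" using closed_sequentially[OF compact_imp_closed[OF W], of X x] by simp
    have "c \<le> u x - v x"
      by (rule usc_difference_limit[OF u v x X(2) _ X(2)]) (use X(1) in auto)
    then show "x \<in> {x \<in> W. c \<le> u x - v x}" using x by simp
  qed
  then have "compact (W \<inter> {x \<in> W. c \<le> u x - v x})" using W by (rule compact_Int_closed[rotated])
  moreover have "W \<inter> {x \<in> W. c \<le> u x - v x} = {x \<in> W. c \<le> u x - v x}" by auto
  ultimately show ?thesis by simp
qed

text \<open>
  A point \<open>x\<close> whose close companion \<open>y\<close> satisfies \<open>c \<le> u y - v x\<close> must be near the set \<open>{k. c \<le> u k - v k}\<close>: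
  otherwise a sequence of counterexamples with \<open>dist x y\<close> tending to 0 would converge into that set.
\<close>

lemma near_coincidence:
  fixes W :: "'a::metric_space set"
  assumes W: "compact W" and u: "usc_on W u" and v: "lsc_on W v" and r: "0 < r"
  shows "\<exists>\<epsilon>>0. \<forall>x\<in>W. \<forall>y\<in>W. dist x y \<le> \<epsilon> \<longrightarrow> c \<le> u y - v x \<longrightarrow> (\<exists>k\<in>W. c \<le> u k - v k \<and> dist x k < r)"
proof (rule ccontr)
  assume neg: "\<not> ?thesis"
  have "\<exists>x y. x \<in> W \<and> y \<in> W \<and> dist x y \<le> 1 / real (Suc n) \<and> c \<le> u y - v x \<and> (\<forall>k\<in>W. c \<le> u k - v k \<longrightarrow> r \<le> dist x k)" for n
  proof -
    have "0 < 1 / real (Suc n)" by simp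
    then show ?thesis using neg by (meson linorder_not_le)
  qed
  then obtain X Y where X: "\<And>n. X n \<in> W" and Y: "\<And>n. Y n \<in> W" and d: "\<And>n. dist (X n) (Y n) \<le> 1 / real (Suc n)"
    and c: "\<And>n. c \<le> u (Y n) - v (X n)" and far: "\<And>n k. k \<in> W \<Longrightarrow> c \<le> u k - v k \<Longrightarrow> r \<le> dist (X n) k"
    by metis
  obtain x \<phi> where x: "x \<in> W" and \<phi>: "strict_mono \<phi>" and lim: "(X \<circ> \<phi>) \<longlonglongrightarrow> x"
    using W X unfolding compact_def by metis
  have "(\<lambda>n. dist (X n) (Y n)) \<longlonglongrightarrow> 0"
    by (rule tendsto_sandwich[OF _ _ tendsto_const LIMSEQ_inverse_real_of_nat])
       (use d in \<open>auto simp: inverse_eq_divide intro!: always_eventually\<close>)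
  from LIMSEQ_subseq_LIMSEQ[OF this \<phi>] have dist0: "(\<lambda>n. dist ((X \<circ> \<phi>) n) ((Y \<circ> \<phi>) n)) \<longlonglongrightarrow> 0"
    by (simp add: o_def)
  have "(\<lambda>n. dist ((X \<circ> \<phi>) n) ((Y \<circ> \<phi>) n) + dist ((X \<circ> \<phi>) n) x) \<longlonglongrightarrow> 0 + 0"
    by (rule tendsto_add[OF dist0]) (use lim in \<open>simp add: tendsto_dist_iff[of "X \<circ> \<phi>"]\<close>)
  then have "(\<lambda>n. dist ((X \<circ> \<phi>) n) ((Y \<circ> \<phi>) n) + dist ((X \<circ> \<phi>) n) x) \<longlonglongrightarrow> 0" by simp
  from tendsto_sandwich[OF _ _ tendsto_const this, of "\<lambda>n. dist ((Y \<circ> \<phi>) n) x"]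
  have "(\<lambda>n. dist ((Y \<circ> \<phi>) n) x) \<longlonglongrightarrow> 0"
    by (simp add: dist_triangle3)
  then have limY: "(Y \<circ> \<phi>) \<longlonglongrightarrow> x" by (rule tendsto_dist_iff[THEN iffD2])
  have "c \<le> u x - v x"
    by (rule usc_difference_limit[OF u v x limY _ lim]) (use X Y c in auto)
  moreover have "\<forall>\<^sub>F n in sequentially. dist ((X \<circ> \<phi>) n) x < r" by (rule tendstoD[OF lim r])
  then obtain n where "dist (X (\<phi> n)) x < r" by (auto dest: eventually_happens)
  ultimately show False using far[OF x, of "\<phi> n"] by simp
qed


theorem theorem1p3:
  fixes \<Omega> :: "(complex ^ 'n) set"
    and \<psi> :: "complex ^ 'n \<Rightarrow> real \<Rightarrow> real"
    and \<Gamma> :: "(real ^ 'n) set"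
    and f :: "real ^ 'n \<Rightarrow> real"
    and u v :: "complex ^ 'n \<Rightarrow> real"
  assumes "open \<Omega>" and "connected \<Omega>" and "\<Omega> \<noteq> {}" and "bounded \<Omega>"
    and "continuous_on (closure \<Omega> \<times> UNIV) (\<lambda>(z, s). \<psi> z s)"
    and "\<forall>z\<in>closure \<Omega>. \<forall>s. 0 \<le> \<psi> z s"
    and "\<forall>z\<in>closure \<Omega>. mono (\<psi> z)"
    and "admissible_cone \<Gamma>"
    and "admissible_function \<Gamma> f"
    and "bounded (u ` closure \<Omega>)" and "usc_on (closure \<Omega>) u"
    and "bounded (v ` closure \<Omega>)" and "lsc_on (closure \<Omega>) v"
    and "viscosity_subsolution (hessian_operator \<Gamma> f) \<psi> \<Omega> u"
    and "viscosity_supersolution (hessian_operator \<Gamma> f) \<psi> \<Omega> v"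
    and "\<forall>z\<in>frontier \<Omega>. u z \<le> v z"
    and "\<forall>K. compact (closure K) \<and> closure K \<subseteq> \<Omega> \<longrightarrow>
           Lim at_top (\<lambda>R::real. ereal (f (\<chi> i. R))) > (SUP z\<in>K. ereal (\<psi> z (v z)))"
  shows "\<forall>z\<in>\<Omega>. u z \<le> v z"
proof (rule ccontr)
  assume "\<not> (\<forall>z\<in>\<Omega>. u z \<le> v z)"
  then obtain z0 where z0: "z0 \<in> \<Omega>" "v z0 < u z0" by force
  define W where "W = closure \<Omega>"
  have \<Omega>W: "\<Omega> \<subseteq> W" and z0W: "z0 \<in> W" using z0 closure_subset by (auto simp: W_def)
  have W: "compact W" using assms(4) by (simp add: W_def compact_closure)
  have usc: "usc_on W u" and lsc: "lsc_on W v" using assms by (auto simp: W_def)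
  note sub = assms(14) and sup = assms(15)
  note \<Gamma> = assms(8) and f = assms(9)
  define M where "M = u z0 - v z0"
  have M: "0 < M" using z0 by (simp add: M_def)
  obtain Cu where Cu: "\<And>x. x \<in> W \<Longrightarrow> \<bar>u x\<bar> \<le> Cu" using assms(10) by (auto simp: bounded_iff W_def)
  obtain Cv where Cv: "\<And>x. x \<in> W \<Longrightarrow> \<bar>v x\<bar> \<le> Cv" using assms(12) by (auto simp: bounded_iff W_def)
  define C0 where "C0 = max Cu Cv"
  have C0: "\<bar>u x\<bar> \<le> C0" "\<bar>v x\<bar> \<le> C0" if "x \<in> W" for x
    using Cu[OF that] Cv[OF that] by (auto simp: C0_def)
  have C0pos: "0 \<le> C0" using C0(1)[OF z0W] by linarith

  define K where "K = {x \<in> W. M / 2 \<le> u x - v x}"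
  have K: "compact K" unfolding K_def by (rule coincidence_set_compact[OF W usc lsc])
  have "K \<subseteq> \<Omega>"
  proof
    fix x assume x: "x \<in> K"
    show "x \<in> \<Omega>"
    proof (rule ccontr)
      assume "x \<notin> \<Omega>"
      then have "x \<in> frontier \<Omega>" using x assms(1) by (simp add: K_def W_def frontier_def interior_open)
      then have "u x \<le> v x" using assms(16) by blast
      then show False using x M by (simp add: K_def)
    qed
  qed
  then obtain r0 where r0: "0 < r0" "(\<Union>x\<in>K. cball x r0) \<subseteq> \<Omega>"
    using compact_subset_open_imp_cball_epsilon_subset[OF K assms(1)] by blast
  define r1 where "r1 = r0 / 2"
  have r1: "0 < r1" using r0 by (simp add: r1_def)
  define K' where "K' = {x + y | x y. x \<in> K \<and> y \<in> cball 0 r1}"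
  have K': "compact K'" unfolding K'_def by (rule compact_sums[OF K compact_cball])
  have near: "x \<in> K' \<and> cball x r1 \<subseteq> \<Omega>" if k: "k \<in> K" "dist x k < r1" for x k
  proof
    have "x = k + (x - k)" "x - k \<in> cball 0 r1" using k by (auto simp: dist_norm norm_minus_commute)
    then show "x \<in> K'" using k(1) unfolding K'_def by blast
    show "cball x r1 \<subseteq> \<Omega>"
    proof
      fix y assume "y \<in> cball x r1"
      then have "dist k y \<le> r0" using k(2) dist_triangle[of k y x] by (simp add: r1_def dist_commute)
      then have "y \<in> cball k r0" by simp
      then show "y \<in> \<Omega>" using r0(2) k(1) by blast
    qed
  qed
  have "K' \<subseteq> \<Omega>"
  proof
    fix z assume "z \<in> K'"
    then obtain x y where "z = x + y" "x \<in> K" "norm y \<le> r1" by (auto simp: K'_def)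
    then have "z \<in> cball x r0" "x \<in> K" using r0(1) by (auto simp: dist_norm r1_def)
    then show "z \<in> \<Omega>" using r0(2) by blast
  qed
  moreover have "closure K' = K'" using K' by (simp add: compact_imp_closed)
  ultimately have lim: "(SUP z\<in>K'. ereal (\<psi> z (v z))) < Lim at_top (\<lambda>R::real. ereal (f (\<chi> i. R)))"
    using assms(17)[rule_format, of K'] K' by metis
  obtain R where R: "0 < R" and fR: "(SUP z\<in>K'. ereal (\<psi> z (v z))) < ereal (f (\<chi> i. R))"
    using diagonal_value_exceeds[OF \<Gamma> f lim] by blast
  define fR where "fR = f (\<chi> i. R)"
  obtain s1 where s1: "(SUP z\<in>K'. ereal (\<psi> z (v z))) < ereal s1" "ereal s1 < ereal fR"
    using ereal_dense2[OF fR] by (auto simp: fR_def)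
  have \<psi>s1: "\<psi> z (v z) \<le> s1" if "z \<in> K'" for z
  proof -
    have "ereal (\<psi> z (v z)) \<le> (SUP z\<in>K'. ereal (\<psi> z (v z)))" using that by (rule SUP_upper)
    then show ?thesis using s1(1) by (meson ereal_less_eq(3) le_less_trans less_imp_le)
  qed

  obtain D where D: "\<And>x. x \<in> W \<Longrightarrow> norm x \<le> D"
    using compact_imp_bounded[OF W] by (auto simp: bounded_iff)
  \<comment> \<open>chosen so that \<open>P \<le> u\<close>, and hence \<open>U \<le> u\<close>, on the closure of \<open>\<Omega>\<close>\<close>
  define B where "B = C0 + R * D\<^sup>2"
  define P where "P x = R * (x \<bullet> x) - B" for x :: "complex ^ 'n"
  have P: "P x \<le> u x" "u x - P x \<le> C0 + B" if "x \<in> W" for x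
  proof -
    have "x \<bullet> x \<le> D\<^sup>2" using D[OF that] by (simp add: dot_square_norm power_mono)
    then have "R * (x \<bullet> x) \<le> R * D\<^sup>2" using R by (intro mult_left_mono) auto
    then show "P x \<le> u x" using C0(1)[OF that] by (simp add: P_def B_def abs_le_iff)
    have "0 \<le> R * (x \<bullet> x)" using R by simp
    then show "u x - P x \<le> C0 + B" using C0(1)[OF that] by (simp add: P_def abs_le_iff)
  qed
  have CB: "0 \<le> C0 + B" using P[OF z0W] by linarith
  \<comment> \<open>small enough for the excess of \<open>U\<close> over \<open>v\<close> at \<open>z0\<close> to stay above \<open>3/4 M\<close>\<close>
  define \<tau> where "\<tau> = min (1/2) (M / (4 * (C0 + B + 1)))"
  have \<tau>: "0 < \<tau>" "\<tau> < 1" "\<tau> * (C0 + B) \<le> M / 4"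
  proof -
    have "0 < M / (4 * (C0 + B + 1))" using M CB by simp
    then show "0 < \<tau>" by (simp add: \<tau>_def)
    show "\<tau> < 1" by (simp add: \<tau>_def)
    have "\<tau> \<le> M / (4 * (C0 + B + 1))" by (simp add: \<tau>_def)
    then have "\<tau> * (4 * (C0 + B + 1)) \<le> M" using CB by (simp add: pos_le_divide_eq)
    then show "\<tau> * (C0 + B) \<le> M / 4" using \<open>0 < \<tau>\<close> by (simp add: algebra_simps)
  qed
  define U where "U x = (1 - \<tau>) * u x + \<tau> * P x" for x
  have U: "U x \<le> u x" "u x - M / 4 \<le> U x" if "x \<in> W" for x
  proof -
    have e: "u x - U x = \<tau> * (u x - P x)" by (simp add: U_def algebra_simps)
    have "0 \<le> \<tau> * (u x - P x)" using \<tau> P(1)[OF that] by simp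
    then show "U x \<le> u x" using e by simp
    have "\<tau> * (u x - P x) \<le> \<tau> * (C0 + B)" using \<tau> P(2)[OF that] by (intro mult_left_mono) auto
    then show "u x - M / 4 \<le> U x" using e \<tau>(3) by linarith
  qed
  define C where "C = C0 + M"
  have C: "0 < C" "\<And>x. x \<in> W \<Longrightarrow> \<bar>U x\<bar> \<le> C" "\<And>x. x \<in> W \<Longrightarrow> \<bar>v x\<bar> \<le> C"
  proof -
    show "0 < C" using C0pos M by (simp add: C_def)
    show "\<bar>U x\<bar> \<le> C" if "x \<in> W" for x using U[OF that] C0(1)[OF that] M unfolding C_def by linarith
    show "\<bar>v x\<bar> \<le> C" if "x \<in> W" for x using C0(2)[OF that] M unfolding C_def by linarith
  qed
  have uscU: "usc_on W U"
  proof -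
    have "continuous_on W (\<lambda>x. \<tau> * P x)" unfolding P_def by (intro continuous_intros)
    then show ?thesis unfolding U_def using \<tau>
      by (intro usc_on_add usc_on_cmult usc continuous_imp_usc_on) auto
  qed

  \<comment> \<open>the perturbation gains \<open>2 \<kappa>\<close>, of which the oscillation of \<open>\<psi>\<close> may cost \<open>\<kappa>\<close>\<close>
  define \<kappa> where "\<kappa> = \<tau> * (fR - s1) / 2"
  have \<kappa>: "0 < \<kappa>" using \<tau> s1(2) by (simp add: \<kappa>_def)
  have "uniformly_continuous_on (W \<times> {-C..C}) (\<lambda>(z, s). \<psi> z s)"
    using assms(5) by (intro compact_uniformly_continuous compact_Times W compact_Icc)
      (auto intro: continuous_on_subset simp: W_def)
  from this[unfolded uniformly_continuous_on_def, rule_format, OF \<kappa>]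
  obtain \<eta> where \<eta>: "0 < \<eta>" and \<eta>': "\<forall>p\<in>W \<times> {-C..C}. \<forall>p'\<in>W \<times> {-C..C}. dist p' p < \<eta> \<longrightarrow>
      dist ((\<lambda>(z, s). \<psi> z s) p') ((\<lambda>(z, s). \<psi> z s) p) < \<kappa>" by blast
  have modulus: "\<psi> x s - \<kappa> \<le> \<psi> y s" if "x \<in> W" "y \<in> W" "\<bar>s\<bar> \<le> C" "dist y x < \<eta>" for x y s
  proof -
    have "dist (\<psi> y s) (\<psi> x s) < \<kappa>"
      using \<eta>'[rule_format, of "(x, s)" "(y, s)"] that by (simp add: dist_Pair_Pair abs_le_iff)
    then show ?thesis by (simp add: dist_real_def abs_less_iff)
  qed
  obtain \<epsilon>0 where \<epsilon>0: "0 < \<epsilon>0" and coincide: "\<And>x y. x \<in> W \<Longrightarrow> y \<in> W \<Longrightarrow> dist x y \<le> \<epsilon>0 \<Longrightarrow>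
      M / 2 \<le> u y - v x \<Longrightarrow> \<exists>k\<in>W. M / 2 \<le> u k - v k \<and> dist x k < r1"
    using near_coincidence[OF W usc lsc r1, of "M / 2"] by blast

  define m where "m = min \<epsilon>0 (min \<eta> r1)"
  have m: "0 < m" "m \<le> \<epsilon>0" "m \<le> \<eta>" "m \<le> r1" using \<epsilon>0 \<eta> r1 by (auto simp: m_def)
  \<comment> \<open>so steep that the sup-convolution is attained within \<open>m / 4\<close> and the mollified function differs
    from it by at most \<open>M / 8\<close>\<close>
  define L where "L = max 1 (max (8 * C / m) (max (8 / m) (8 / M)))"
  have L: "1 \<le> L" "8 * C / m \<le> L" "8 / m \<le> L" "8 / M \<le> L" by (auto simp: L_def)
  have Lpos: "0 < L" using L by linarith
  have L': "2 * C / L \<le> m / 4" "1 / L \<le> m / 8" "1 / L \<le> M / 8"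
    using L m M Lpos by (auto simp: field_simps)
  define \<delta> where "\<delta> = 1 / L\<^sup>2"
  have \<delta>: "0 < \<delta>" "L * \<delta> = 1 / L" "\<delta> \<le> 1 / L"
  proof -
    show "0 < \<delta>" using Lpos by (simp add: \<delta>_def)
    show "L * \<delta> = 1 / L" using Lpos by (simp add: \<delta>_def power2_eq_square)
    have "1 * \<delta> \<le> L * \<delta>" using L(1) \<open>0 < \<delta>\<close> by (intro mult_right_mono) auto
    then show "\<delta> \<le> 1 / L" using \<open>L * \<delta> = 1 / L\<close> by simp
  qed
  have "W \<noteq> {}" using z0W by blast
  obtain w where lip: "\<And>x y. \<bar>w x - w y\<bar> \<le> L * dist x y" and wC: "\<And>x. \<bar>w x\<bar> \<le> C"
    and wU: "\<And>x y. y \<in> W \<Longrightarrow> U y - L * dist x y \<le> w x" and att: "\<And>x. x \<in> W \<Longrightarrow> \<exists>y\<in>W. w x = U y - L * dist x y"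
    using sup_convolution_exists[OF W \<open>W \<noteq> {}\<close> uscU C(2) Lpos] by blast
  have attained: "\<exists>y\<in>W. w x = U y - L * dist x y \<and> dist x y \<le> m / 4" if "x \<in> W" for x
  proof -
    obtain y where y: "y \<in> W" "w x = U y - L * dist x y" using att[OF \<open>x \<in> W\<close>] by blast
    have "L * dist x y \<le> 2 * C" using C(2)[OF y(1)] wC[of x] y(2) by linarith
    then have "dist x y \<le> 2 * C / L" using Lpos by (simp add: pos_le_divide_eq mult.commute)
    then show ?thesis using y L'(1) by fastforce
  qed
  have wuc: "uniformly_continuous_on UNIV w"
    unfolding uniformly_continuous_on_def
  proof (intro allI impI)
    fix e :: real assume e: "0 < e"
    have "dist (w y) (w x) < e" if "dist y x < e / L" for x y
    proof -
      have "L * dist y x < e" using that Lpos by (simp add: pos_less_divide_eq mult.commute)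
      then show ?thesis using lip[of y x] by (simp add: dist_real_def)
    qed
    then show "\<exists>d>0. \<forall>x\<in>UNIV. \<forall>x'\<in>UNIV. dist x' x < d \<longrightarrow> dist (w x') (w x) < e"
      using e Lpos by (intro exI[of _ "e / L"]) auto
  qed
  have wc: "continuous_on UNIV w" by (rule uniformly_continuous_imp_continuous[OF wuc])
  obtain \<rho> :: "complex ^ 'n \<Rightarrow> real" and \<rho>1 \<rho>2 where mo: "mollifier \<delta> \<rho> \<rho>1 \<rho>2"
    using exists_mollifier[OF \<delta>(1)] by blast
  interpret mollifier \<delta> \<rho> \<rho>1 \<rho>2 by (rule mo)
  define \<omega> where "\<omega> = conv w \<rho>"
  have \<omega>w: "\<bar>\<omega> x - w x\<bar> \<le> 1 / L" for x
    unfolding \<omega>_def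
  proof (rule conv_near[OF wc])
    fix y assume "y \<in> cball x \<delta>"
    then have "L * dist y x \<le> L * \<delta>" using Lpos by (intro mult_left_mono) (auto simp: dist_commute)
    then show "\<bar>w y - w x\<bar> \<le> 1 / L" using lip[of y x] \<delta>(2) by simp
  qed
  obtain \<omega>1 \<omega>2 where \<omega>td: "twice_diff \<omega> \<omega>1 \<omega>2" using conv_twice_diff[OF wc] unfolding \<omega>_def by blast
  have \<omega>c: "continuous_on UNIV \<omega>" by (rule twice_diffD(3)[OF \<omega>td])
  have "\<exists>x\<in>W. \<forall>y\<in>W. \<omega> y + - v y \<le> \<omega> x + - v x"
  proof (rule usc_attains_sup[OF W \<open>W \<noteq> {}\<close>, where B="C + 1 / L + C"])
    show "usc_on W (\<lambda>x. \<omega> x + - v x)"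
      using lsc unfolding lsc_on_iff_usc_on
      by (rule usc_on_add[OF continuous_imp_usc_on[OF continuous_on_subset[OF \<omega>c subset_UNIV]]])
    show "\<omega> x + - v x \<le> C + 1 / L + C" if "x \<in> W" for x
      using C(3)[OF that] wC[of x] \<omega>w[of x] by linarith
  qed
  then obtain p where p: "p \<in> W" and max: "\<And>y. y \<in> W \<Longrightarrow> \<omega> y - v y \<le> \<omega> p - v p" by auto
  have "3 / 4 * M \<le> U z0 - v z0" using U(2)[OF z0W] by (simp add: M_def field_simps)
  moreover have "U z0 \<le> w z0" using wU[OF z0W, of z0] by simp
  moreover have "w z0 \<le> \<omega> z0 + 1 / L" "\<omega> p \<le> w p + 1 / L" using \<omega>w[of z0] \<omega>w[of p] by (simp_all add: abs_le_iff)
  ultimately have gap: "3 / 4 * M - 2 * (1 / L) \<le> w p - v p"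
    using max[OF z0W] by linarith
  obtain y0 where y0: "y0 \<in> W" "w p = U y0 - L * dist p y0" "dist p y0 \<le> m / 4" using attained[OF p] by blast
  have "0 \<le> L * dist p y0" using Lpos by simp
  then have "M / 2 \<le> u y0 - v p" using gap L'(3) U(1)[OF y0(1)] y0(2) by linarith
  moreover have "dist p y0 \<le> \<epsilon>0" using y0(3) m by linarith
  ultimately obtain k where "k \<in> K" "dist p k < r1" using coincide[OF p y0(1)] by (auto simp: K_def)
  from near[OF this] have pK: "p \<in> K'" and pball: "cball p r1 \<subseteq> \<Omega>" by auto
  have p\<Omega>: "p \<in> \<Omega>" using pball r1 by auto

  \<comment> \<open>the level for which the sup-convolution is a subsolution near \<open>p\<close>\<close>
  define s where "s = (1 - \<tau>) * (\<psi> p (v p) - \<kappa>) + \<tau> * fR"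
  have strict: "\<psi> p (v p) < s"
  proof -
    have "\<tau> * \<psi> p (v p) \<le> \<tau> * s1" using \<tau> \<psi>s1[OF pK] by (intro mult_left_mono) auto
    moreover have "0 < \<tau> * \<kappa>" using \<tau> \<kappa> by simp
    moreover have "s = \<psi> p (v p) - \<tau> * \<psi> p (v p) - \<kappa> + \<tau> * \<kappa> + \<tau> * fR" by (simp add: s_def algebra_simps)
    moreover have "2 * \<kappa> = \<tau> * fR - \<tau> * s1" by (simp add: \<kappa>_def right_diff_distrib)
    ultimately show ?thesis using \<kappa> by linarith
  qed
  have "ereal s \<le> hessian_operator \<Gamma> f (complex_hessian (conv w \<rho>) p)"
  proof (rule mollification_preserves_subsolution[OF \<Gamma> f mo wuc wC])
    show "\<delta> < 2 * \<delta>" using \<delta>(1) by simp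
    fix x q q1 q2
    assume x: "x \<in> cball p (2 * \<delta>)" and q: "twice_diff q q1 q2" and qx: "w x = q x" and wq: "\<forall>\<^sub>F y in nhds x. w y \<le> q y"
    have dx: "dist p x \<le> m / 4" using x \<delta>(3) L'(2) by simp
    have xW: "x \<in> W" using dx m pball \<Omega>W by (auto simp: subset_eq)
    obtain y where y: "y \<in> W" "w x = U y - L * dist x y" "dist x y \<le> m / 4" using attained[OF xW] by blast
    have dy: "dist p y \<le> m / 2" using dist_triangle[of p y x] dx y(3) by simp
    then have y\<Omega>: "y \<in> \<Omega>" using pball m by (auto simp: subset_eq)
    \<comment> \<open>translating the test function from \<open>x\<close> to the point \<open>y\<close> where the sup-convolution is attained\<close>
    define q' where "q' z = q (z + (x - y)) + L * dist x y" for z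
    have q': "twice_diff q' (\<lambda>z. q1 (z + (x - y))) (\<lambda>z. q2 (z + (x - y)))"
      unfolding q'_def by (rule twice_diff_add_const[OF twice_diff_shift[OF q]])
    have "((\<lambda>z. z + (x - y)) \<longlongrightarrow> y + (x - y)) (nhds y)"
      by (rule tendsto_add[OF filterlim_ident tendsto_const])
    then have "filterlim (\<lambda>z. z + (x - y)) (nhds x) (nhds y)" by simp
    from eventually_compose_filterlim[OF wq this]
    have "\<forall>\<^sub>F z in nhds y. w (z + (x - y)) \<le> q (z + (x - y))" .
    moreover have "\<forall>\<^sub>F z in nhds y. z \<in> \<Omega>" by (rule eventually_nhds_in_open[OF assms(1) y\<Omega>])
    ultimately have le: "\<forall>\<^sub>F z in nhds y. (1 - \<tau>) * u z + \<tau> * (R * (z \<bullet> z) - B) \<le> q' z"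
    proof eventually_elim
      case (elim z)
      have "dist (z + (x - y)) z = dist x y" by (simp add: dist_norm)
      then have "U z \<le> w (z + (x - y)) + L * dist x y" using wU[of z "z + (x - y)"] elim(2) \<Omega>W by auto
      then show ?case using elim(1) by (simp add: q'_def U_def P_def)
    qed
    have eq: "(1 - \<tau>) * u y + \<tau> * (R * (y \<bullet> y) - B) = q' y"
      using y(2) qx by (simp add: q'_def U_def P_def)
    have "complex_hessian q' y = complex_hessian q x" by (rule complex_hessian_cong[OF q' q]) simp
    with perturbed_subsolution[OF \<Gamma> f sub y\<Omega> \<tau>(1,2) R q' eq le]
    have F: "ereal ((1 - \<tau>) * \<psi> y (u y) + \<tau> * fR) \<le> hessian_operator \<Gamma> f (complex_hessian q x)"
      by (simp add: fR_def)
    have "v p \<le> u y"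
    proof -
      have "L * dist x p \<le> L * (2 * \<delta>)" using x Lpos by (intro mult_left_mono) (auto simp: dist_commute)
      moreover have "L * (2 * \<delta>) = 2 * (1 / L)" using \<delta>(2) by simp
      ultimately have "w p - 2 * (1 / L) \<le> w x" using lip[of x p] by linarith
      moreover have "w x \<le> U y" using y(2) Lpos by simp
      ultimately show ?thesis using gap L'(3) M U(1)[OF y(1)] by linarith
    qed
    have "\<psi> p (v p) - \<kappa> \<le> \<psi> y (v p)"
      by (rule modulus[OF p y(1) C(3)[OF p]]) (use dy m in \<open>simp add: dist_commute\<close>)
    also have "\<dots> \<le> \<psi> y (u y)"
      using assms(7) y(1) \<open>v p \<le> u y\<close> by (auto simp: W_def intro: monoD)
    finally have "(1 - \<tau>) * (\<psi> p (v p) - \<kappa>) \<le> (1 - \<tau>) * \<psi> y (u y)"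
      using \<tau> by (intro mult_left_mono) auto
    then have "ereal s \<le> ereal ((1 - \<tau>) * \<psi> y (u y) + \<tau> * fR)" by (simp add: s_def)
    then show "ereal s \<le> hessian_operator \<Gamma> f (complex_hessian q x)" using F by (rule order_trans)
  qed
  moreover have "hessian_operator \<Gamma> f (complex_hessian \<omega> p) \<le> ereal (\<psi> p (v p))"
  proof -
    define q where "q x = \<omega> x + (v p - \<omega> p)" for x
    have q: "twice_diff q \<omega>1 \<omega>2" unfolding q_def by (rule twice_diff_add_const[OF \<omega>td])
    have "\<forall>\<^sub>F x in nhds p. x \<in> \<Omega>" by (rule eventually_nhds_in_open[OF assms(1) p\<Omega>])
    then have "\<forall>\<^sub>F x in nhds p. q x \<le> v x"
    proof (rule eventually_mono)
      fix x assume "x \<in> \<Omega>"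
      then show "q x \<le> v x" using max[of x] \<Omega>W by (auto simp: q_def)
    qed
    then have "lower_test_function v p q" by (intro lower_test_twice_diff[OF q]) (simp add: q_def)
    moreover have "complex_hessian q p = complex_hessian \<omega> p" by (rule complex_hessian_cong[OF q \<omega>td refl])
    ultimately show ?thesis using sup p\<Omega> unfolding viscosity_supersolution_def by metis
  qed
  ultimately have "ereal s \<le> ereal (\<psi> p (v p))" unfolding \<omega>_def by (rule order_trans)
  then show False using strict by simp
qed

end
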